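(* There is an absolute constant $C>0$ such that the following holds. Let $g\in M^*(\mathbb{R}^d)$ with $\|g\|_2=1$, let $\Omega\subset\mathbb{R}^{2d}$ be a compact set with finite perimeter, and assume that $\|g\|_{M^*}^2|\partial\Omega|\ge1$. Let $$\widetilde\Omega:=\{z\in\mathbb{R}^{2d}:\rho_\Omega(z)>1/2\},$$ where $\rho_\Omega$ is the accumulated spectrogram of $\Omega$ with respect to $g$. Then $$|\Omega\,\triangle\,\widetilde\Omega|\le C\,\|g\|_{M^*}^2|\partial\Omega|,$$ where $\triangle$ denotes the symmetric difference of two sets and $|\partial\Omega|$ is the perimeter of $\Omega$.
   Context: For $f\in L^2(\mathbb{R}^d)$ and $z=(x,\xi)\in\mathbb{R}^d\times\mathbb{R}^d$, the short-time Fourier transform is $V_gf(x,\xi)=\int_{\mathbb{R}^d}f(t)\overline{g(t-x)}e^{-2\pi i\xi\cdot t}\,dt$. For compact $\Omega\subset\mathbb{R}^{2d}$, the time-frequency localization operator $H_\Omega$ on $L^2(\mathbb{R}^d)$ is $H_\Omega f(t)=\int_\Omega V_gf(x,\xi)g(t-x)e^{2\pi i\xi\cdot t}\,dx\,d\xi$, i.e. $H_\Omega f=V_g^*(1_\Omega\cdot V_gf)$; it is a compact positive operator. Let $\lambda_1^\Omega\ge\lambda_2^\Omega\ge\dots$ be its non-zero eigenvalues, counted with multiplicity and ordered non-increasingly, and $\{h_k^\Omega\}_{k\ge1}$ a corresponding orthonormal set of eigenfunctions. $|E|$ denotes the Lebesgue measure of a set $E$, and $A_\Omega=\lceil|\Omega|\rceil$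 is the smallest integer $\ge|\Omega|$. The accumulated spectrogram of $\Omega$ (with respect to $g$) is $\rho_\Omega(z)=\sum_{k=1}^{A_\Omega}|V_gh_k^\Omega(z)|^2$, $z\in\mathbb{R}^{2d}$. $M^*(\mathbb{R}^d)$ is the class of $g\in L^2(\mathbb{R}^d)$ with $\|g\|_{M^*}^2:=\int_{\mathbb{R}^{2d}}|z|\,|V_gg(z)|^2\,dz<+\infty$ ($|z|$ the Euclidean norm). For real-valued $f\in L^1(\mathbb{R}^n)$, $\mathrm{Var}(f)=\sup\{\int_{\mathbb{R}^n}f\,\mathrm{div}\,\phi\,dx:\phi\in C_c^1(\mathbb{R}^n,\mathbb{R}^n),\ |\phi(x)|\le1\ \forall x\}$ (Euclidean norm). A set $\Omega\subset\mathbb{R}^{2d}$ has finite perimeter if $1_\Omega$ has bounded variation, and then its perimeter is $|\partial\Omega|:=\mathrm{Var}(1_\Omega)$. *)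

theory Defs
  imports "HOL-Analysis.Analysis" "HOL-Library.Extended_Nat"
begin

text \<open>
  The constant of the theorem must not depend on the dimension, so the dimension is a number and
  not a type: a point of \<open>\<real>\<^sup>n\<close> is a function \<open>nat \<Rightarrow> real\<close> that is \<open>undefined\<close> outside \<open>{..<n}\<close>.
  The measure is the product Borel-Lebesgue measure. The topology is the product topology on
  \<open>nat \<Rightarrow> real\<close>, which induces the Euclidean topology on the carrier of \<open>\<real>\<^sup>n\<close>.
\<close>

type_synonym vec = "nat \<Rightarrow> real"

definition Rn :: "nat \<Rightarrow> vec set" where
  "Rn n = (\<Pi>\<^sub>E i\<in>{..<n}. UNIV)"

definition lebR :: "nat \<Rightarrow> vec measure" where
  "lebR n = (\<Pi>\<^sub>M i\<in>{..<n}. lborel)"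

abbreviation enorm :: "nat \<Rightarrow> vec \<Rightarrow> real" where
  "enorm n x \<equiv> L2_set x {..<n}"

definition dotp :: "nat \<Rightarrow> vec \<Rightarrow> vec \<Rightarrow> real" where
  "dotp n x y = (\<Sum>i<n. x i * y i)"

definition vdiff :: "nat \<Rightarrow> vec \<Rightarrow> vec \<Rightarrow> vec" where
  "vdiff n x y = (\<lambda>i\<in>{..<n}. x i - y i)"


section \<open>Square-integrable functions\<close>

text \<open>Elements of \<open>L\<^sup>2(\<real>\<^sup>d)\<close> are represented by Borel functions; equality in \<open>L\<^sup>2\<close> is equality
  almost everywhere and is written out where it is needed.\<close>

definition L2 :: "nat \<Rightarrow> (vec \<Rightarrow> complex) set" where
  "L2 d = {f \<in> borel_measurable (lebR d). integrable (lebR d) (\<lambda>t. (cmod (f t))\<^sup>2)}"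

definition L2_inner :: "nat \<Rightarrow> (vec \<Rightarrow> complex) \<Rightarrow> (vec \<Rightarrow> complex) \<Rightarrow> complex" where
  "L2_inner d f g = (LINT t|lebR d. f t * cnj (g t))"

definition L2_norm :: "nat \<Rightarrow> (vec \<Rightarrow> complex) \<Rightarrow> real" where
  "L2_norm d f = sqrt (LINT t|lebR d. (cmod (f t))\<^sup>2)"


section \<open>Short-time Fourier transform and localization operators\<close>

text \<open>A point \<open>z\<close> of \<open>\<real>\<^sup>2\<^sup>d\<close> stands for the pair \<open>(x, \<xi>)\<close> of its first and last \<open>d\<close> coordinates.\<close>

definition pos :: "nat \<Rightarrow> vec \<Rightarrow> vec" where
  "pos d z = (\<lambda>i\<in>{..<d}. z i)"

definition freq :: "nat \<Rightarrow> vec \<Rightarrow> vec" where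
  "freq d z = (\<lambda>i\<in>{..<d}. z (d + i))"

definition stft :: "nat \<Rightarrow> (vec \<Rightarrow> complex) \<Rightarrow> (vec \<Rightarrow> complex) \<Rightarrow> vec \<Rightarrow> complex" where
  "stft d g f z =
     (LINT t|lebR d. f t * cnj (g (vdiff d t (pos d z))) * cis (- 2 * pi * dotp d (freq d z) t))"

definition loc_op ::
  "nat \<Rightarrow> (vec \<Rightarrow> complex) \<Rightarrow> vec set \<Rightarrow> (vec \<Rightarrow> complex) \<Rightarrow> vec \<Rightarrow> complex" where
  "loc_op d g \<Omega> f t =
     (LINT z:\<Omega>|lebR (2 * d).
        stft d g f z * g (vdiff d t (pos d z)) * cis (2 * pi * dotp d (freq d z) t))"

definition is_eigenfunction ::
  "nat \<Rightarrow> (vec \<Rightarrow> complex) \<Rightarrow> vec set \<Rightarrow> complex \<Rightarrow> (vec \<Rightarrow> complex) \<Rightarrow> bool" where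
  "is_eigenfunction d g \<Omega> \<mu> f \<longleftrightarrow>
     f \<in> L2 d \<and> \<not> (AE t in lebR d. f t = 0) \<and>
     (AE t in lebR d. loc_op d g \<Omega> f t = \<mu> * f t)"

text \<open>
  \<open>eigensystem d g \<Omega> N lam h\<close>: \<open>lam\<close> lists the non-zero eigenvalues of \<open>H\<^sub>\<Omega>\<close> in non-increasing
  order and with multiplicity, and \<open>h\<close> lists corresponding orthonormal eigenfunctions. There are
  \<open>N \<le> \<infinity>\<close> of them, indexed from 1; values of \<open>lam\<close> and \<open>h\<close> at other indices are irrelevant.
  The last clause is the multiplicity count: for each eigenvalue \<open>\<mu> \<noteq> 0\<close> the orthonormal functions
  \<open>h k\<close> with \<open>lam k = \<mu>\<close> span (hence are a basis of) the eigenspace of \<open>\<mu>\<close>.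
\<close>

definition eigen_indices :: "enat \<Rightarrow> nat set" where
  "eigen_indices N = {k. 1 \<le> k \<and> enat k \<le> N}"

definition eigensystem ::
  "nat \<Rightarrow> (vec \<Rightarrow> complex) \<Rightarrow> vec set \<Rightarrow> enat \<Rightarrow> (nat \<Rightarrow> real) \<Rightarrow> (nat \<Rightarrow> vec \<Rightarrow> complex) \<Rightarrow> bool"
where
  "eigensystem d g \<Omega> N lam h \<longleftrightarrow>
     (\<forall>k\<in>eigen_indices N. lam k \<noteq> 0 \<and> is_eigenfunction d g \<Omega> (complex_of_real (lam k)) (h k)) \<and>
     (\<forall>j\<in>eigen_indices N. \<forall>k\<in>eigen_indices N. j \<le> k \<longrightarrow> lam k \<le> lam j) \<and>
     (\<forall>j\<in>eigen_indices N. \<forall>k\<in>eigen_indices N.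
        L2_inner d (h j) (h k) = (if j = k then 1 else 0)) \<and>
     (\<forall>\<mu> f. \<mu> \<noteq> 0 \<longrightarrow> is_eigenfunction d g \<Omega> \<mu> f \<longrightarrow>
        (\<exists>F c. finite F \<and> F \<subseteq> {k \<in> eigen_indices N. complex_of_real (lam k) = \<mu>} \<and>
               (AE t in lebR d. f t = (\<Sum>k\<in>F. c k * h k t))))"

definition ceil_measure :: "nat \<Rightarrow> vec set \<Rightarrow> nat" where
  "ceil_measure n \<Omega> = nat \<lceil>measure (lebR n) \<Omega>\<rceil>"

definition acc_spectrogram ::
  "nat \<Rightarrow> (vec \<Rightarrow> complex) \<Rightarrow> vec set \<Rightarrow> (nat \<Rightarrow> vec \<Rightarrow> complex) \<Rightarrow> vec \<Rightarrow> real" where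
  "acc_spectrogram d g \<Omega> h z = (\<Sum>k = 1..ceil_measure (2 * d) \<Omega>. (cmod (stft d g (h k) z))\<^sup>2)"


section \<open>The modulation class \<open>M\<^sup>*\<close>\<close>

definition Mstar :: "nat \<Rightarrow> (vec \<Rightarrow> complex) set" where
  "Mstar d =
     {g \<in> L2 d. integrable (lebR (2 * d)) (\<lambda>z. enorm (2 * d) z * (cmod (stft d g g z))\<^sup>2)}"

definition Mstar_norm :: "nat \<Rightarrow> (vec \<Rightarrow> complex) \<Rightarrow> real" where
  "Mstar_norm d g = sqrt (LINT z|lebR (2 * d). enorm (2 * d) z * (cmod (stft d g g z))\<^sup>2)"


section \<open>Variation and perimeter\<close>

definition partial_derivative :: "nat \<Rightarrow> (vec \<Rightarrow> real) \<Rightarrow> vec \<Rightarrow> real" where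
  "partial_derivative j u x = deriv (\<lambda>s. u (x(j := s))) (x j)"

definition C1_on_Rn :: "nat \<Rightarrow> (vec \<Rightarrow> real) \<Rightarrow> bool" where
  "C1_on_Rn n u \<longleftrightarrow>
     continuous_on (Rn n) u \<and>
     (\<forall>j<n. (\<forall>x\<in>Rn n. (\<lambda>s. u (x(j := s))) differentiable at (x j)) \<and>
            continuous_on (Rn n) (partial_derivative j u))"

definition test_fields :: "nat \<Rightarrow> (vec \<Rightarrow> vec) set" where
  "test_fields n =
     {\<phi> \<in> Rn n \<rightarrow> Rn n.
        (\<forall>i<n. C1_on_Rn n (\<lambda>x. \<phi> x i)) \<and>
        (\<exists>K. compact K \<and> K \<subseteq> Rn n \<and> (\<forall>x\<in>Rn n - K. \<forall>i<n. \<phi> x i = 0)) \<and>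
        (\<forall>x\<in>Rn n. enorm n (\<phi> x) \<le> 1)}"

definition divergence :: "nat \<Rightarrow> (vec \<Rightarrow> vec) \<Rightarrow> vec \<Rightarrow> real" where
  "divergence n \<phi> x = (\<Sum>i<n. partial_derivative i (\<lambda>y. \<phi> y i) x)"

definition variation :: "nat \<Rightarrow> (vec \<Rightarrow> real) \<Rightarrow> ereal" where
  "variation n f = (SUP \<phi>\<in>test_fields n. ereal (LINT x|lebR n. f x * divergence n \<phi> x))"

definition finite_perimeter :: "nat \<Rightarrow> vec set \<Rightarrow> bool" where
  "finite_perimeter n \<Omega> \<longleftrightarrow>
     integrable (lebR n) (indicat_real \<Omega>) \<and> variation n (indicat_real \<Omega>) < \<infinity>"

text \<open>Only meaningful for sets of finite perimeter, since \<open>real_of_ereal \<infinity> = 0\<close>.\<close>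

definition perimeter :: "nat \<Rightarrow> vec set \<Rightarrow> real" where
  "perimeter n \<Omega> = real_of_ereal (variation n (indicat_real \<Omega>))"

end

theory Submission
  imports Defs "HOL-Probability.Probability"
begin

text \<open>
  Write \<open>p(u) = |V\<^sub>g g(u)|\<^sup>2\<close>, a probability density by Moyal's identity, and
  \<open>\<Theta>(z) = \<integral>\<^sub>\<Omega> p(w - z) dw = \<langle>H\<^sub>\<Omega> \<pi>(z) g, \<pi>(z) g\<rangle> = \<Sum>\<^sub>k \<lambda>\<^sub>k |V\<^sub>g h\<^sub>k(z)|\<^sup>2\<close>.
  Translating a set of finite perimeter by \<open>u\<close> moves at most \<open>|u| |\<partial>\<Omega>|\<close> of its mass, so
  \<open>\<parallel>\<Theta> - 1\<^sub>\<Omega>\<parallel>\<^sub>1 \<le> D = \<integral> |u| p(u) du |\<partial>\<Omega>|\<close>. Integrating the expansion of \<open>\<Theta>\<close> over the whole space and over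
  \<open>\<Omega>\<close> gives \<open>\<Sum> \<lambda>\<^sub>k = |\<Omega>|\<close> and \<open>\<Sum> \<lambda>\<^sub>k (1 - \<lambda>\<^sub>k) \<le> D\<close>. As the \<open>\<lambda>\<^sub>k\<close> decrease, the tail
  \<open>\<Sum>\<^bsub>k > A\<^esub> \<lambda>\<^sub>k\<close> is at most \<open>D\<close> as well, whence \<open>\<parallel>\<rho> - \<Theta>\<parallel>\<^sub>1 \<le> 1 + 2 D\<close>. On the symmetric difference
  \<open>|\<rho> - 1\<^sub>\<Omega>| \<ge> 1/2\<close>, and Chebyshev's inequality gives the bound \<open>2 (1 + 3 D) \<le> 8 D\<close>.

  The spectral theorem behind the expansion of \<open>\<Theta>\<close> comes from the power method: for a kernel \<open>K\<close> on
  a finite measure space with largest Rayleigh quotient \<open>m\<close>, the normalised iterates of a column of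
  \<open>K\<close> under \<open>K / m\<close> form a Cauchy sequence because their moments decrease, and the traces of the powers
  of \<open>K\<close> show that for some column the limit does not vanish.
\<close>

section \<open>Square-integrable functions\<close>

text \<open>\<open>eigensystem\<close> describes the eigenspace of each nonzero eigenvalue, but does
  not say that the listed functions exhaust the operator. What is missing is that, off finitely many
  \<open>h k\<close>, the quadratic form is bounded by the remaining eigenvalues. This needs an
  eigenvector of the deflated operator, hence an existence proof. Time space has infinite measure,
  so existence is shown on the other side: the transform restricted to \<Omega>, composed with its
  adjoint, has a bounded kernel on a finite measure space, and its eigenfunctions are carried back.
  The perimeter is a supremum over test fields, so the translation bound comes from one field in
  direction h, built from S = 1_\<Omega> - 1_\<Omega>(. + h), mollified and averaged over the
  segment from 0 to h. Its pairing with \<Omega> gives a mollified autocorrelation of S, which tends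
  to the integral of S^2. As S takes only the values -1, 0, 1, this is the integral of |S|. This
  limit and Plancherel's formula both rest on continuity of translations. In the last bound the
  summand 1 comes from rounding |\<Omega>| up to an integer, and D >= 1 absorbs it.\<close>

lemma borel_measurable_cnj [measurable (raw)]:
  "f \<in> borel_measurable M \<Longrightarrow> (\<lambda>x. cnj (f x)) \<in> borel_measurable M"
  by (rule measurable_compose[OF _ borel_measurable_continuous_onI]) (auto intro!: continuous_intros)

text \<open>\<open>L2\<close> for an arbitrary measure: the argument treats functions of time and
  functions on phase space weighted by \<Omega> alike.\<close>

definition sq_int :: "'a measure \<Rightarrow> ('a \<Rightarrow> complex) set" where
  "sq_int M = {f \<in> borel_measurable M. integrable M (\<lambda>t. (cmod (f t))\<^sup>2)}"

definition ip :: "'a measure \<Rightarrow> ('a \<Rightarrow> complex) \<Rightarrow> ('a \<Rightarrow> complex) \<Rightarrow> complex" where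
  "ip M f g = (LINT t|M. f t * cnj (g t))"

definition sq_norm :: "'a measure \<Rightarrow> ('a \<Rightarrow> complex) \<Rightarrow> real" where
  "sq_norm M f = (LINT t|M. (cmod (f t))\<^sup>2)"

lemma sq_int_measurable [measurable_dest]: "f \<in> sq_int M \<Longrightarrow> f \<in> borel_measurable M"
  by (simp add: sq_int_def)

lemma sq_int_integrable: "f \<in> sq_int M \<Longrightarrow> integrable M (\<lambda>t. (cmod (f t))\<^sup>2)"
  by (simp add: sq_int_def)

lemma sq_norm_nonneg [simp]: "0 \<le> sq_norm M f"
  by (simp add: sq_norm_def)

lemma norm_mult_le_sum_squares: "cmod a * cmod b \<le> (cmod a)\<^sup>2 + (cmod b)\<^sup>2"
proof -
  have "0 \<le> (cmod a - cmod b)\<^sup>2" "0 \<le> (cmod a)\<^sup>2 + (cmod b)\<^sup>2"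
    by simp_all
  then show ?thesis
    unfolding power2_diff by linarith
qed

lemma sq_int_integrable_mult:
  assumes "f \<in> sq_int M" "g \<in> sq_int M"
  shows "integrable M (\<lambda>t. f t * cnj (g t))"
proof (rule Bochner_Integration.integrable_bound)
  show "integrable M (\<lambda>t. (cmod (f t))\<^sup>2 + (cmod (g t))\<^sup>2)"
    using assms by (simp add: sq_int_def)
  show "(\<lambda>t. f t * cnj (g t)) \<in> borel_measurable M"
    using assms by (auto simp: sq_int_def)
  show "AE t in M. norm (f t * cnj (g t)) \<le> norm ((cmod (f t))\<^sup>2 + (cmod (g t))\<^sup>2)"
    by (auto simp: norm_mult intro!: order_trans[OF norm_mult_le_sum_squares])
qed

lemma sq_int_scale: "f \<in> sq_int M \<Longrightarrow> (\<lambda>t. c * f t) \<in> sq_int M"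
  by (auto simp: sq_int_def norm_mult power_mult_distrib)

lemma sq_int_add:
  assumes "f \<in> sq_int M" "g \<in> sq_int M"
  shows "(\<lambda>t. f t + g t) \<in> sq_int M"
proof -
  have "integrable M (\<lambda>t. (cmod (f t + g t))\<^sup>2)"
  proof (rule Bochner_Integration.integrable_bound)
    show "integrable M (\<lambda>t. 2 * (cmod (f t))\<^sup>2 + 2 * (cmod (g t))\<^sup>2)"
      using assms by (simp add: sq_int_def)
    show "(\<lambda>t. (cmod (f t + g t))\<^sup>2) \<in> borel_measurable M"
      using assms by (auto simp: sq_int_def)
    have "(cmod (a + b))\<^sup>2 \<le> 2 * (cmod a)\<^sup>2 + 2 * (cmod b)\<^sup>2" for a b
    proof -
      have "(cmod (a + b))\<^sup>2 \<le> (cmod a + cmod b)\<^sup>2"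
        by (intro power_mono norm_triangle_ineq) auto
      moreover have "0 \<le> (cmod a - cmod b)\<^sup>2"
        by simp
      ultimately show ?thesis
        by (simp add: power2_diff power2_sum)
    qed
    then show "AE t in M. norm ((cmod (f t + g t))\<^sup>2) \<le> norm (2 * (cmod (f t))\<^sup>2 + 2 * (cmod (g t))\<^sup>2)"
      by auto
  qed
  then show ?thesis
    using assms by (auto simp: sq_int_def)
qed

lemma sq_int_zero: "(\<lambda>t. 0) \<in> sq_int M"
  by (simp add: sq_int_def)

lemma sq_int_sum:
  "(\<And>k. k \<in> A \<Longrightarrow> f k \<in> sq_int M) \<Longrightarrow> (\<lambda>t. \<Sum>k\<in>A. f k t) \<in> sq_int M"
  by (induction A rule: infinite_finite_induct) (auto simp: sq_int_zero intro!: sq_int_add)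

lemma sq_int_diff:
  assumes "f \<in> sq_int M" "g \<in> sq_int M"
  shows "(\<lambda>t. f t - g t) \<in> sq_int M"
  using sq_int_add[OF assms(1) sq_int_scale[OF assms(2), of "- 1"]] by simp

lemma ip_cnj: "ip M g f = cnj (ip M f g)"
  using Bochner_Integration.integral_cnj[of M "\<lambda>t. f t * cnj (g t)"]
  by (simp add: ip_def mult.commute)

lemma ip_self: "ip M f f = of_real (sq_norm M f)"
  by (simp add: ip_def sq_norm_def complex_norm_square[symmetric] flip: of_real_power)

lemma ip_add_left:
  assumes "f \<in> sq_int M" "g \<in> sq_int M" "u \<in> sq_int M"
  shows "ip M (\<lambda>t. f t + g t) u = ip M f u + ip M g u"
  using assms by (simp add: ip_def distrib_right sq_int_integrable_mult)

lemma ip_diff_left: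
  assumes "f \<in> sq_int M" "g \<in> sq_int M" "u \<in> sq_int M"
  shows "ip M (\<lambda>t. f t - g t) u = ip M f u - ip M g u"
  using assms by (simp add: ip_def left_diff_distrib sq_int_integrable_mult)

lemma ip_scale_left: "ip M (\<lambda>t. c * f t) u = c * ip M f u"
  by (simp add: ip_def mult.assoc)

lemma ip_sum_left:
  assumes "\<And>k. k \<in> A \<Longrightarrow> f k \<in> sq_int M" "u \<in> sq_int M"
  shows "ip M (\<lambda>t. \<Sum>k\<in>A. f k t) u = (\<Sum>k\<in>A. ip M (f k) u)"
  using assms by (simp add: ip_def sum_distrib_right sq_int_integrable_mult)

lemma ip_add_right:
  assumes "f \<in> sq_int M" "g \<in> sq_int M" "u \<in> sq_int M"
  shows "ip M u (\<lambda>t. f t + g t) = ip M u f + ip M u g"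
  using ip_add_left[OF assms] by (subst (1 2 3) ip_cnj) simp

lemma ip_diff_right:
  assumes "f \<in> sq_int M" "g \<in> sq_int M" "u \<in> sq_int M"
  shows "ip M u (\<lambda>t. f t - g t) = ip M u f - ip M u g"
  using ip_diff_left[OF assms] by (subst (1 2 3) ip_cnj) simp

lemma ip_scale_right: "ip M u (\<lambda>t. c * f t) = cnj c * ip M u f"
  using ip_scale_left[of M c f u] by (subst (1 2) ip_cnj) simp

lemma ip_cong_AE:
  assumes "AE t in M. f t = f' t" "AE t in M. g t = g' t"
    and "f \<in> borel_measurable M" "f' \<in> borel_measurable M"
    and "g \<in> borel_measurable M" "g' \<in> borel_measurable M"
  shows "ip M f g = ip M f' g'"
  unfolding ip_def using assms by (intro integral_cong_AE) auto

lemma sq_norm_add_scale: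
  assumes "f \<in> sq_int M" "g \<in> sq_int M"
  shows "sq_norm M (\<lambda>t. f t + a * g t) = sq_norm M f + 2 * Re (cnj a * ip M f g) + (cmod a)\<^sup>2 * sq_norm M g"
proof -
  note s = sq_int_scale[OF assms(2), of a]
  have "complex_of_real (sq_norm M (\<lambda>t. f t + a * g t)) =
      ip M f f + cnj a * ip M f g + a * ip M g f + a * cnj a * ip M g g"
    by (subst ip_self[symmetric])
      (simp add: ip_add_left ip_add_right ip_scale_left ip_scale_right sq_int_add assms s algebra_simps)
  also have "\<dots> = sq_norm M f + (cnj a * ip M f g + cnj (cnj a * ip M f g)) + (cmod a)\<^sup>2 * sq_norm M g"
    by (simp add: ip_self ip_cnj[of M g f] complex_norm_square del: of_real_power)
  also have "\<dots> = complex_of_real (sq_norm M f + 2 * Re (cnj a * ip M f g) + (cmod a)\<^sup>2 * sq_norm M g)"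
    by (simp only: complex_add_cnj of_real_add)
  finally show ?thesis
    by (simp only: of_real_eq_iff)
qed

text \<open>The discriminant criterion. It is kept apart from inner products because it also serves
  the semidefinite form \<open>R\<close> of a kernel.\<close>

lemma square_le_of_quadratic_nonneg:
  fixes A B C :: real
  assumes "\<And>s. 0 \<le> A + 2 * s * B + s\<^sup>2 * C" and "0 \<le> C"
  shows "B\<^sup>2 \<le> A * C"
proof (cases "C = 0")
  case True
  have "B = 0"
  proof (rule ccontr)
    \<comment> \<open>At \<open>s = - (A + 1) / (2 * B)\<close> the quadratic, whose leading term is
      absent here, takes the value -1.\<close>
    assume "B \<noteq> 0"
    then show False
      using assms(1)[of "- (A + 1) / (2 * B)"] True by (simp add: field_simps)
  qed
  then show ?thesis
    using True by simp
next
  case False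
  then have "C > 0"
    using assms(2) by simp
  have "0 \<le> (A + 2 * (- B / C) * B + (- B / C)\<^sup>2 * C) * C"
    using assms(1)[of "- B / C"] \<open>C > 0\<close> by simp
  also have "\<dots> = A * C - B\<^sup>2"
    using \<open>C > 0\<close> by (simp add: field_simps power2_eq_square)
  finally show ?thesis
    by simp
qed

lemma ip_Cauchy_Schwarz:
  assumes "f \<in> sq_int M" "g \<in> sq_int M"
  shows "(cmod (ip M f g))\<^sup>2 \<le> sq_norm M f * sq_norm M g"
proof (cases "ip M f g = 0")
  case False
  define c where "c = (cmod (ip M f g))\<^sup>2"
  have c: "c > 0"
    using False by (simp add: c_def)
  \<comment> \<open>The multiplier \<open>of_real s * ip M f g\<close> of \<open>g\<close> removes
    the phase, so that the linear term is the real number \<open>2 * s * c\<close>. The discriminant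
    then gives the claim up to a factor \<open>c\<close>, which is cancelled.\<close>
  have "0 \<le> sq_norm M f + 2 * s * c + s\<^sup>2 * (c * sq_norm M g)" for s
  proof -
    have "0 \<le> sq_norm M (\<lambda>t. f t + (of_real s * ip M f g) * g t)"
      by simp
    also have "\<dots> = sq_norm M f + 2 * Re (of_real s * (ip M f g * cnj (ip M f g)))
        + (cmod (of_real s * ip M f g))\<^sup>2 * sq_norm M g"
      by (subst sq_norm_add_scale[OF assms]) (simp add: mult_ac)
    also have "\<dots> = sq_norm M f + 2 * s * c + s\<^sup>2 * (c * sq_norm M g)"
      unfolding complex_norm_square[symmetric] c_def
      by (simp add: norm_mult power_mult_distrib mult_ac flip: of_real_power of_real_mult)
    finally show ?thesis .
  qed
  then have "c\<^sup>2 \<le> sq_norm M f * (c * sq_norm M g)"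
    by (rule square_le_of_quadratic_nonneg) (use c in auto)
  then have "c * c \<le> c * (sq_norm M f * sq_norm M g)"
    by (simp add: power2_eq_square mult_ac)
  then have "c \<le> sq_norm M f * sq_norm M g"
    using c by (simp only: mult_le_cancel_left_pos)
  then show ?thesis
    by (simp add: c_def)
qed simp

section \<open>The top eigenvalue of a positive semidefinite kernel\<close>

text \<open>On a finite measure space bounded functions are square integrable, and an operator with
  bounded kernel preserves them. Working with functions instead of classes makes evaluation at a
  point available, on which the power method relies.\<close>

definition bdd_meas :: "'a measure \<Rightarrow> ('a \<Rightarrow> complex) set" where
  "bdd_meas N = {F \<in> borel_measurable N. \<exists>B. \<forall>z\<in>space N. cmod (F z) \<le> B}"

lemma bmI: "F \<in> borel_measurable N \<Longrightarrow> (\<And>z. z \<in> space N \<Longrightarrow> cmod (F z) \<le> B) \<Longrightarrow> F \<in> bdd_meas N"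
  by (auto simp: bdd_meas_def)

lemma bdd_meas_measurable [measurable_dest]: "F \<in> bdd_meas N \<Longrightarrow> F \<in> borel_measurable N"
  by (simp add: bdd_meas_def)

lemma bdd_meas_bound:
  assumes "F \<in> bdd_meas N"
  obtains B where "B \<ge> 0" "\<And>z. z \<in> space N \<Longrightarrow> cmod (F z) \<le> B"
proof -
  obtain B where B: "\<And>z. z \<in> space N \<Longrightarrow> cmod (F z) \<le> B"
    using assms by (auto simp: bdd_meas_def)
  show ?thesis
    by (rule that[of "\<bar>B\<bar>"]) (use B in force)+
qed

lemma bdd_meas_add: 
  assumes "F \<in> bdd_meas N" "G \<in> bdd_meas N" shows "(\<lambda>z. F z + G z) \<in> bdd_meas N"
proof -
  obtain B C where "\<And>z. z \<in> space N \<Longrightarrow> cmod (F z) \<le> B" "\<And>z. z \<in> space N \<Longrightarrow> cmod (G z) \<le> C"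
    using assms by (auto simp: bdd_meas_def)
  then show ?thesis
    using assms by (intro bmI[of _ _ "B + C"]) (auto intro!: order_trans[OF norm_triangle_ineq] add_mono)
qed

lemma bdd_meas_mult: 
  assumes "F \<in> bdd_meas N" "G \<in> bdd_meas N" shows "(\<lambda>z. F z * G z) \<in> bdd_meas N"
proof -
  obtain B C where "B \<ge> 0" "\<And>z. z \<in> space N \<Longrightarrow> cmod (F z) \<le> B" "\<And>z. z \<in> space N \<Longrightarrow> cmod (G z) \<le> C"
    using assms by (metis bdd_meas_bound)
  then show ?thesis
    using assms by (intro bmI[of _ _ "B * C"]) (auto simp: norm_mult intro!: mult_mono)
qed

lemma bdd_meas_const: "(\<lambda>z. c) \<in> bdd_meas N"
  by (auto simp: bdd_meas_def)

lemma bdd_meas_scale: "F \<in> bdd_meas N \<Longrightarrow> (\<lambda>z. c * F z) \<in> bdd_meas N"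
  by (intro bdd_meas_mult bdd_meas_const)

lemma (in finite_measure) bdd_meas_sq_int:
  assumes "F \<in> bdd_meas M" shows "F \<in> sq_int M"
proof -
  obtain B where "B \<ge> 0" "\<And>z. z \<in> space M \<Longrightarrow> cmod (F z) \<le> B"
    using assms by (metis bdd_meas_bound)
  then show ?thesis
    using assms by (auto simp: sq_int_def intro!: integrable_const_bound[of _ "B\<^sup>2"] power_mono)
qed

lemma (in finite_measure) sq_norm_le_const:
  assumes "F \<in> borel_measurable M" "\<And>z. z \<in> space M \<Longrightarrow> (cmod (F z))\<^sup>2 \<le> B"
  shows "sq_norm M F \<le> measure M (space M) * B"
proof -
  have "sq_norm M F \<le> (LINT z|M. B)"
    unfolding sq_norm_def using assms
    by (intro integral_mono integrable_const integrable_const_bound[of "\<lambda>z. (cmod (F z))\<^sup>2" B] AE_I2) auto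
  then show ?thesis
    by simp
qed

text \<open>The bound 1 is a normalisation that fits Gram kernels of vectors of norm at most 1.
  Positivity is asked on the class of functions on which \<open>T\<close> is studied.\<close>

locale psd_kernel = finite_measure N for N :: "'z measure" +
  fixes K :: "'z \<Rightarrow> 'z \<Rightarrow> complex"
  assumes K_measurable [measurable]: "case_prod K \<in> borel_measurable (N \<Otimes>\<^sub>M N)"
    and K_bound: "z \<in> space N \<Longrightarrow> w \<in> space N \<Longrightarrow> cmod (K z w) \<le> 1"
    and K_hermitian: "z \<in> space N \<Longrightarrow> w \<in> space N \<Longrightarrow> K w z = cnj (K z w)"
    and K_psd: "F \<in> bdd_meas N \<Longrightarrow> 0 \<le> Re (ip N (\<lambda>z. LINT w|N. K z w * F w) F)"
begin

sublocale pair_sigma_finite N N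
  by standard

definition T :: "('z \<Rightarrow> complex) \<Rightarrow> 'z \<Rightarrow> complex" where
  "T F z = (LINT w|N. K z w * F w)"

text \<open>By hermitian symmetry this is the function that sends \<open>w\<close> to
  \<open>K w z\<close>. The conjugated form turns evaluation of \<open>T F\<close> at
  \<open>z\<close> into an inner product.\<close>

definition column :: "'z \<Rightarrow> 'z \<Rightarrow> complex" where
  "column z w = cnj (K z w)"

definition vol :: real where
  "vol = measure N (space N)"

lemma vol_nonneg: "0 \<le> vol"
  by (simp add: vol_def)

lemma column_bdd_meas: "z \<in> space N \<Longrightarrow> column z \<in> bdd_meas N"
  unfolding column_def by (rule bmI[of _ _ 1]) (auto simp: K_bound)

lemma T_eq_ip: "T F z = ip N F (column z)"
  by (simp add: T_def ip_def column_def mult.commute)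

lemma sq_norm_column: "z \<in> space N \<Longrightarrow> sq_norm N (column z) \<le> vol"
  using sq_norm_le_const[of "column z" 1] bdd_meas_measurable[OF column_bdd_meas[of z]] K_bound
  by (simp add: vol_def column_def abs_square_le_1)

text \<open>Evaluation of \<open>T F\<close> is an inner product with a column, so control in the
  mean becomes control at every point. This upgrades mean convergence of the iterates to pointwise
  convergence.\<close>

lemma T_bound:
  assumes "F \<in> bdd_meas N" "z \<in> space N"
  shows "(cmod (T F z))\<^sup>2 \<le> vol * sq_norm N F"
proof -
  have "(cmod (T F z))\<^sup>2 \<le> sq_norm N F * sq_norm N (column z)"
    unfolding T_eq_ip using assms by (intro ip_Cauchy_Schwarz bdd_meas_sq_int column_bdd_meas)
  also have "\<dots> \<le> sq_norm N F * vol"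
    using assms by (intro mult_left_mono sq_norm_column) auto
  finally show ?thesis
    by (simp add: mult.commute)
qed

lemma T_measurable [measurable]:
  assumes [measurable]: "F \<in> borel_measurable N"
  shows "T F \<in> borel_measurable N"
  unfolding T_def[abs_def] by measurable

lemma T_bdd_meas:
  assumes "F \<in> bdd_meas N" shows "T F \<in> bdd_meas N"
proof (rule bmI[of _ _ "sqrt (vol * sq_norm N F)"])
  show "T F \<in> borel_measurable N"
    using assms by measurable
  show "cmod (T F z) \<le> sqrt (vol * sq_norm N F)" if "z \<in> space N" for z
    using T_bound[OF assms that] by (rule real_le_rsqrt)
qed

lemma Tn_bdd_meas: "F \<in> bdd_meas N \<Longrightarrow> (T ^^ n) F \<in> bdd_meas N"
  by (induction n) (auto intro: T_bdd_meas)

lemma sq_norm_T_le: "F \<in> bdd_meas N \<Longrightarrow> sq_norm N (T F) \<le> vol * (vol * sq_norm N F)"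
  using sq_norm_le_const[of "T F"] T_bound[of F] by (simp add: vol_def bdd_meas_measurable)

lemma T_add_scale:
  assumes "F \<in> bdd_meas N" "G \<in> bdd_meas N" "z \<in> space N"
  shows "T (\<lambda>w. F w + a * G w) z = T F z + a * T G z"
  using assms column_bdd_meas
  by (simp add: T_eq_ip ip_add_left ip_scale_left bdd_meas_sq_int bdd_meas_scale)

lemma T_selfadjoint:
  assumes "F \<in> bdd_meas N" "G \<in> bdd_meas N"
  shows "ip N (T F) G = ip N F (T G)"
proof -
  interpret NN: finite_measure "N \<Otimes>\<^sub>M N"
    by (rule finite_measure_pair_measure) (rule finite_measure_axioms)+
  obtain B where B: "B \<ge> 0" "\<And>z. z \<in> space N \<Longrightarrow> cmod (F z) \<le> B"
    using assms by (metis bdd_meas_bound)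
  obtain C where C: "C \<ge> 0" "\<And>z. z \<in> space N \<Longrightarrow> cmod (G z) \<le> C"
    using assms by (metis bdd_meas_bound)
  have [measurable]: "F \<in> borel_measurable N" "G \<in> borel_measurable N"
    using assms by (auto simp: bdd_meas_measurable)
  have "cmod (K z w * F w * cnj (G z)) \<le> 1 * B * C" if "z \<in> space N" "w \<in> space N" for z w
    using that B C K_bound unfolding norm_mult complex_mod_cnj
    by (intro mult_mono mult_nonneg_nonneg) auto
  then have int: "integrable (N \<Otimes>\<^sub>M N) (\<lambda>(z, w). K z w * F w * cnj (G z))"
    by (intro NN.integrable_const_bound[of _ "1 * B * C"] AE_I2) (auto simp: space_pair_measure)
  have "ip N (T F) G = (LINT z|N. LINT w|N. K z w * F w * cnj (G z))"
    unfolding ip_def T_def by (auto intro!: Bochner_Integration.integral_cong)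
  also have "\<dots> = (LINT w|N. LINT z|N. K z w * F w * cnj (G z))"
    using Fubini_integral[OF int] by simp
  also have "\<dots> = (LINT w|N. LINT z|N. F w * cnj (K w z * G z))"
  proof (intro Bochner_Integration.integral_cong refl)
    fix w z assume "w \<in> space N" "z \<in> space N"
    then have "cnj (K w z) = K z w"
      using K_hermitian[of w z] by simp
    then show "K z w * F w * cnj (G z) = F w * cnj (K w z * G z)"
      by (simp add: mult_ac)
  qed
  also have "\<dots> = ip N F (T G)"
    unfolding ip_def T_def by (simp flip: Bochner_Integration.integral_cnj)
  finally show ?thesis .
qed

definition R :: "('z \<Rightarrow> complex) \<Rightarrow> real" where
  "R F = Re (ip N (T F) F)"

text \<open>Division by zero yields 0, so a function of norm zero contributes a harmless quotient.
  \<open>R_quotient_bdd\<close> makes the supremum meaningful.\<close>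

definition top_ev :: real where
  "top_ev = (SUP F\<in>bdd_meas N. R F / sq_norm N F)"

lemma R_nonneg: "F \<in> bdd_meas N \<Longrightarrow> 0 \<le> R F"
  using K_psd by (simp add: R_def T_def[abs_def])

lemma R_le_sqrt:
  assumes "F \<in> bdd_meas N" shows "(R F)\<^sup>2 \<le> sq_norm N (T F) * sq_norm N F"
proof -
  have "(R F)\<^sup>2 \<le> (cmod (ip N (T F) F))\<^sup>2"
    unfolding R_def by (simp add: abs_le_square_iff[symmetric] abs_Re_le_cmod) 
  also have "\<dots> \<le> sq_norm N (T F) * sq_norm N F"
    using assms by (intro ip_Cauchy_Schwarz bdd_meas_sq_int T_bdd_meas)
  finally show ?thesis .
qed

lemma R_le_vol:
  assumes "F \<in> bdd_meas N" shows "R F \<le> vol * sq_norm N F"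
proof (rule power2_le_imp_le)
  have "(R F)\<^sup>2 \<le> (vol * (vol * sq_norm N F)) * sq_norm N F"
    using R_le_sqrt[OF assms] sq_norm_T_le[OF assms] by (meson mult_right_mono sq_norm_nonneg order_trans)
  then show "(R F)\<^sup>2 \<le> (vol * sq_norm N F)\<^sup>2"
    by (simp add: power2_eq_square mult_ac)
qed (simp add: vol_nonneg)

lemma R_quotient_bdd: "bdd_above ((\<lambda>F. R F / sq_norm N F) ` bdd_meas N)"
proof (rule bdd_aboveI2)
  show "R F / sq_norm N F \<le> vol" if "F \<in> bdd_meas N" for F
    using R_le_vol[OF that] vol_nonneg sq_norm_nonneg[of N F]
    by (metis divide_eq_0_iff divide_le_eq order_le_less)
qed

lemma R_le_top:
  assumes "F \<in> bdd_meas N" shows "R F \<le> top_ev * sq_norm N F"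
proof (cases "sq_norm N F = 0")
  case True
  then show ?thesis
    using R_le_sqrt[OF assms] by simp
next
  case False
  then have "sq_norm N F > 0"
    using sq_norm_nonneg[of N F] by linarith
  moreover have "R F / sq_norm N F \<le> top_ev"
    unfolding top_ev_def using assms by (intro cSUP_upper R_quotient_bdd)
  ultimately show ?thesis
    by (simp add: divide_le_eq)
qed

lemma R_add_scale:
  assumes "F \<in> bdd_meas N" "G \<in> bdd_meas N"
  shows "R (\<lambda>z. F z + of_real s * G z) = R F + 2 * s * Re (ip N (T F) G) + s\<^sup>2 * R G"
proof -
  let ?s = "complex_of_real s"
  note m = bdd_meas_sq_int T_bdd_meas bdd_meas_add bdd_meas_scale sq_int_scale sq_int_add assms
  have "ip N (T (\<lambda>z. F z + ?s * G z)) (\<lambda>z. F z + ?s * G z) =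
    ip N (\<lambda>z. T F z + ?s * T G z) (\<lambda>z. F z + ?s * G z)"
    unfolding ip_def by (intro Bochner_Integration.integral_cong refl) (simp add: T_add_scale assms)
  also have "\<dots> = ip N (T F) F + ?s * ip N (T F) G + ?s * ip N (T G) F + ?s * ?s * ip N (T G) G"
    by (simp add: ip_add_left ip_add_right ip_scale_left ip_scale_right m)
      (simp add: algebra_simps)
  also have "ip N (T G) F = cnj (ip N (T F) G)"
    using T_selfadjoint[OF assms(2,1)] ip_cnj[of N G "T F"] by simp
  finally show ?thesis
    by (simp add: R_def power2_eq_square)
qed

text \<open>The form of a positive semidefinite kernel is a possibly degenerate inner product. Real
  multiples of \<open>G\<close> bound the real part, and later uses concern pairs on which the form
  is real.\<close>

lemma R_Cauchy_Schwarz: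
  assumes "F \<in> bdd_meas N" "G \<in> bdd_meas N"
  shows "(Re (ip N (T F) G))\<^sup>2 \<le> R F * R G"
proof (rule square_le_of_quadratic_nonneg)
  show "0 \<le> R F + 2 * s * Re (ip N (T F) G) + s\<^sup>2 * R G" for s
    using R_nonneg[of "\<lambda>z. F z + of_real s * G z"] assms
    by (simp add: R_add_scale bdd_meas_add bdd_meas_scale)
qed (use assms R_nonneg in auto)

text \<open>The operator inequality T^2 <= m T: Cauchy-Schwarz for the form with
  \<open>G = T F\<close>, then the Rayleigh bound for \<open>T F\<close>, then cancellation of one
  factor.\<close>

lemma sq_norm_T_le_top:
  assumes "F \<in> bdd_meas N" shows "sq_norm N (T F) \<le> top_ev * R F"
proof (cases "sq_norm N (T F) = 0")
  case True
  have "0 \<le> top_ev * sq_norm N F" 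
    using R_le_top[OF assms] R_nonneg[OF assms] by linarith
  then have "top_ev \<ge> 0 \<or> sq_norm N F = 0"
    using sq_norm_nonneg[of N F] by (auto simp: zero_le_mult_iff)
  then show ?thesis
    using True R_nonneg[OF assms] R_le_sqrt[OF assms] by auto
next
  case False
  then have pos: "sq_norm N (T F) > 0"
    using sq_norm_nonneg[of N "T F"] by linarith
  have "(sq_norm N (T F))\<^sup>2 \<le> R F * R (T F)"
    using R_Cauchy_Schwarz[OF assms T_bdd_meas[OF assms]] by (simp add: ip_self)
  also have "\<dots> \<le> R F * (top_ev * sq_norm N (T F))"
    using assms by (intro mult_left_mono R_le_top R_nonneg T_bdd_meas)
  finally have "sq_norm N (T F) * sq_norm N (T F) \<le> sq_norm N (T F) * (top_ev * R F)"
    by (simp add: power2_eq_square mult_ac)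
  then show ?thesis
    using pos by (simp only: mult_le_cancel_left_pos)
qed

text \<open>The moments of the spectral measure of \<open>F\<close>, written without a spectral
  theorem. Even ones are squared norms of iterates and odd ones are values of \<open>R\<close>,
  whence the two cases in the facts below.\<close>

definition mom :: "('z \<Rightarrow> complex) \<Rightarrow> nat \<Rightarrow> real" where
  "mom F n = Re (ip N ((T ^^ n) F) F)"

lemma ip_Tn:
  assumes "F \<in> bdd_meas N" "G \<in> bdd_meas N"
  shows "ip N ((T ^^ i) F) ((T ^^ j) G) = ip N ((T ^^ (i + j)) F) G"
  using assms(2)
proof (induction j arbitrary: G)
  case (Suc j)
  have "ip N ((T ^^ i) F) ((T ^^ Suc j) G) = ip N ((T ^^ i) F) ((T ^^ j) (T G))"
    by (simp only: funpow_Suc_right o_def)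
  also have "\<dots> = ip N ((T ^^ (i + j)) F) (T G)"
    by (rule Suc.IH) (rule T_bdd_meas[OF Suc.prems])
  also have "\<dots> = ip N (T ((T ^^ (i + j)) F)) G"
    by (rule T_selfadjoint[symmetric]) (auto intro: Tn_bdd_meas assms Suc.prems)
  finally show ?case
    by simp
qed simp

lemma Re_ip_Tn: "F \<in> bdd_meas N \<Longrightarrow> Re (ip N ((T ^^ i) F) ((T ^^ j) F)) = mom F (i + j)"
  by (simp add: ip_Tn mom_def)

lemma mom_even: "F \<in> bdd_meas N \<Longrightarrow> mom F (2 * j) = sq_norm N ((T ^^ j) F)"
  using Re_ip_Tn[of F j j] by (simp add: ip_self mult_2)

lemma mom_odd: "F \<in> bdd_meas N \<Longrightarrow> mom F (Suc (2 * j)) = R ((T ^^ j) F)"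
  using Re_ip_Tn[of F "Suc j" j] by (simp add: R_def mult_2)

lemma mom_nonneg: "F \<in> bdd_meas N \<Longrightarrow> 0 \<le> mom F n"
  by (cases "even n") (auto simp: mom_even mom_odd R_nonneg Tn_bdd_meas elim!: evenE oddE)

text \<open>From an even index the step is the Rayleigh bound, from an odd index it is
  \<open>sq_norm_T_le_top\<close>.\<close>

lemma mom_Suc_le:
  assumes "F \<in> bdd_meas N" shows "mom F (Suc n) \<le> top_ev * mom F n"
proof (cases "even n")
  case True
  then obtain j where n: "n = 2 * j" by (elim evenE)
  show ?thesis
    using R_le_top[OF Tn_bdd_meas[OF assms, of j]] by (simp add: n mom_even mom_odd assms)
next
  case False
  then obtain j where n: "n = Suc (2 * j)" by (elim oddE) simp
  show ?thesis
    using sq_norm_T_le_top[OF Tn_bdd_meas[OF assms, of j]] mom_even[OF assms, of "Suc j"]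
    by (simp add: n mom_odd assms)
qed

text \<open>Cauchy-Schwarz for the inner product if \<open>n\<close> is even and for the form
  \<open>R\<close> if \<open>n\<close> is odd.\<close>

lemma mom_log_convex:
  assumes "F \<in> bdd_meas N" shows "(mom F (Suc n))\<^sup>2 \<le> mom F n * mom F (Suc (Suc n))"
proof (cases "even n")
  case True
  then obtain j where n: "n = 2 * j" by (elim evenE)
  show ?thesis
    using R_le_sqrt[OF Tn_bdd_meas[OF assms, of j]] mom_even[OF assms, of "Suc j"]
      mom_even[OF assms, of j] mom_odd[OF assms, of j]
    unfolding n by (simp add: mult.commute)
next
  case False
  then obtain j where n: "n = Suc (2 * j)" by (elim oddE) simp
  let ?v = "(T ^^ j) F"
  have "(Re (ip N (T ?v) (T ?v)))\<^sup>2 \<le> R ?v * R (T ?v)"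
    using assms by (intro R_Cauchy_Schwarz Tn_bdd_meas T_bdd_meas)
  then show ?thesis
    using mom_even[OF assms, of "Suc j"] mom_odd[OF assms, of "Suc j"] mom_odd[OF assms, of j]
    by (simp add: n ip_self)
qed

end

section \<open>Power method: limits of normalised iterates\<close>

context psd_kernel
begin

definition scaled_iter :: "('z \<Rightarrow> complex) \<Rightarrow> nat \<Rightarrow> 'z \<Rightarrow> complex" where
  "scaled_iter F n z = of_real (1 / top_ev ^ n) * (T ^^ n) F z"

definition smom :: "('z \<Rightarrow> complex) \<Rightarrow> nat \<Rightarrow> real" where
  "smom F n = mom F n / top_ev ^ n"

lemma scaled_iter_bdd_meas: "F \<in> bdd_meas N \<Longrightarrow> scaled_iter F n \<in> bdd_meas N"
  unfolding scaled_iter_def by (intro bdd_meas_scale Tn_bdd_meas)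

lemma sq_norm_scale: "sq_norm N (\<lambda>z. c * f z) = (cmod c)\<^sup>2 * sq_norm N f"
  by (simp add: sq_norm_def norm_mult power_mult_distrib)

text \<open>Self-adjointness makes the cross term depend on \<open>n + l\<close> only. The distance
  of two iterates is thus a second difference of one scalar sequence and becomes small once that
  sequence converges.\<close>

lemma sq_norm_scaled_iter_diff:
  assumes "F \<in> bdd_meas N"
  shows "sq_norm N (\<lambda>z. scaled_iter F n z - scaled_iter F l z) =
    smom F (2 * n) - 2 * smom F (n + l) + smom F (2 * l)"
proof -
  let ?c = "\<lambda>n. complex_of_real (1 / top_ev ^ n)"
  have "sq_norm N (\<lambda>z. ?c n * (T ^^ n) F z + (- ?c l) * (T ^^ l) F z) =
      sq_norm N (\<lambda>z. ?c n * (T ^^ n) F z)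
      + 2 * Re (cnj (- ?c l) * ip N (\<lambda>z. ?c n * (T ^^ n) F z) ((T ^^ l) F))
      + (cmod (- ?c l))\<^sup>2 * sq_norm N ((T ^^ l) F)"
    using assms by (intro sq_norm_add_scale bdd_meas_sq_int bdd_meas_scale Tn_bdd_meas)
  also have "Re (cnj (- ?c l) * ip N (\<lambda>z. ?c n * (T ^^ n) F z) ((T ^^ l) F)) = - smom F (n + l)"
    using Re_ip_Tn[OF assms, of n l] unfolding ip_scale_left
    by (simp add: smom_def power_add flip: of_real_power)
  also have "sq_norm N (\<lambda>z. ?c n * (T ^^ n) F z) = smom F (2 * n)"
    unfolding sq_norm_scale
    by (simp add: mom_even[OF assms] smom_def norm_divide norm_power power_divide power_mult power2_eq_square
      flip: power_mult_distrib)
  also have "(cmod (- ?c l))\<^sup>2 * sq_norm N ((T ^^ l) F) = smom F (2 * l)"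
    by (simp add: mom_even[OF assms] smom_def norm_divide norm_power power_divide power_mult power2_eq_square
      flip: power_mult_distrib)
  finally show ?thesis
    by (simp add: scaled_iter_def)
qed

lemma sq_norm_scaled_iter: "F \<in> bdd_meas N \<Longrightarrow> sq_norm N (scaled_iter F n) = smom F (2 * n)"
  unfolding scaled_iter_def[abs_def] sq_norm_scale
  by (simp add: mom_even smom_def norm_divide norm_power power_divide power_mult power2_eq_square
      flip: power_mult_distrib)

context
  assumes top_pos: "top_ev > 0"
begin

lemma smom_nonneg: "F \<in> bdd_meas N \<Longrightarrow> 0 \<le> smom F n"
  using top_pos by (simp add: smom_def mom_nonneg)

lemma smom_decseq:
  assumes "F \<in> bdd_meas N" shows "decseq (smom F)"
proof (rule decseq_SucI)
  fix n
  have "smom F (Suc n) \<le> (top_ev * mom F n) / top_ev ^ Suc n"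
    unfolding smom_def using top_pos by (intro divide_right_mono mom_Suc_le assms) auto
  also have "\<dots> = smom F n"
    using top_pos by (simp add: smom_def)
  finally show "smom F (Suc n) \<le> smom F n" .
qed

lemma smom_convergent:
  assumes "F \<in> bdd_meas N"
  obtains L where "smom F \<longlonglongrightarrow> L" "0 \<le> L"
proof -
  have "\<forall>n. 0 \<le> smom F n"
    using smom_nonneg[OF assms] by blast
  with smom_decseq[OF assms] obtain L where "smom F \<longlonglongrightarrow> L"
    by (rule decseq_convergent)
  moreover have "0 \<le> L"
    using calculation by (rule LIMSEQ_le_const) (use smom_nonneg[OF assms] in auto)
  ultimately show ?thesis
    by (rule that)
qed

lemma T_scaled_iter: "T (scaled_iter F n) z = top_ev * scaled_iter F (Suc n) z"
proof -
  have "T (scaled_iter F n) z = of_real (1 / top_ev ^ n) * T ((T ^^ n) F) z"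
    unfolding T_def scaled_iter_def
    by (subst integral_mult_right_zero[symmetric]) (simp add: mult_ac)
  then show ?thesis
    using top_pos by (simp add: scaled_iter_def)
qed

lemma scaled_iter_bound:
  assumes "F \<in> bdd_meas N" "z \<in> space N"
  shows "(cmod (scaled_iter F (Suc n) z))\<^sup>2 \<le> vol * smom F 0 / top_ev\<^sup>2"
proof -
  have "top_ev\<^sup>2 * (cmod (scaled_iter F (Suc n) z))\<^sup>2 = (cmod (T (scaled_iter F n) z))\<^sup>2"
    using top_pos by (simp add: T_scaled_iter norm_mult power_mult_distrib)
  also have "\<dots> \<le> vol * sq_norm N (scaled_iter F n)"
    by (rule T_bound) (auto intro: scaled_iter_bdd_meas assms)
  also have "\<dots> \<le> vol * smom F 0"
    using decseqD[OF smom_decseq[OF assms(1)], of 0 "2 * n"]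
    by (intro mult_left_mono vol_nonneg) (simp add: sq_norm_scaled_iter assms)
  finally show ?thesis
    using top_pos by (simp add: field_simps)
qed

text \<open>The iterates are Cauchy in the mean because the normalised moments decrease to a limit.
  One more application of \<open>T\<close>, the reason for \<open>Suc n\<close>, makes them Cauchy
  at every point.\<close>

lemma scaled_iter_Cauchy:
  assumes "F \<in> bdd_meas N" "z \<in> space N"
  shows "Cauchy (\<lambda>n. scaled_iter F (Suc n) z)"
proof (rule metric_CauchyI)
  fix e :: real assume "e > 0"
  obtain L where L: "smom F \<longlonglongrightarrow> L"
    using smom_convergent[OF assms(1)] by blast
  \<comment> \<open>Chosen so that \<open>(vol + 1) * (4 * d) = (e * top_ev)\<^sup>2\<close>; the
    moments deviate from \<open>L\<close> by less than \<open>d\<close> and enter with total weight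
    4. The 1 added to \<open>vol\<close> also covers a space of measure zero.\<close>
  define d where "d = (e * top_ev)\<^sup>2 / (4 * (vol + 1))"
  have "d > 0"
    using \<open>e > 0\<close> top_pos vol_nonneg by (simp add: d_def)
  then obtain n0 where n0: "\<And>n. n \<ge> n0 \<Longrightarrow> \<bar>smom F n - L\<bar> < d"
    using L by (metis LIMSEQ_D real_norm_def)
  have "dist (scaled_iter F (Suc n) z) (scaled_iter F (Suc l) z) < e" if "n \<ge> n0" "l \<ge> n0" for n l
  proof -
    let ?D = "\<lambda>w. scaled_iter F n w + (- 1) * scaled_iter F l w"
    have "top_ev\<^sup>2 * (cmod (scaled_iter F (Suc n) z - scaled_iter F (Suc l) z))\<^sup>2 = (cmod (T ?D z))\<^sup>2"
      using assms top_pos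
      by (subst T_add_scale)
        (auto simp: scaled_iter_bdd_meas T_scaled_iter norm_mult power_mult_distrib simp flip: right_diff_distrib)
    also have "\<dots> \<le> vol * sq_norm N ?D"
      by (intro T_bound bdd_meas_add bdd_meas_scale scaled_iter_bdd_meas assms)
    also have "sq_norm N ?D = smom F (2 * n) - 2 * smom F (n + l) + smom F (2 * l)"
      using sq_norm_scaled_iter_diff[OF assms(1), of n l] by simp
    also have "vol * \<dots> \<le> vol * (4 * d)"
      using n0[of "2 * n"] n0[of "n + l"] n0[of "2 * l"] that
      by (intro mult_left_mono vol_nonneg) linarith
    also have "\<dots> < (vol + 1) * (4 * d)"
      using \<open>d > 0\<close> by simp
    also have "\<dots> = (e * top_ev)\<^sup>2"
      using vol_nonneg by (simp add: d_def field_simps)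
    finally have "(cmod (scaled_iter F (Suc n) z - scaled_iter F (Suc l) z))\<^sup>2 < e\<^sup>2"
      using top_pos by (simp add: power_mult_distrib)
    then show ?thesis
      using \<open>e > 0\<close> by (simp add: dist_norm power2_less_imp_less)
  qed
  then show "\<exists>M. \<forall>m\<ge>M. \<forall>n\<ge>M. dist (scaled_iter F (Suc m) z) (scaled_iter F (Suc n) z) < e"
    by blast
qed

text \<open>Dominated convergence is used twice: in the recursion of the iterates, which yields the
  eigenvalue equation, and in their norms, which yields \<open>sq_norm N G = L\<close>. Positivity
  of \<open>L\<close> is what keeps \<open>G\<close> from vanishing.\<close>

lemma eigenfunction_of_limit:
  assumes F: "F \<in> bdd_meas N" and L: "smom F \<longlonglongrightarrow> L" and "L > 0"
  obtains G where "G \<in> bdd_meas N" "\<And>z. z \<in> space N \<Longrightarrow> T G z = complex_of_real top_ev * G z" "sq_norm N G > 0"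
proof -
  define G where "G z = lim (\<lambda>n. scaled_iter F (Suc n) z)" for z
  define B where "B = sqrt (vol * smom F 0 / top_ev\<^sup>2)"
  have lim: "(\<lambda>n. scaled_iter F (Suc n) z) \<longlonglongrightarrow> G z" if "z \<in> space N" for z
    using scaled_iter_Cauchy[OF F that] unfolding G_def
    by (simp add: Cauchy_convergent_iff convergent_LIMSEQ_iff)
  have [measurable]: "scaled_iter F n \<in> borel_measurable N" for n
    using scaled_iter_bdd_meas[OF F] by (rule bdd_meas_measurable)
  have G_meas [measurable]: "G \<in> borel_measurable N"
    by (rule borel_measurable_LIMSEQ_metric[OF _ lim]) measurable
  have bnd: "cmod (scaled_iter F (Suc n) z) \<le> B" if "z \<in> space N" for n z
    unfolding B_def using scaled_iter_bound[OF F that] by (rule real_le_rsqrt)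
  have G_bnd: "cmod (G z) \<le> B" if "z \<in> space N" for z
    by (rule LIMSEQ_le_const2[OF tendsto_norm[OF lim[OF that]]]) (use bnd that in auto)
  have "B \<ge> 0"
    using smom_nonneg[OF F, of 0] vol_nonneg by (simp add: B_def)
  have 1: "T G z = complex_of_real top_ev * G z" if z: "z \<in> space N" for z
  proof -
    have "(\<lambda>n. T (scaled_iter F (Suc n)) z) \<longlonglongrightarrow> T G z"
      unfolding T_def
    proof (rule integral_dominated_convergence[where w = "\<lambda>_. 1 * B"])
      show "AE w in N. (\<lambda>n. K z w * scaled_iter F (Suc n) w) \<longlonglongrightarrow> K z w * G w"
        using lim by (auto intro!: tendsto_intros)
      show "AE w in N. norm (K z w * scaled_iter F (Suc n) w) \<le> 1 * B" for n
        using bnd K_bound[OF z] unfolding norm_mult by (intro AE_I2 mult_mono) auto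
    qed (use z in auto)
    moreover have "(\<lambda>n. T (scaled_iter F (Suc n)) z) \<longlonglongrightarrow> complex_of_real top_ev * G z"
      unfolding T_scaled_iter using LIMSEQ_Suc[OF lim[OF z]] by (intro tendsto_intros)
    ultimately show ?thesis
      by (rule LIMSEQ_unique)
  qed
  have "(\<lambda>n. sq_norm N (scaled_iter F (Suc n))) \<longlonglongrightarrow> sq_norm N G"
    unfolding sq_norm_def
  proof (rule integral_dominated_convergence[where w = "\<lambda>_. B\<^sup>2"])
    show "AE w in N. (\<lambda>n. (cmod (scaled_iter F (Suc n) w))\<^sup>2) \<longlonglongrightarrow> (cmod (G w))\<^sup>2"
      using lim by (auto intro!: tendsto_intros)
    show "AE w in N. norm ((cmod (scaled_iter F (Suc n) w))\<^sup>2) \<le> B\<^sup>2" for n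
      using bnd by (auto intro!: power_mono)
  qed auto
  moreover have "(\<lambda>n. sq_norm N (scaled_iter F (Suc n))) \<longlonglongrightarrow> L"
    unfolding sq_norm_scaled_iter[OF F]
    by (rule LIMSEQ_subseq_LIMSEQ[OF L, unfolded o_def]) (auto simp: strict_mono_def)
  ultimately have "sq_norm N G = L"
    by (rule LIMSEQ_unique)
  then show ?thesis
    using that[of G] 1 bmI[OF G_meas G_bnd] \<open>L > 0\<close> by auto
qed

text \<open>By log-convexity the ratios of successive moments increase, and the first ratio is the
  Rayleigh quotient of \<open>F\<close>, which exceeds \<open>r\<close>.\<close>

lemma mom_ge_power:
  assumes F: "F \<in> bdd_meas N" and "r > 0" and r: "r * sq_norm N F < R F"
  shows "sq_norm N F * r ^ n \<le> mom F n"
proof -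
  have m0: "mom F 0 = sq_norm N F" and m1: "mom F 1 = R F"
    using mom_even[OF F, of 0] mom_odd[OF F, of 0] by auto
  have pos: "sq_norm N F > 0"
  proof (rule ccontr)
    assume "\<not> sq_norm N F > 0"
    then have "sq_norm N F = 0"
      using sq_norm_nonneg[of N F] by linarith
    then show False
      using r R_le_top[OF F] by simp
  qed
  have "0 < mom F n \<and> r * mom F n \<le> mom F (Suc n)" for n
  proof (induction n)
    case 0
    then show ?case
      using r pos m0 m1 by simp
  next
    case (Suc n)
    then have *: "0 < mom F (Suc n)"
      using \<open>r > 0\<close> by (meson mult_pos_pos order_less_le_trans)
    have "mom F n * (r * mom F (Suc n)) \<le> mom F (Suc n) * mom F (Suc n)"
      using mult_right_mono[of "r * mom F n" "mom F (Suc n)" "mom F (Suc n)"] Suc *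
      by (simp add: mult_ac)
    also have "\<dots> \<le> mom F n * mom F (Suc (Suc n))"
      using mom_log_convex[OF F, of n] by (simp add: power2_eq_square)
    finally show ?case
      using Suc * by (simp only: mult_le_cancel_left_pos)
  qed
  then have step: "r * mom F n \<le> mom F (Suc n)" for n
    by blast
  show ?thesis
  proof (induction n)
    case (Suc n)
    then have "r * (sq_norm N F * r ^ n) \<le> r * mom F n"
      using \<open>r > 0\<close> by simp
    with step[of n] show ?case
      by (simp add: mult_ac)
  qed (simp add: m0)
qed

lemma Tn_column_measurable:
  "(\<lambda>(w, z). (T ^^ n) (column w) z) \<in> borel_measurable (N \<Otimes>\<^sub>M N)"
proof (induction n)
  case 0
  show ?case
    by (simp add: column_def) measurable
next
  case (Suc n)
  note [measurable] = Suc
  have "(\<lambda>(w, z). LINT v|N. K z v * (T ^^ n) (column w) v) \<in> borel_measurable (N \<Otimes>\<^sub>M N)"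
    by measurable
  moreover have "(\<lambda>(w, z). (T ^^ Suc n) (column w) z) = (\<lambda>(w, z). LINT v|N. K z v * (T ^^ n) (column w) v)"
    unfolding funpow.simps o_apply by (subst T_def) (rule refl)
  ultimately show ?case
    by (simp only:)
qed

text \<open>The right-hand side is the trace of the iterated kernel; it dominates the operator norm of the
  iterate because \<open>T\<close> followed by evaluation at \<open>w\<close> is the inner product with \<open>column w\<close>.\<close>

lemma trace_ge_power:
  assumes r: "0 < r" "r < top_ev"
  shows "r ^ (2 * j + 2) \<le> (LINT w|N. sq_norm N ((T ^^ j) (column w)))"
proof -
  have "\<exists>F\<in>bdd_meas N. r < R F / sq_norm N F"
    using r(2) unfolding top_ev_def
    by (subst (asm) less_cSUP_iff[OF _ R_quotient_bdd]) (use bdd_meas_const in auto)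
  then obtain F where F: "F \<in> bdd_meas N" "r < R F / sq_norm N F"
    by blast
  have pos: "sq_norm N F > 0"
  proof (rule ccontr)
    assume "\<not> sq_norm N F > 0"
    then have "sq_norm N F = 0"
      using sq_norm_nonneg[of N F] by linarith
    then show False
      using F(2) r(1) by simp
  qed
  have [measurable]: "F \<in> borel_measurable N"
    using F(1) by (rule bdd_meas_measurable)
  note [measurable] = Tn_column_measurable
  \<comment> \<open>Serves integrability of the trace integrand: the normalised moments of a column
    decrease from its squared norm.\<close>
  have bnd: "sq_norm N ((T ^^ j) (column w)) \<le> top_ev ^ (2 * j) * vol" if w: "w \<in> space N" for w
  proof -
    have "mom (column w) (2 * j) / top_ev ^ (2 * j) \<le> mom (column w) 0"
      using decseqD[OF smom_decseq[OF column_bdd_meas[OF w]], of 0 "2 * j"] by (simp add: smom_def)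
    also have "\<dots> \<le> vol"
      using mom_even[OF column_bdd_meas[OF w], of 0] sq_norm_column[OF w] by simp
    finally show ?thesis
      using top_pos mom_even[OF column_bdd_meas[OF w], of j] by (simp add: pos_divide_le_eq mult.commute)
  qed
  have "sq_norm N F * r ^ (2 * j + 2) \<le> mom F (2 * Suc j)"
    using mom_ge_power[OF F(1) r(1), of "2 * Suc j"] F(2) pos by (simp add: pos_less_divide_eq)
  also have "\<dots> = (LINT w|N. (cmod (T ((T ^^ j) F) w))\<^sup>2)"
    using mom_even[OF F(1), of "Suc j"] by (simp add: sq_norm_def)
  also have "\<dots> \<le> (LINT w|N. sq_norm N F * sq_norm N ((T ^^ j) (column w)))"
  proof (rule integral_mono)
    fix w assume w: "w \<in> space N"
    have "T ((T ^^ j) F) w = ip N F ((T ^^ j) (column w))"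
      using ip_Tn[OF F(1) column_bdd_meas[OF w], of 0 j] by (simp add: T_eq_ip[of _ w])
    then show "(cmod (T ((T ^^ j) F) w))\<^sup>2 \<le> sq_norm N F * sq_norm N ((T ^^ j) (column w))"
      using F(1) w by (simp add: ip_Cauchy_Schwarz bdd_meas_sq_int Tn_bdd_meas column_bdd_meas)
  next
    show "integrable N (\<lambda>w. (cmod (T ((T ^^ j) F) w))\<^sup>2)"
      using F(1) by (intro sq_int_integrable bdd_meas_sq_int T_bdd_meas Tn_bdd_meas)
    have "integrable N (\<lambda>w. sq_norm N ((T ^^ j) (column w)))"
      using bnd by (intro integrable_const_bound[of _ "top_ev ^ (2 * j) * vol"] AE_I2)
        (auto simp: sq_norm_def[of N "(T ^^ j) (column _)"])
    then show "integrable N (\<lambda>w. sq_norm N F * sq_norm N ((T ^^ j) (column w)))"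
      by simp
  qed
  finally have "sq_norm N F * r ^ (2 * j + 2) \<le> sq_norm N F * (LINT w|N. sq_norm N ((T ^^ j) (column w)))"
    by simp
  then show ?thesis
    using pos by (simp only: mult_le_cancel_left_pos)
qed

text \<open>If all limits were 0, dominated convergence would send the traces divided by
  \<open>top_ev ^ (2 * j)\<close> to 0, whereas \<open>trace_ge_power\<close> keeps them above
  \<open>top_ev\<^sup>2\<close>.\<close>

lemma exists_nonvanishing_column:
  obtains w L where "w \<in> space N" "smom (column w) \<longlonglongrightarrow> L" "L > 0"
proof (rule ccontr)
  note exists = that
  assume no: "\<not> thesis"
  have lim0: "smom (column w) \<longlonglongrightarrow> 0" if w: "w \<in> space N" for w
  proof -
    obtain L where "smom (column w) \<longlonglongrightarrow> L" "0 \<le> L"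
      using smom_convergent[OF column_bdd_meas[OF w]] by blast
    then show ?thesis
      using no exists[OF w] by (cases "L = 0") auto
  qed
  note [measurable] = Tn_column_measurable
  have eq: "smom (column w) (2 * j) = sq_norm N ((T ^^ j) (column w)) / top_ev ^ (2 * j)" if "w \<in> space N" for w j
    using that by (simp add: smom_def mom_even column_bdd_meas)
  have "(\<lambda>j. LINT w|N. sq_norm N ((T ^^ j) (column w)) / top_ev ^ (2 * j)) \<longlonglongrightarrow> (LINT w|N. 0)"
  proof (rule integral_dominated_convergence[where w = "\<lambda>_. vol"])
    show "AE w in N. (\<lambda>j. sq_norm N ((T ^^ j) (column w)) / top_ev ^ (2 * j)) \<longlonglongrightarrow> 0"
    proof (rule AE_I2)
      fix w assume w: "w \<in> space N"
      have "(\<lambda>j. smom (column w) (2 * j)) \<longlonglongrightarrow> 0"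
        by (rule LIMSEQ_subseq_LIMSEQ[OF lim0[OF w], unfolded o_def]) (auto simp: strict_mono_def)
      then show "(\<lambda>j. sq_norm N ((T ^^ j) (column w)) / top_ev ^ (2 * j)) \<longlonglongrightarrow> 0"
        by (simp add: eq[OF w])
    qed
    show "AE w in N. norm (sq_norm N ((T ^^ j) (column w)) / top_ev ^ (2 * j)) \<le> vol" for j
    proof (rule AE_I2)
      fix w assume w: "w \<in> space N"
      have "smom (column w) (2 * j) \<le> vol"
        using decseqD[OF smom_decseq[OF column_bdd_meas[OF w]], of 0 "2 * j"] sq_norm_column[OF w]
          mom_even[OF column_bdd_meas[OF w], of 0] by (simp add: smom_def)
      then show "norm (sq_norm N ((T ^^ j) (column w)) / top_ev ^ (2 * j)) \<le> vol"
        using eq[OF w, of j] smom_nonneg[OF column_bdd_meas[OF w], of "2 * j"] by simp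
    qed
  qed (auto simp: sq_norm_def)
  moreover have "top_ev\<^sup>2 \<le> (LINT w|N. sq_norm N ((T ^^ j) (column w)) / top_ev ^ (2 * j))" for j
  proof -
    \<comment> \<open>\<open>trace_ge_power\<close> covers \<open>r < top_ev\<close> only, as the
      supremum is not known to be attained; here \<open>r\<close> tends to \<open>top_ev\<close>
      from the left.\<close>
    have "top_ev ^ (2 * j + 2) \<le> (LINT w|N. sq_norm N ((T ^^ j) (column w)))"
    proof (rule tendsto_upperbound)
      show "((\<lambda>r. r ^ (2 * j + 2)) \<longlongrightarrow> top_ev ^ (2 * j + 2)) (at_left top_ev)"
        by (intro tendsto_intros)
      show "\<forall>\<^sub>F r in at_left top_ev. r ^ (2 * j + 2) \<le> (LINT w|N. sq_norm N ((T ^^ j) (column w)))"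
        using eventually_at_left_real[OF top_pos] by eventually_elim (rule trace_ge_power, auto)
    qed simp
    then show ?thesis
      using top_pos by (simp add: pos_le_divide_eq power_add power2_eq_square mult_ac)
  qed
  ultimately have "top_ev\<^sup>2 \<le> (LINT w|N. 0)"
    by (intro LIMSEQ_le_const) auto
  then show False
    using top_pos by simp
qed

theorem top_eigenfunction:
  obtains G where "G \<in> bdd_meas N" "\<And>z. z \<in> space N \<Longrightarrow> T G z = complex_of_real top_ev * G z" "sq_norm N G > 0"
  using exists_nonvanishing_column eigenfunction_of_limit column_bdd_meas by metis

end

end

section \<open>Operators given by families of vectors\<close>

text \<open>\<open>V\<close> is the analysis map of the family, \<open>synth\<close> its adjoint,
  and \<open>gram\<close> the kernel of \<open>V\<close> after \<open>synth\<close>. The space of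
  \<open>M\<close> may have infinite measure, so the eigenvalue problem of \<open>synth\<close>
  after \<open>V\<close> is solved through \<open>gram\<close>, which lives on the finite space of
  \<open>N\<close>.\<close>

locale vector_family = N: finite_measure N + M: sigma_finite_measure M
  for N :: "'z measure" and M :: "'t measure" +
  fixes e :: "'z \<Rightarrow> 't \<Rightarrow> complex"
  assumes e_measurable [measurable]: "case_prod e \<in> borel_measurable (N \<Otimes>\<^sub>M M)"
    and e_sq_int: "z \<in> space N \<Longrightarrow> e z \<in> sq_int M"
    and e_norm: "z \<in> space N \<Longrightarrow> sq_norm M (e z) \<le> 1"
begin

sublocale NM: pair_sigma_finite N M
  by standard

definition V :: "('t \<Rightarrow> complex) \<Rightarrow> 'z \<Rightarrow> complex" where
  "V f z = ip M f (e z)"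

definition synth :: "('z \<Rightarrow> complex) \<Rightarrow> 't \<Rightarrow> complex" where
  "synth F t = (LINT z|N. F z * e z t)"

definition gram :: "'z \<Rightarrow> 'z \<Rightarrow> complex" where
  "gram z w = ip M (e w) (e z)"

lemma V_measurable:
  assumes [measurable]: "f \<in> borel_measurable M" shows "V f \<in> borel_measurable N"
  unfolding V_def[abs_def] ip_def by measurable

lemma V_bound:
  assumes "f \<in> sq_int M" "z \<in> space N" shows "(cmod (V f z))\<^sup>2 \<le> sq_norm M f"
proof -
  have "(cmod (V f z))\<^sup>2 \<le> sq_norm M f * sq_norm M (e z)"
    unfolding V_def using assms by (intro ip_Cauchy_Schwarz e_sq_int)
  also have "\<dots> \<le> sq_norm M f * 1"
    using assms by (intro mult_left_mono e_norm) auto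
  finally show ?thesis
    by simp
qed

lemma V_bdd_meas:
  assumes "f \<in> sq_int M" shows "V f \<in> bdd_meas N"
  using V_measurable[OF sq_int_measurable[OF assms]] V_bound[OF assms]
  by (intro bmI[of _ _ "sqrt (sq_norm M f)"]) (auto intro: real_le_rsqrt)

lemma Fubini_e:
  assumes F: "F \<in> bdd_meas N" and f: "f \<in> sq_int M"
  shows "integrable (N \<Otimes>\<^sub>M M) (\<lambda>(z, t). F z * e z t * cnj (f t))"
proof (rule NM.Fubini_integrable)
  obtain B where B: "B \<ge> 0" "\<And>z. z \<in> space N \<Longrightarrow> cmod (F z) \<le> B"
    using F by (metis bdd_meas_bound)
  have [measurable]: "F \<in> borel_measurable N" "f \<in> borel_measurable M"
    using F f by (auto simp: bdd_meas_measurable sq_int_measurable)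
  show "(\<lambda>(z, t). F z * e z t * cnj (f t)) \<in> borel_measurable (N \<Otimes>\<^sub>M M)"
    by measurable
  have int: "integrable M (\<lambda>t. F z * e z t * cnj (f t))" if "z \<in> space N" for z
    using sq_int_integrable_mult[OF e_sq_int[OF that] f] by (simp add: mult.assoc)
  then show "AE z in N. integrable M (\<lambda>t. case (z, t) of (z, t) \<Rightarrow> F z * e z t * cnj (f t))"
    by auto
  have "(LINT t|M. cmod (F z * e z t * cnj (f t))) \<le> B * (1 + sq_norm M f)" if z: "z \<in> space N" for z
  proof -
    have "(LINT t|M. cmod (F z * e z t * cnj (f t))) \<le> (LINT t|M. B * ((cmod (e z t))\<^sup>2 + (cmod (f t))\<^sup>2))"
    proof (rule integral_mono)
      show "cmod (F z * e z t * cnj (f t)) \<le> B * ((cmod (e z t))\<^sup>2 + (cmod (f t))\<^sup>2)" for t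
        using B(2)[OF z] B(1) norm_mult_le_sum_squares[of "e z t" "f t"]
        by (simp add: norm_mult mult.assoc mult_mono)
    qed (use int[OF z] sq_int_integrable[OF e_sq_int[OF z]] sq_int_integrable[OF f] in auto)
    also have "\<dots> = B * (sq_norm M (e z) + sq_norm M f)"
      using sq_int_integrable[OF e_sq_int[OF z]] sq_int_integrable[OF f] by (simp add: sq_norm_def)
    also have "\<dots> \<le> B * (1 + sq_norm M f)"
      using B(1) e_norm[OF z] by (intro mult_left_mono) auto
    finally show ?thesis .
  qed
  then show "integrable N (\<lambda>z. LINT t|M. norm (case (z, t) of (z, t) \<Rightarrow> F z * e z t * cnj (f t)))"
    by (intro N.integrable_const_bound[of _ "B * (1 + sq_norm M f)"] AE_I2) auto
qed

lemma synth_measurable: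
  assumes [measurable]: "F \<in> borel_measurable N" shows "synth F \<in> borel_measurable M"
  unfolding synth_def[abs_def] by measurable

lemma ip_synth:
  assumes "F \<in> bdd_meas N" "f \<in> sq_int M"
  shows "ip M (synth F) f = ip N F (V f)"
proof -
  have "ip M (synth F) f = (LINT t|M. LINT z|N. F z * e z t * cnj (f t))"
    by (simp add: ip_def synth_def)
  also have "\<dots> = (LINT z|N. LINT t|M. F z * e z t * cnj (f t))"
    by (rule NM.Fubini_integral[OF Fubini_e[OF assms]])
  also have "\<dots> = ip N F (V f)"
    by (simp add: ip_def V_def mult.assoc mult.commute[of "e _ _"] flip: Bochner_Integration.integral_cnj)
  finally show ?thesis .
qed

lemma e_sq_integrable: "integrable (N \<Otimes>\<^sub>M M) (\<lambda>(z, t). (cmod (e z t))\<^sup>2)"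
proof (rule NM.Fubini_integrable)
  show "integrable N (\<lambda>z. LINT t|M. norm (case (z, t) of (z, t) \<Rightarrow> (cmod (e z t))\<^sup>2))"
    using e_norm by (intro N.integrable_const_bound[of _ 1] AE_I2) (auto simp: sq_norm_def)
  show "AE z in N. integrable M (\<lambda>t. case (z, t) of (z, t) \<Rightarrow> (cmod (e z t))\<^sup>2)"
    using e_sq_int by (auto simp: sq_int_def)
qed measurable

lemma AE_e_sq_int: "AE t in M. (\<lambda>z. e z t) \<in> sq_int N"
proof -
  have "AE t in M. integrable N (\<lambda>z. (cmod (e z t))\<^sup>2)"
    using NM.AE_integrable_snd[OF e_sq_integrable] by simp
  then show ?thesis
    using AE_space[of M]
  proof eventually_elim
    case (elim t)
    have "(\<lambda>z. e z t) \<in> borel_measurable N"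
      using measurable_Pair1[OF e_measurable elim(2)] by simp
    then show ?case
      using elim(1) unfolding sq_int_def by blast
  qed
qed

text \<open>Cauchy-Schwarz in \<open>z\<close> at almost every \<open>t\<close>; the dominating
  function is integrable because the squared norms of the \<open>e z\<close> have a finite integral
  over \<open>N\<close>.\<close>

lemma synth_sq_int:
  assumes F: "F \<in> bdd_meas N" shows "synth F \<in> sq_int M"
proof -
  have [measurable]: "F \<in> borel_measurable N"
    using F by (rule bdd_meas_measurable)
  have cF: "(\<lambda>z. cnj (F z)) \<in> bdd_meas N"
    using F by (auto simp: bdd_meas_def)
  have "AE t in M. (cmod (synth F t))\<^sup>2 \<le> sq_norm N F * (LINT z|N. (cmod (e z t))\<^sup>2)"
    using AE_e_sq_int
  proof eventually_elim
    case (elim t)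
    have "synth F t = ip N (\<lambda>z. e z t) (\<lambda>z. cnj (F z))"
      by (simp add: synth_def ip_def mult.commute)
    have "(cmod (synth F t))\<^sup>2 \<le> sq_norm N (\<lambda>z. e z t) * sq_norm N (\<lambda>z. cnj (F z))"
      unfolding \<open>synth F t = _\<close> by (rule ip_Cauchy_Schwarz[OF elim N.bdd_meas_sq_int[OF cF]])
    also have "\<dots> = sq_norm N F * (LINT z|N. (cmod (e z t))\<^sup>2)"
      by (simp add: sq_norm_def)
    finally show ?case .
  qed
  note bound = this
  have "integrable M (\<lambda>t. sq_norm N F * (LINT z|N. (cmod (e z t))\<^sup>2))"
    using NM.integrable_snd[OF e_sq_integrable] by simp
  then have "integrable M (\<lambda>t. (cmod (synth F t))\<^sup>2)"
  proof (rule Bochner_Integration.integrable_bound)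
    show "AE t in M. norm ((cmod (synth F t))\<^sup>2) \<le> norm (sq_norm N F * (LINT z|N. (cmod (e z t))\<^sup>2))"
      using bound by eventually_elim simp
  qed (use synth_measurable[of F] in measurable)
  then show ?thesis
    by (simp add: sq_int_def synth_measurable)
qed

lemma V_synth:
  assumes "F \<in> bdd_meas N" "z \<in> space N"
  shows "V (synth F) z = (LINT w|N. gram z w * F w)"
proof -
  have "V (synth F) z = ip N F (V (e z))"
    unfolding V_def[of _ z] by (intro ip_synth assms e_sq_int)
  also have "\<dots> = (LINT w|N. F w * cnj (ip M (e z) (e w)))"
    by (simp add: ip_def V_def)
  also have "\<dots> = (LINT w|N. gram z w * F w)"
    by (simp add: gram_def ip_cnj[of M _ "e z"] mult.commute)
  finally show ?thesis .
qed

lemma ip_V_synth_self: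
  assumes "F \<in> bdd_meas N" shows "ip N (V (synth F)) F = of_real (sq_norm M (synth F))"
proof -
  have "ip N (V (synth F)) F = cnj (ip N F (V (synth F)))"
    by (rule ip_cnj)
  also have "\<dots> = of_real (sq_norm M (synth F))"
    by (subst ip_synth[symmetric]) (auto simp: assms synth_sq_int ip_self)
  finally show ?thesis .
qed

sublocale PK: psd_kernel N gram
proof
  show "case_prod gram \<in> borel_measurable (N \<Otimes>\<^sub>M N)"
    unfolding gram_def ip_def by measurable
  show "cmod (gram z w) \<le> 1" if "z \<in> space N" "w \<in> space N" for z w
  proof -
    have "(cmod (gram z w))\<^sup>2 \<le> sq_norm M (e w) * sq_norm M (e z)"
      unfolding gram_def using that by (intro ip_Cauchy_Schwarz e_sq_int)
    also have "\<dots> \<le> 1 * 1"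
      using that by (intro mult_mono e_norm) auto
    finally show ?thesis
      by (simp add: abs_square_le_1)
  qed
  show "gram w z = cnj (gram z w)" for z w
    unfolding gram_def by (rule ip_cnj)
  \<comment> \<open>The form of the Gram kernel at \<open>F\<close> is the squared norm of
    \<open>synth F\<close>.\<close>
  show "0 \<le> Re (ip N (\<lambda>z. LINT w|N. gram z w * F w) F)" if F: "F \<in> bdd_meas N" for F
  proof -
    have "ip N (\<lambda>z. LINT w|N. gram z w * F w) F = ip N (V (synth F)) F"
      unfolding ip_def by (intro Bochner_Integration.integral_cong refl) (simp add: V_synth[OF F])
    then show ?thesis
      by (simp add: ip_V_synth_self F)
  qed
qed

lemma V_synth_T: "F \<in> bdd_meas N \<Longrightarrow> z \<in> space N \<Longrightarrow> V (synth F) z = PK.T F z"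
  by (simp add: V_synth PK.T_def)

lemma sq_norm_synth: "F \<in> bdd_meas N \<Longrightarrow> sq_norm M (synth F) = PK.R F"
proof -
  assume F: "F \<in> bdd_meas N"
  have "ip N (PK.T F) F = ip N (V (synth F)) F"
    unfolding ip_def by (intro Bochner_Integration.integral_cong refl) (simp add: V_synth_T[OF F])
  then show ?thesis
    by (simp add: PK.R_def ip_V_synth_self F)
qed

text \<open>Cauchy-Schwarz for \<open>ip M (synth (V f)) f\<close>, which is the squared norm of
  \<open>V f\<close> by adjointness. It carries Rayleigh bounds from the Gram kernel back to
  \<open>V\<close>.\<close>

lemma sq_norm_V_le_R:
  assumes "f \<in> sq_int M" shows "(sq_norm N (V f))\<^sup>2 \<le> PK.R (V f) * sq_norm M f"
proof -
  note F = V_bdd_meas[OF assms]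
  have "ip M (synth (V f)) f = of_real (sq_norm N (V f))"
    using ip_synth[OF F assms] by (simp add: ip_self)
  then show ?thesis
    using ip_Cauchy_Schwarz[OF synth_sq_int[OF F] assms] by (simp add: sq_norm_synth F)
qed

text \<open>Nonzero eigenvalues are common to the two products of \<open>V\<close> and its adjoint:
  an eigenfunction \<open>G\<close> of the Gram operator is mapped by \<open>synth\<close>, and the
  factor \<open>1 / top_ev\<close> makes \<open>V f = G\<close>. The function \<open>f0\<close>
  ensures that \<open>top_ev\<close> is positive.\<close>

theorem top_eigenvector:
  assumes f0: "f0 \<in> sq_int M" "sq_norm N (V f0) > 0"
  obtains \<mu> f where "\<mu> > 0" "f \<in> sq_int M" "sq_norm M f > 0" "\<And>t. synth (V f) t = complex_of_real \<mu> * f t"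
    "\<And>r. r \<in> sq_int M \<Longrightarrow> sq_norm N (V r) \<le> \<mu> * sq_norm M r"
proof -
  let ?m = "PK.top_ev"
  have "0 < PK.R (V f0) * sq_norm M f0"
    using sq_norm_V_le_R[OF f0(1)] f0(2) by (meson less_le_trans zero_less_power)
  then have "0 < PK.R (V f0)"
    by (metis PK.R_nonneg V_bdd_meas f0(1) less_eq_real_def mult_zero_left)
  then have "0 < ?m * sq_norm N (V f0)"
    using PK.R_le_top[OF V_bdd_meas[OF f0(1)]] by linarith
  then have m: "?m > 0"
    using f0(2) by (simp add: zero_less_mult_iff)
  obtain G where G: "G \<in> bdd_meas N" "\<And>z. z \<in> space N \<Longrightarrow> PK.T G z = complex_of_real ?m * G z" "sq_norm N G > 0"
    using PK.top_eigenfunction[OF m] by blast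
  define f where "f t = complex_of_real (1 / ?m) * synth G t" for t
  have f: "f \<in> sq_int M"
    unfolding f_def by (intro sq_int_scale synth_sq_int G)
  have Vf: "V f z = G z" if "z \<in> space N" for z
  proof -
    have "V f z = complex_of_real (1 / ?m) * V (synth G) z"
      unfolding V_def f_def by (rule ip_scale_left)
    then show ?thesis
      using m by (simp add: V_synth_T G that)
  qed
  have "PK.R G = ?m * sq_norm N G"
  proof -
    have "ip N (PK.T G) G = ip N (\<lambda>z. complex_of_real ?m * G z) G"
      unfolding ip_def by (intro Bochner_Integration.integral_cong refl) (simp add: G(2))
    then show ?thesis
      by (simp add: PK.R_def ip_scale_left ip_self)
  qed
  then have "sq_norm M (synth G) > 0"
    using m G(3) by (simp add: sq_norm_synth G(1))
  then have nf: "sq_norm M f > 0"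
    using m unfolding f_def sq_norm_def by (simp add: norm_mult norm_divide power_mult_distrib power_divide)
  have eig: "synth (V f) t = complex_of_real ?m * f t" for t
  proof -
    have "synth (V f) t = synth G t"
      unfolding synth_def by (intro Bochner_Integration.integral_cong refl) (simp add: Vf)
    then show ?thesis
      using m by (simp add: f_def)
  qed
  have ray: "sq_norm N (V r) \<le> ?m * sq_norm M r" if r: "r \<in> sq_int M" for r
  proof (cases "sq_norm N (V r) = 0")
    case True
    then show ?thesis
      using m by simp
  next
    case False
    then have pos: "sq_norm N (V r) > 0"
      using sq_norm_nonneg[of N "V r"] by linarith
    have "(sq_norm N (V r))\<^sup>2 \<le> PK.R (V r) * sq_norm M r"
      by (rule sq_norm_V_le_R[OF r])
    also have "\<dots> \<le> (?m * sq_norm N (V r)) * sq_norm M r"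
      by (intro mult_right_mono PK.R_le_top V_bdd_meas r) auto
    finally have "sq_norm N (V r) * sq_norm N (V r) \<le> sq_norm N (V r) * (?m * sq_norm M r)"
      by (simp add: power2_eq_square mult_ac)
    then show ?thesis
      using pos by (simp only: mult_le_cancel_left_pos)
  qed
  show ?thesis
    by (rule that[OF m f nf eig ray])
qed

end

section \<open>Finite orthonormal systems and their residuals\<close>

definition orthonormal :: "'t measure \<Rightarrow> 'i set \<Rightarrow> ('i \<Rightarrow> 't \<Rightarrow> complex) \<Rightarrow> bool" where
  "orthonormal M A h \<longleftrightarrow> (\<forall>k\<in>A. h k \<in> sq_int M) \<and>
     (\<forall>j\<in>A. \<forall>k\<in>A. ip M (h j) (h k) = (if j = k then 1 else 0))"

definition proj :: "'t measure \<Rightarrow> 'i set \<Rightarrow> ('i \<Rightarrow> 't \<Rightarrow> complex) \<Rightarrow> ('t \<Rightarrow> complex) \<Rightarrow> 't \<Rightarrow> complex" where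
  "proj M A h f t = (\<Sum>k\<in>A. ip M f (h k) * h k t)"

definition resid :: "'t measure \<Rightarrow> 'i set \<Rightarrow> ('i \<Rightarrow> 't \<Rightarrow> complex) \<Rightarrow> ('t \<Rightarrow> complex) \<Rightarrow> 't \<Rightarrow> complex" where
  "resid M A h f t = f t - proj M A h f t"

lemma orthonormal_ip:
  "orthonormal M A h \<Longrightarrow> j \<in> A \<Longrightarrow> k \<in> A \<Longrightarrow> ip M (h j) (h k) = (if j = k then 1 else 0)"
  by (simp add: orthonormal_def)

lemma proj_sq_int: "orthonormal M A h \<Longrightarrow> proj M A h f \<in> sq_int M"
  unfolding proj_def[abs_def] by (intro sq_int_sum sq_int_scale) (simp add: orthonormal_def)

lemma resid_sq_int: "orthonormal M A h \<Longrightarrow> f \<in> sq_int M \<Longrightarrow> resid M A h f \<in> sq_int M"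
  unfolding resid_def[abs_def] by (intro sq_int_diff proj_sq_int)

lemma ip_proj_left:
  assumes "orthonormal M A h" "u \<in> sq_int M"
  shows "ip M (proj M A h f) u = (\<Sum>k\<in>A. ip M f (h k) * ip M (h k) u)"
  unfolding proj_def[abs_def] using assms
  by (subst ip_sum_left) (auto simp: ip_scale_left orthonormal_def intro: sq_int_scale)

lemma ip_resid_basis:
  assumes "orthonormal M A h" "finite A" "f \<in> sq_int M" "k \<in> A"
  shows "ip M (resid M A h f) (h k) = 0"
proof -
  have hk: "h k \<in> sq_int M"
    using assms by (auto simp: orthonormal_def)
  have "ip M (proj M A h f) (h k) = (\<Sum>j\<in>A. if j = k then ip M f (h k) else 0)"
    unfolding ip_proj_left[OF assms(1) hk]
    by (intro sum.cong refl) (simp add: orthonormal_ip[OF assms(1)] assms(4))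
  then show ?thesis
    unfolding resid_def[abs_def]
    using assms by (subst ip_diff_left) (auto simp: hk proj_sq_int)
qed

lemma sq_norm_resid:
  assumes "orthonormal M A h" "finite A" "f \<in> sq_int M"
  shows "sq_norm M (resid M A h f) = sq_norm M f - (\<Sum>k\<in>A. (cmod (ip M f (h k)))\<^sup>2)"
proof -
  let ?r = "resid M A h f"
  have r: "?r \<in> sq_int M"
    by (rule resid_sq_int[OF assms(1,3)])
  have "ip M (proj M A h f) ?r = (\<Sum>k\<in>A. ip M f (h k) * cnj (ip M ?r (h k)))"
    unfolding ip_proj_left[OF assms(1) r]
    by (intro sum.cong refl) (simp add: ip_cnj[of M "h _" ?r])
  also have "\<dots> = 0"
    using ip_resid_basis[OF assms] by simp
  finally have "ip M (proj M A h f) ?r = 0" .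
  moreover have "ip M ?r ?r = ip M f ?r - ip M (proj M A h f) ?r"
    using ip_diff_left[OF assms(3) proj_sq_int[OF assms(1)] r] by (simp add: resid_def[abs_def])
  moreover have "ip M ?r f = ip M f f - ip M (proj M A h f) f"
    using ip_diff_left[OF assms(3) proj_sq_int[OF assms(1)] assms(3)] by (simp add: resid_def[abs_def])
  ultimately have "complex_of_real (sq_norm M ?r) = cnj (sq_norm M f - ip M (proj M A h f) f)"
    using ip_cnj[of M f ?r] by (simp add: ip_self)
  also have "\<dots> = complex_of_real (sq_norm M f - (\<Sum>k\<in>A. (cmod (ip M f (h k)))\<^sup>2))"
    by (simp add: ip_proj_left[OF assms(1,3)] ip_cnj[of M "h _" f] complex_norm_square mult.commute
        del: of_real_power)
  finally show ?thesis
    by (simp only: of_real_eq_iff)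
qed

lemma Bessel:
  assumes "orthonormal M A h" "finite A" "f \<in> sq_int M"
  shows "(\<Sum>k\<in>A. (cmod (ip M f (h k)))\<^sup>2) \<le> sq_norm M f"
  using sq_norm_resid[OF assms] sq_norm_nonneg[of M "resid M A h f"] by linarith

lemma resid_basis:
  assumes "orthonormal M A h" "finite A" "k \<in> A"
  shows "resid M A h (h k) t = 0"
proof -
  have "proj M A h (h k) t = (\<Sum>j\<in>A. if j = k then h k t else 0)"
    unfolding proj_def by (intro sum.cong refl) (simp add: orthonormal_ip[OF assms(1)] assms(3))
  then show ?thesis
    using assms by (simp add: resid_def)
qed

text \<open>Self-adjointness of the projection. Through it, analysing \<open>f\<close> with the
  residuals of the \<open>e z\<close> is the same as analysing the residual of \<open>f\<close> with
  the \<open>e z\<close>.\<close>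

lemma ip_resid_right:
  assumes "orthonormal M A h" "f \<in> sq_int M" "g \<in> sq_int M"
  shows "ip M f (resid M A h g) = ip M (resid M A h f) g"
proof -
  have "ip M f (proj M A h g) = cnj (\<Sum>k\<in>A. ip M g (h k) * ip M (h k) f)"
    by (subst ip_cnj) (simp add: ip_proj_left assms)
  also have "\<dots> = (\<Sum>k\<in>A. ip M f (h k) * ip M (h k) g)"
    by (simp add: ip_cnj[of M _ f] ip_cnj[of M "h _" g] mult.commute)
  also have "\<dots> = ip M (proj M A h f) g"
    by (simp add: ip_proj_left assms)
  finally show ?thesis
    unfolding resid_def[abs_def] using assms
    by (simp add: ip_diff_left ip_diff_right proj_sq_int)
qed

text \<open>\<open>h_complete\<close> treats one eigenvalue at a time and starts from an eigenvector
  that is already at hand. The expansion of the whole operator is derived from it below.\<close>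

locale eigen_family = vector_family N M e
  for N :: "'z measure" and M :: "'t measure" and e :: "'z \<Rightarrow> 't \<Rightarrow> complex" +
  fixes h :: "'i \<Rightarrow> 't \<Rightarrow> complex" and lam :: "'i \<Rightarrow> real" and I :: "'i set"
  assumes h_orthonormal: "orthonormal M I h"
    and lam_nonzero: "k \<in> I \<Longrightarrow> lam k \<noteq> 0"
    and h_eigen: "k \<in> I \<Longrightarrow> AE t in M. synth (V (h k)) t = complex_of_real (lam k) * h k t"
    and h_complete: "\<mu> \<noteq> 0 \<Longrightarrow> f \<in> sq_int M \<Longrightarrow> \<not> (AE t in M. f t = 0) \<Longrightarrow>
      (AE t in M. synth (V f) t = \<mu> * f t) \<Longrightarrow>
      \<exists>F c. finite F \<and> F \<subseteq> {k \<in> I. complex_of_real (lam k) = \<mu>} \<and>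
        (AE t in M. f t = (\<Sum>k\<in>F. c k * h k t))"
begin

lemma h_sq_int: "k \<in> I \<Longrightarrow> h k \<in> sq_int M"
  using h_orthonormal by (simp add: orthonormal_def)

lemma orthonormal_subset: "A \<subseteq> I \<Longrightarrow> orthonormal M A h"
  using h_orthonormal unfolding orthonormal_def by (metis subsetD)

lemma ip_V_eigen:
  assumes "k \<in> I" "f \<in> sq_int M"
  shows "ip N (V (h k)) (V f) = complex_of_real (lam k) * ip M (h k) f"
proof -
  have "ip N (V (h k)) (V f) = ip M (synth (V (h k))) f"
    using assms by (intro ip_synth[symmetric] V_bdd_meas h_sq_int)
  also have "\<dots> = ip M (\<lambda>t. complex_of_real (lam k) * h k t) f"
    using h_sq_int[OF assms(1)] assms(2)
    by (intro ip_cong_AE[OF h_eigen[OF assms(1)]])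
       (auto simp: sq_int_measurable intro!: sq_int_measurable[OF synth_sq_int] V_bdd_meas)
  finally show ?thesis
    by (simp add: ip_scale_left)
qed

lemma sq_norm_V_eigen: "k \<in> I \<Longrightarrow> sq_norm N (V (h k)) = lam k"
  using ip_V_eigen[of k "h k"] h_sq_int[of k] orthonormal_ip[OF h_orthonormal, of k k]
  by (simp add: ip_self)

lemma lam_pos: "k \<in> I \<Longrightarrow> 0 < lam k"
  using sq_norm_V_eigen[of k] sq_norm_nonneg[of N "V (h k)"] lam_nonzero[of k] by linarith

lemma V_resid:
  assumes "A \<subseteq> I" "f \<in> sq_int M" "z \<in> space N"
  shows "V (resid M A h f) z = V f z - (\<Sum>k\<in>A. ip M f (h k) * V (h k) z)"
  unfolding V_def resid_def[abs_def]
  using assms orthonormal_subset[OF assms(1)]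
  by (simp add: ip_diff_left proj_sq_int e_sq_int ip_proj_left)

text \<open>By \<open>ip_V_eigen\<close>, orthogonality to \<open>h k\<close> in \<open>M\<close>
  becomes orthogonality of the images under \<open>V\<close> in \<open>N\<close>, so the energies of
  the removed components simply subtract.\<close>

lemma sq_norm_V_resid:
  assumes A: "A \<subseteq> I" "finite A" and f: "f \<in> sq_int M"
  shows "sq_norm N (V (resid M A h f)) = sq_norm N (V f) - (\<Sum>k\<in>A. lam k * (cmod (ip M f (h k)))\<^sup>2)"
proof -
  let ?r = "resid M A h f"
  note o = orthonormal_subset[OF A(1)]
  have r: "?r \<in> sq_int M"
    by (rule resid_sq_int[OF o f])
  have Vs: "u \<in> sq_int M \<Longrightarrow> V u \<in> sq_int N" for u
    by (intro N.bdd_meas_sq_int V_bdd_meas)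
  have split: "ip N (V ?r) (V u) = ip N (V f) (V u) - (\<Sum>k\<in>A. ip M f (h k) * (lam k * ip M (h k) u))"
    if u: "u \<in> sq_int M" for u
  proof -
    have "ip N (V ?r) (V u) = ip N (\<lambda>z. V f z - (\<Sum>k\<in>A. ip M f (h k) * V (h k) z)) (V u)"
      unfolding ip_def[of N]
      by (intro Bochner_Integration.integral_cong refl) (simp add: V_resid A f)
    also have "\<dots> = ip N (V f) (V u) - ip N (\<lambda>z. \<Sum>k\<in>A. ip M f (h k) * V (h k) z) (V u)"
      using A by (intro ip_diff_left Vs f u sq_int_sum sq_int_scale h_sq_int) auto
    also have "ip N (\<lambda>z. \<Sum>k\<in>A. ip M f (h k) * V (h k) z) (V u) =
        (\<Sum>k\<in>A. ip M f (h k) * (lam k * ip M (h k) u))"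
      using A by (subst ip_sum_left)
        (auto simp: ip_scale_left ip_V_eigen u subset_eq intro!: Vs sq_int_scale h_sq_int u)
    finally show ?thesis .
  qed
  have "ip M (h k) ?r = 0" if "k \<in> A" for k
    using ip_resid_basis[OF o A(2) f that] ip_cnj[of M "h k" ?r] by simp
  then have "ip N (V ?r) (V ?r) = cnj (ip N (V ?r) (V f))"
    using split[OF r] ip_cnj[of N "V f" "V ?r"] by simp
  also have "\<dots> = complex_of_real (sq_norm N (V f) - (\<Sum>k\<in>A. lam k * (cmod (ip M f (h k)))\<^sup>2))"
    by (simp add: split f ip_self ip_cnj[of M "h _" f] complex_norm_square mult_ac del: of_real_power)
  finally show ?thesis
    by (simp only: ip_self of_real_eq_iff)
qed

text \<open>Replacing each \<open>e z\<close> by its component orthogonal to finitely many eigenvectors deflates the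
  operator, so that the existence of a top eigenvector applies to the orthogonal complement.\<close>

lemma deflated_family:
  assumes A: "A \<subseteq> I" "finite A"
  shows "vector_family N M (\<lambda>z. resid M A h (e z))"
proof
  note o = orthonormal_subset[OF A(1)]
  have [measurable]: "h k \<in> borel_measurable M" if "k \<in> A" for k
    using h_sq_int A that by (auto simp: sq_int_measurable)
  show "(\<lambda>(z, t). resid M A h (e z) t) \<in> borel_measurable (N \<Otimes>\<^sub>M M)"
    unfolding resid_def proj_def ip_def by measurable
  show "resid M A h (e z) \<in> sq_int M" if "z \<in> space N" for z
    by (rule resid_sq_int[OF o e_sq_int[OF that]])
  show "sq_norm M (resid M A h (e z)) \<le> 1" if "z \<in> space N" for z
    using sq_norm_resid[OF o A(2) e_sq_int[OF that]] e_norm[OF that]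
      sum_nonneg[of A "\<lambda>k. (cmod (ip M (e z) (h k)))\<^sup>2"] by simp
qed

text \<open>If \<open>V r\<close> does not vanish, the deflated family has a top eigenvector
  \<open>f\<close> with eigenvalue \<open>\<mu>\<close>. It is orthogonal to \<open>h k\<close> for
  \<open>k\<close> in \<open>A\<close>, hence an eigenvector of the original operator as well, hence
  by \<open>h_complete\<close> a combination of \<open>h k\<close> with
  \<open>lam k = \<mu>\<close>. One such index lies outside \<open>A\<close>, so
  \<open>\<mu> \<le> c\<close>.\<close>

lemma sq_norm_V_orthogonal_le:
  assumes A: "A \<subseteq> I" "finite A" and r: "r \<in> sq_int M" "\<And>k. k \<in> A \<Longrightarrow> ip M r (h k) = 0"
    and c: "c \<ge> 0" "\<And>k. k \<in> I - A \<Longrightarrow> lam k \<le> c"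
  shows "sq_norm N (V r) \<le> c * sq_norm M r"
proof (cases "sq_norm N (V r) = 0")
  case False
  note o = orthonormal_subset[OF A(1)]
  interpret D: vector_family N M "\<lambda>z. resid M A h (e z)"
    by (rule deflated_family[OF A])
  have DV: "D.V f z = V (resid M A h f) z" if "f \<in> sq_int M" "z \<in> space N" for f z
    unfolding D.V_def V_def using that by (intro ip_resid_right o e_sq_int)
  have DV_orth: "D.V f z = V f z"
    if "f \<in> sq_int M" "z \<in> space N" "\<And>k. k \<in> A \<Longrightarrow> ip M f (h k) = 0" for f z
    using that by (simp add: DV V_resid A)
  have eqV: "sq_norm N (D.V r) = sq_norm N (V r)"
    unfolding sq_norm_def by (intro Bochner_Integration.integral_cong refl) (simp add: DV_orth r)
  have "sq_norm N (D.V r) > 0"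
    unfolding eqV using False sq_norm_nonneg[of N "V r"] by linarith
  then obtain \<mu> f where \<mu>: "\<mu> > 0" and f: "f \<in> sq_int M" "sq_norm M f > 0"
    and eig: "\<And>t. D.synth (D.V f) t = complex_of_real \<mu> * f t"
    and ray: "\<And>r. r \<in> sq_int M \<Longrightarrow> sq_norm N (D.V r) \<le> \<mu> * sq_norm M r"
    using D.top_eigenvector[OF r(1)] by blast
  \<comment> \<open>The deflated analysis map annihilates \<open>h k\<close>, so by adjointness the
    range of the deflated operator is orthogonal to it.\<close>
  have f_orth: "ip M f (h k) = 0" if k: "k \<in> A" for k
  proof -
    have hk: "h k \<in> sq_int M"
      using k A by (auto intro: h_sq_int)
    have "complex_of_real \<mu> * ip M f (h k) = ip M (D.synth (D.V f)) (h k)"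
      by (simp add: eig[abs_def] ip_scale_left)
    also have "\<dots> = ip N (D.V f) (D.V (h k))"
      by (intro D.ip_synth D.V_bdd_meas f hk)
    also have "\<dots> = ip N (D.V f) (\<lambda>z. 0)"
      unfolding ip_def
      by (intro Bochner_Integration.integral_cong refl)
        (simp add: DV hk resid_basis[OF o A(2) k] V_def ip_def)
    finally show ?thesis
      using \<mu> by (simp add: ip_def)
  qed
  have DVf: "D.V f z = V f z" if "z \<in> space N" for z
    using that f f_orth by (intro DV_orth) auto
  \<comment> \<open>At \<open>f\<close> the two operators differ by multiples of
    \<open>ip N (V f) (V (h k))\<close>, which vanish. The integrals are split where
    \<open>e z t\<close> is square integrable in \<open>z\<close>, that is at almost every
    \<open>t\<close>.\<close>
  have "AE t in M. synth (V f) t = complex_of_real \<mu> * f t"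
    using AE_e_sq_int
  proof eventually_elim
    case (elim t)
    have int: "integrable N (\<lambda>z. V f z * e z t)"
    proof -
      have "(\<lambda>z. cnj (V f z)) \<in> sq_int N"
        using N.bdd_meas_sq_int[OF V_bdd_meas[OF f(1)]] by (auto simp: sq_int_def)
      from sq_int_integrable_mult[OF elim this] show ?thesis
        by (simp add: mult.commute)
    qed
    have int2: "integrable N (\<lambda>z. V f z * (ip M (e z) (h k) * h k t))" if "k \<in> A" for k
    proof -
      have "integrable N (\<lambda>z. V f z * cnj (V (h k) z))"
        using that A by (intro sq_int_integrable_mult N.bdd_meas_sq_int V_bdd_meas f h_sq_int) auto
      then have "integrable N (\<lambda>z. V f z * cnj (V (h k) z) * h k t)"
        by simp
      then show ?thesis
        by (simp add: V_def ip_cnj[of M "e _"] mult.assoc)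
    qed
    have zero: "(LINT z|N. V f z * (ip M (e z) (h k) * h k t)) = 0" if k: "k \<in> A" for k
    proof -
      have "(LINT z|N. V f z * (ip M (e z) (h k) * h k t)) = ip N (V f) (V (h k)) * h k t"
        by (simp add: V_def ip_cnj[of M "e _"] ip_def[of N] flip: mult.assoc)
      also have "ip N (V f) (V (h k)) = cnj (lam k * ip M (h k) f)"
        using k A f by (subst ip_cnj) (auto simp: ip_V_eigen)
      also have "ip M (h k) f = 0"
        using f_orth[OF k] ip_cnj[of M "h k" f] by simp
      finally show ?thesis
        by simp
    qed
    have "complex_of_real \<mu> * f t = D.synth (V f) t"
      unfolding eig[symmetric] D.synth_def
      by (intro Bochner_Integration.integral_cong refl) (simp add: DVf)
    also have "\<dots> = (LINT z|N. V f z * e z t - (\<Sum>k\<in>A. V f z * (ip M (e z) (h k) * h k t)))"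
      by (simp add: D.synth_def resid_def proj_def right_diff_distrib sum_distrib_left)
    also have "\<dots> = synth (V f) t - (\<Sum>k\<in>A. LINT z|N. V f z * (ip M (e z) (h k) * h k t))"
      using int int2 by (simp add: synth_def)
    finally show ?case
      using zero by simp
  qed
  moreover have "\<not> (AE t in M. f t = 0)"
  proof
    assume "AE t in M. f t = 0"
    then have "sq_norm M f = (LINT t|M. 0)"
      unfolding sq_norm_def using f(1) by (intro integral_cong_AE) (auto simp: sq_int_measurable)
    then show False
      using f(2) by simp
  qed
  ultimately obtain F c' where F: "finite F" "F \<subseteq> {k \<in> I. complex_of_real (lam k) = complex_of_real \<mu>}"
    and fF: "AE t in M. f t = (\<Sum>k\<in>F. c' k * h k t)"
    using h_complete[of "complex_of_real \<mu>" f] \<mu> f by auto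
  \<comment> \<open>Otherwise \<open>f\<close> would be orthogonal to itself.\<close>
  have "\<not> F \<subseteq> A"
  proof
    assume FA: "F \<subseteq> A"
    have hF: "h k \<in> sq_int M" if "k \<in> F" for k
      using that F by (auto intro: h_sq_int)
    have sF: "(\<lambda>t. \<Sum>k\<in>F. c' k * h k t) \<in> sq_int M"
      by (intro sq_int_sum sq_int_scale hF)
    have "ip M f f = ip M (\<lambda>t. \<Sum>k\<in>F. c' k * h k t) f"
      by (rule ip_cong_AE[OF fF]) (use f sF in \<open>auto simp: sq_int_measurable\<close>)
    also have "\<dots> = (\<Sum>k\<in>F. c' k * ip M (h k) f)"
      by (subst ip_sum_left) (auto simp: ip_scale_left intro: sq_int_scale hF f)
    also have "\<dots> = 0"
      using FA f_orth ip_cnj[of M _ f] by (intro sum.neutral) (auto simp: subset_eq)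
    finally show False
      using f(2) by (simp add: ip_self)
  qed
  then obtain k where "k \<in> F" "k \<notin> A"
    by blast
  then have "\<mu> \<le> c"
    using F(2) c(2)[of k] by auto
  have "sq_norm N (V r) = sq_norm N (D.V r)"
    by (rule eqV[symmetric])
  also have "\<dots> \<le> \<mu> * sq_norm M r"
    by (rule ray[OF r(1)])
  also have "\<dots> \<le> c * sq_norm M r"
    using \<open>\<mu> \<le> c\<close> by (intro mult_right_mono) auto
  finally show ?thesis .
qed (use c in simp)

text \<open>The trace bound: Bessel's inequality for each \<open>e z\<close>, integrated over
  \<open>N\<close>.\<close>

lemma sum_lam_le:
  assumes A: "A \<subseteq> I" "finite A"
  shows "(\<Sum>k\<in>A. lam k) \<le> measure N (space N)"
proof -
  note o = orthonormal_subset[OF A(1)]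
  have int: "integrable N (\<lambda>z. (cmod (V (h k) z))\<^sup>2)" if "k \<in> A" for k
    using that A by (intro sq_int_integrable N.bdd_meas_sq_int V_bdd_meas h_sq_int) auto
  have "(\<Sum>k\<in>A. lam k) = (\<Sum>k\<in>A. sq_norm N (V (h k)))"
    using A by (intro sum.cong refl) (auto simp: sq_norm_V_eigen)
  also have "\<dots> = (LINT z|N. (\<Sum>k\<in>A. (cmod (V (h k) z))\<^sup>2))"
    using int by (simp add: sq_norm_def)
  also have "\<dots> \<le> (LINT z|N. 1)"
  proof (rule integral_mono)
    fix z assume z: "z \<in> space N"
    have "(\<Sum>k\<in>A. (cmod (V (h k) z))\<^sup>2) = (\<Sum>k\<in>A. (cmod (ip M (e z) (h k)))\<^sup>2)"
      by (simp add: V_def ip_cnj[of M "e z"])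
    also have "\<dots> \<le> 1"
      using Bessel[OF o A(2) e_sq_int[OF z]] e_norm[OF z] by linarith
    finally show "(\<Sum>k\<in>A. (cmod (V (h k) z))\<^sup>2) \<le> 1" .
  qed (use int in auto)
  finally show ?thesis
    by simp
qed

text \<open>\<open>sq_norm_V_orthogonal_le\<close> for the residual of \<open>f\<close>. The error
  depends on \<open>f\<close> through its norm only, which makes the later truncation error uniform
  over phase space.\<close>

lemma spectral_gap:
  assumes A: "A \<subseteq> I" "finite A" and f: "f \<in> sq_int M"
    and c: "c \<ge> 0" "\<And>k. k \<in> I - A \<Longrightarrow> lam k \<le> c"
  shows "\<bar>sq_norm N (V f) - (\<Sum>k\<in>A. lam k * (cmod (ip M f (h k)))\<^sup>2)\<bar> \<le> c * sq_norm M f"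
proof -
  note o = orthonormal_subset[OF A(1)]
  have "sq_norm N (V (resid M A h f)) \<le> c * sq_norm M (resid M A h f)"
    using A f c by (intro sq_norm_V_orthogonal_le resid_sq_int o ip_resid_basis) auto
  also have "\<dots> \<le> c * sq_norm M f"
    using c(1) sum_nonneg[of A "\<lambda>k. (cmod (ip M f (h k)))\<^sup>2"]
    by (intro mult_left_mono) (simp_all add: sq_norm_resid[OF o A(2) f])
  finally show ?thesis
    using sq_norm_nonneg[of N "V (resid M A h f)"] by (simp add: sq_norm_V_resid A f)
qed

end

section \<open>Lebesgue measure on \<open>\<real>\<^sup>n\<close>\<close>

interpretation lborel_product: product_sigma_finite "\<lambda>_::nat. lborel :: real measure" ..

text \<open>One map for all substitutions: translation for \<open>s = 1\<close>, reflection for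
  \<open>s = - 1\<close>, dilation for \<open>a = 0\<close>. The change of variables is then proved
  once.\<close>

definition aff_map :: "nat \<Rightarrow> vec \<Rightarrow> real \<Rightarrow> vec \<Rightarrow> vec" where
  "aff_map n a s x = (\<lambda>i\<in>{..<n}. a i + s * x i)"

lemma space_lebR: "space (lebR n) = Rn n"
  by (simp add: lebR_def Rn_def space_PiM)

lemma measurable_lebR_component [measurable]: "i < n \<Longrightarrow> (\<lambda>x. x i) \<in> borel_measurable (lebR n)"
  unfolding lebR_def by measurable

lemma measurable_lebRI:
  assumes "\<And>i. i < n \<Longrightarrow> (\<lambda>x. f x i) \<in> borel_measurable M"
    and "\<And>x. x \<in> space M \<Longrightarrow> f x \<in> Rn n"
  shows "f \<in> measurable M (lebR n)"
  unfolding lebR_def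
  by (rule measurable_PiM_single') (use assms in \<open>auto simp: Rn_def PiE_iff\<close>)

lemma sigma_finite_lebR: "sigma_finite_measure (lebR n)"
  unfolding lebR_def by (rule lborel_product.sigma_finite) simp

lemma lebR_eqI:
  assumes "sets P = sets (lebR n)"
    and "\<And>A. (\<And>i. i < n \<Longrightarrow> A i \<in> sets borel) \<Longrightarrow>
      emeasure P (Pi\<^sub>E {..<n} A) = (\<Prod>i<n. emeasure lborel (A i))"
  shows "P = lebR n"
  unfolding lebR_def
  by (rule lborel_product.PiM_eqI) (use assms in \<open>auto simp: lebR_def\<close>)

lemma emeasure_lebR_box:
  "(\<And>i. i < n \<Longrightarrow> A i \<in> sets borel) \<Longrightarrow>
    emeasure (lebR n) (Pi\<^sub>E {..<n} A) = (\<Prod>i<n. emeasure lborel (A i))"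
  unfolding lebR_def by (subst lborel_product.emeasure_PiM) auto

lemma sets_lebR_box: "(\<And>i. i < n \<Longrightarrow> A i \<in> sets borel) \<Longrightarrow> Pi\<^sub>E {..<n} A \<in> sets (lebR n)"
  unfolding lebR_def by (rule sets_PiM_I_finite) auto

lemma aff_map_in_Rn [simp]: "aff_map n a s x \<in> Rn n"
  by (simp add: aff_map_def Rn_def)

lemma aff_map_measurable [measurable]: "aff_map n a s \<in> measurable (lebR n) (lebR n)"
proof (rule measurable_lebRI)
  show "(\<lambda>x. aff_map n a s x i) \<in> borel_measurable (lebR n)" if "i < n" for i
    using that by (simp add: aff_map_def)
qed auto

text \<open>Product measures are determined by boxes, and on a box this is the one-dimensional
  substitution in each coordinate.\<close>

lemma lebR_aff_map:
  assumes "s \<noteq> 0"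
  shows "lebR n = density (distr (lebR n) (lebR n) (aff_map n a s)) (\<lambda>_. ennreal (\<bar>s\<bar> ^ n))"
proof (rule lebR_eqI[symmetric])
  fix A :: "nat \<Rightarrow> real set" assume A: "\<And>i. i < n \<Longrightarrow> A i \<in> sets borel"
  have 1: "emeasure lborel (A i) = ennreal \<bar>s\<bar> * emeasure lborel ((\<lambda>x. a i + s * x) -` A i)" if "i < n" for i
    using A[OF that]
    by (subst lborel_real_affine[OF assms, of "a i"])
      (simp add: emeasure_density_const emeasure_distr)
  have "aff_map n a s -` (Pi\<^sub>E {..<n} A) \<inter> space (lebR n) = Pi\<^sub>E {..<n} (\<lambda>i. (\<lambda>x. a i + s * x) -` A i)"
    by (auto simp: space_lebR Rn_def aff_map_def PiE_iff extensional_def)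
  then have "emeasure (density (distr (lebR n) (lebR n) (aff_map n a s)) (\<lambda>_. ennreal (\<bar>s\<bar> ^ n))) (Pi\<^sub>E {..<n} A)
    = ennreal (\<bar>s\<bar> ^ n) * emeasure (lebR n) (Pi\<^sub>E {..<n} (\<lambda>i. (\<lambda>x. a i + s * x) -` A i))"
    using A by (simp add: emeasure_density_const emeasure_distr sets_lebR_box)
  also have "emeasure (lebR n) (Pi\<^sub>E {..<n} (\<lambda>i. (\<lambda>x. a i + s * x) -` A i)) =
    (\<Prod>i<n. emeasure lborel ((\<lambda>x. a i + s * x) -` A i))"
  proof (rule emeasure_lebR_box)
    show "(\<lambda>x. a i + s * x) -` A i \<in> sets borel" if "i < n" for i
      using measurable_sets[of "\<lambda>x. a i + s * x" borel borel "A i"] A[OF that] by simp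
  qed
  also have "ennreal (\<bar>s\<bar> ^ n) * \<dots> = (\<Prod>i<n. ennreal \<bar>s\<bar> * emeasure lborel ((\<lambda>x. a i + s * x) -` A i))"
    by (simp add: prod.distrib ennreal_power)
  also have "\<dots> = (\<Prod>i<n. emeasure lborel (A i))"
    using 1 by (intro prod.cong) auto
  finally show "emeasure (density (distr (lebR n) (lebR n) (aff_map n a s)) (\<lambda>_. ennreal (\<bar>s\<bar> ^ n))) (Pi\<^sub>E {..<n} A)
    = (\<Prod>i<n. emeasure lborel (A i))" .
qed simp

lemma nn_integral_aff_map:
  assumes "s \<noteq> 0" and [measurable]: "f \<in> borel_measurable (lebR n)"
  shows "(\<integral>\<^sup>+x. f x \<partial>lebR n) = ennreal (\<bar>s\<bar> ^ n) * (\<integral>\<^sup>+x. f (aff_map n a s x) \<partial>lebR n)"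
  by (subst lebR_aff_map[OF assms(1), of n a])
    (simp add: nn_integral_density nn_integral_distr nn_integral_cmult)

lemma integral_aff_map:
  fixes f :: "vec \<Rightarrow> 'b::{banach, second_countable_topology}"
  assumes "s \<noteq> 0" and [measurable]: "f \<in> borel_measurable (lebR n)"
  shows "(LINT x|lebR n. f x) = \<bar>s\<bar> ^ n *\<^sub>R (LINT x|lebR n. f (aff_map n a s x))"
  by (subst lebR_aff_map[OF assms(1), of n a])
    (simp add: integral_density integral_distr)

lemma integrable_aff_map_iff:
  fixes f :: "vec \<Rightarrow> 'b::{banach, second_countable_topology}"
  assumes "s \<noteq> 0" and [measurable]: "f \<in> borel_measurable (lebR n)"
  shows "integrable (lebR n) (\<lambda>x. f (aff_map n a s x)) \<longleftrightarrow> integrable (lebR n) f"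
proof -
  have "integrable (lebR n) f \<longleftrightarrow>
      integrable (density (distr (lebR n) (lebR n) (aff_map n a s)) (\<lambda>_. ennreal (\<bar>s\<bar> ^ n))) f"
    by (subst lebR_aff_map[OF assms(1), of n a]) simp
  also have "\<dots> \<longleftrightarrow> integrable (lebR n) (\<lambda>x. f (aff_map n a s x))"
  proof -
    have "integrable (lebR n) (\<lambda>x. f (aff_map n a s x))"
      if "integrable (lebR n) (\<lambda>x. \<bar>s\<bar> ^ n *\<^sub>R f (aff_map n a s x))"
      using integrable_scaleR_right[OF that, of "inverse (\<bar>s\<bar> ^ n)"] assms(1) by simp
    then show ?thesis
      by (auto simp: integrable_density integrable_distr_eq)
  qed
  finally show ?thesis
    by simp
qed

section \<open>Translations as affine maps\<close>

definition vadd :: "nat \<Rightarrow> vec \<Rightarrow> vec \<Rightarrow> vec" where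
  "vadd n x a = (\<lambda>i\<in>{..<n}. x i + a i)"

lemma vadd_aff_map: "vadd n x a = aff_map n a 1 x"
  by (simp add: vadd_def aff_map_def add.commute)

lemma vdiff_aff_map: "vdiff n x a = aff_map n (\<lambda>i. - a i) 1 x"
  by (simp add: vdiff_def aff_map_def)

lemma vdiff_aff_map_right: "vdiff n a x = aff_map n a (- 1) x"
  by (simp add: vdiff_def aff_map_def)

lemmas nn_integral_vadd = nn_integral_aff_map[of 1, simplified, folded vadd_aff_map, symmetric]
lemmas integral_vadd = integral_aff_map[of 1, simplified, folded vadd_aff_map, symmetric]
lemmas integrable_vadd_iff = integrable_aff_map_iff[of 1, simplified, folded vadd_aff_map]
lemmas nn_integral_vdiff = nn_integral_aff_map[of 1 _ _ "\<lambda>i. - a i" for a, simplified, folded vdiff_aff_map, symmetric]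
lemmas integral_vdiff = integral_aff_map[of 1 _ _ "\<lambda>i. - a i" for a, simplified, folded vdiff_aff_map, symmetric]
lemmas integrable_vdiff_iff = integrable_aff_map_iff[of 1 _ _ "\<lambda>i. - a i" for a, simplified, folded vdiff_aff_map]
lemmas nn_integral_vdiff_right = nn_integral_aff_map[of "- 1", simplified, folded vdiff_aff_map_right, symmetric]

lemma measurable_vdiff [measurable]:
  assumes [measurable]: "f \<in> measurable M (lebR n)" "g \<in> measurable M (lebR n)"
  shows "(\<lambda>x. vdiff n (f x) (g x)) \<in> measurable M (lebR n)"
proof (rule measurable_lebRI)
  show "(\<lambda>x. vdiff n (f x) (g x) i) \<in> borel_measurable M" if "i < n" for i
    using that by (auto simp: vdiff_def intro!: borel_measurable_diff
      measurable_compose[OF _ measurable_lebR_component] assms)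
qed (simp add: vdiff_def Rn_def)

lemma measurable_vadd [measurable]:
  assumes [measurable]: "f \<in> measurable M (lebR n)" "g \<in> measurable M (lebR n)"
  shows "(\<lambda>x. vadd n (f x) (g x)) \<in> measurable M (lebR n)"
proof (rule measurable_lebRI)
  show "(\<lambda>x. vadd n (f x) (g x) i) \<in> borel_measurable M" if "i < n" for i
    using that by (auto simp: vadd_def intro!: borel_measurable_add
      measurable_compose[OF _ measurable_lebR_component] assms)
qed (simp add: vadd_def Rn_def)

lemma measurable_dotp [measurable]:
  assumes [measurable]: "f \<in> measurable M (lebR n)" "g \<in> measurable M (lebR n)"
  shows "(\<lambda>x. dotp n (f x) (g x)) \<in> borel_measurable M"
  unfolding dotp_def
  by (intro borel_measurable_sum borel_measurable_times measurable_compose[OF _ measurable_lebR_component])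
    (use assms in auto)

section \<open>Phase space as a product of position and frequency\<close>

definition vjoin :: "nat \<Rightarrow> vec \<times> vec \<Rightarrow> vec" where
  "vjoin d p = (\<lambda>i\<in>{..<2 * d}. if i < d then fst p i else snd p (i - d))"

lemma vjoin_in_Rn: "vjoin d p \<in> Rn (2 * d)"
  by (simp add: vjoin_def Rn_def)

lemma pos_vjoin: "x \<in> Rn d \<Longrightarrow> pos d (vjoin d (x, y)) = x"
  by (auto simp: pos_def vjoin_def Rn_def fun_eq_iff PiE_iff extensional_def)

lemma freq_vjoin: "y \<in> Rn d \<Longrightarrow> freq d (vjoin d (x, y)) = y"
  by (auto simp: freq_def vjoin_def Rn_def fun_eq_iff PiE_iff extensional_def)

lemma measurable_pos [measurable]: "pos d \<in> measurable (lebR (2 * d)) (lebR d)"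
  by (rule measurable_lebRI) (auto simp: pos_def Rn_def)

lemma measurable_freq [measurable]: "freq d \<in> measurable (lebR (2 * d)) (lebR d)"
  by (rule measurable_lebRI) (auto simp: freq_def Rn_def)

lemma measurable_vjoin [measurable]: "vjoin d \<in> measurable (lebR d \<Otimes>\<^sub>M lebR d) (lebR (2 * d))"
proof (rule measurable_lebRI)
  show "(\<lambda>x. vjoin d x i) \<in> borel_measurable (lebR d \<Otimes>\<^sub>M lebR d)" if "i < 2 * d" for i
  proof (cases "i < d")
    case True
    then show ?thesis
      using that by (simp add: vjoin_def)
  next
    case False
    then have "i - d < d"
      using that by simp
    then show ?thesis
      using that False by (simp add: vjoin_def)
  qed
qed (rule vjoin_in_Rn)

lemma distr_vjoin: "distr (lebR d \<Otimes>\<^sub>M lebR d) (lebR (2 * d)) (vjoin d) = lebR (2 * d)"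
proof (rule lebR_eqI)
  interpret S: sigma_finite_measure "lebR d"
    by (rule sigma_finite_lebR)
  fix A :: "nat \<Rightarrow> real set" assume A: "\<And>i. i < 2 * d \<Longrightarrow> A i \<in> sets borel"
  have "vjoin d -` (Pi\<^sub>E {..<2 * d} A) \<inter> space (lebR d \<Otimes>\<^sub>M lebR d) =
      Pi\<^sub>E {..<d} A \<times> Pi\<^sub>E {..<d} (\<lambda>i. A (d + i))" (is "?l = ?r")
  proof
    show "?l \<subseteq> ?r"
    proof
      fix p assume p: "p \<in> ?l"
      then have J: "vjoin d p i \<in> A i" if "i < 2 * d" for i
        using that by (auto simp: PiE_iff)
      have "fst p i \<in> A i" if "i < d" for i
        using J[of i] that by (simp add: vjoin_def)
      moreover have "snd p i \<in> A (d + i)" if "i < d" for i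
        using J[of "d + i"] that by (simp add: vjoin_def)
      ultimately show "p \<in> ?r"
        using p by (auto simp: space_pair_measure space_lebR Rn_def PiE_iff)
    qed
    show "?r \<subseteq> ?l"
    proof
      fix p assume p: "p \<in> ?r"
      then have f: "fst p \<in> Pi\<^sub>E {..<d} A" and g: "snd p \<in> Pi\<^sub>E {..<d} (\<lambda>i. A (d + i))"
        by (simp_all only: mem_Times_iff)
      have 1: "fst p i \<in> A i" if "i < d" for i
        using PiE_mem[OF f, of i] that by simp
      have 2: "snd p i \<in> A (d + i)" if "i < d" for i
        using PiE_mem[OF g, of i] that by simp
      have "vjoin d p i \<in> A i" if "i < 2 * d" for i
      proof (cases "i < d")
        case False
        then show ?thesis
          using 2[of "i - d"] that by (simp add: vjoin_def)
      qed (use 1 that in \<open>simp add: vjoin_def\<close>)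
      then show "p \<in> ?l"
        using f g by (simp add: space_pair_measure space_lebR Rn_def PiE_iff vjoin_def mem_Times_iff)
    qed
  qed
  then have "emeasure (distr (lebR d \<Otimes>\<^sub>M lebR d) (lebR (2 * d)) (vjoin d)) (Pi\<^sub>E {..<2 * d} A)
     = emeasure (lebR d) (Pi\<^sub>E {..<d} A) * emeasure (lebR d) (Pi\<^sub>E {..<d} (\<lambda>i. A (d + i)))"
    using A by (simp add: emeasure_distr sets_lebR_box S.emeasure_pair_measure_Times)
  also have "\<dots> = (\<Prod>i<d. emeasure lborel (A i)) * (\<Prod>i<d. emeasure lborel (A (d + i)))"
    using A by (simp add: emeasure_lebR_box)
  also have "\<dots> = (\<Prod>i<2 * d. emeasure lborel (A i))"
  proof -
    have "(\<Prod>i<d. emeasure lborel (A (d + i))) = (\<Prod>i\<in>{d..<2 * d}. emeasure lborel (A i))"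
      by (rule prod.reindex_bij_witness[of _ "\<lambda>i. i - d" "\<lambda>i. d + i"]) auto
    moreover have "{..<2 * d} = {..<d} \<union> {d..<2 * d}"
      by auto
    moreover have "(\<Prod>i\<in>{..<d} \<union> {d..<2 * d}. emeasure lborel (A i)) =
      (\<Prod>i<d. emeasure lborel (A i)) * (\<Prod>i\<in>{d..<2 * d}. emeasure lborel (A i))"
      by (rule prod.union_disjoint) auto
    ultimately show ?thesis
      by (simp only:)
  qed
  finally show "emeasure (distr (lebR d \<Otimes>\<^sub>M lebR d) (lebR (2 * d)) (vjoin d)) (Pi\<^sub>E {..<2 * d} A) =
    (\<Prod>i<2 * d. emeasure lborel (A i))" .
qed simp

lemma nn_integral_vjoin:
  assumes [measurable]: "f \<in> borel_measurable (lebR (2 * d))"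
  shows "(\<integral>\<^sup>+z. f z \<partial>lebR (2 * d)) = (\<integral>\<^sup>+x. \<integral>\<^sup>+y. f (vjoin d (x, y)) \<partial>lebR d \<partial>lebR d)"
proof -
  interpret S: sigma_finite_measure "lebR d"
    by (rule sigma_finite_lebR)
  have "(\<integral>\<^sup>+z. f z \<partial>lebR (2 * d)) = (\<integral>\<^sup>+p. f (vjoin d p) \<partial>(lebR d \<Otimes>\<^sub>M lebR d))"
    by (subst distr_vjoin[symmetric]) (simp add: nn_integral_distr)
  also have "\<dots> = (\<integral>\<^sup>+x. \<integral>\<^sup>+y. f (vjoin d (x, y)) \<partial>lebR d \<partial>lebR d)"
    by (subst S.nn_integral_fst[symmetric]) auto
  finally show ?thesis .
qed

section \<open>Continuity of translations\<close>

lemma tendsto_vecI: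
  fixes f :: "'a \<Rightarrow> vec"
  assumes "\<And>i. ((\<lambda>k. f k i) \<longlongrightarrow> l i) F"
  shows "(f \<longlongrightarrow> l) F"
proof -
  have "limitin (product_topology (\<lambda>_::nat. euclideanreal) UNIV) f l F"
    using assms by (simp add: limitin_componentwise)
  then show ?thesis
    by (simp add: euclidean_product_topology)
qed

lemma tendsto_vecD:
  fixes f :: "'a \<Rightarrow> vec"
  assumes "(f \<longlongrightarrow> l) F"
  shows "((\<lambda>k. f k i) \<longlongrightarrow> l i) F"
proof -
  have "limitin (product_topology (\<lambda>_::nat. euclideanreal) UNIV) f l F"
    using assms by (simp add: euclidean_product_topology)
  then show ?thesis
    by (simp add: limitin_componentwise)
qed

text \<open>Points of \<open>Rn n\<close> have the constant value \<open>undefined\<close> in all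
  coordinates from \<open>n\<close> on, so the inclusion into the full function space is measurable.
  Together with \<open>sets_lebR_borel\<close> it identifies the sets of \<open>lebR n\<close> with
  traces of Borel sets, which are generated by closed sets.\<close>

lemma borel_Int_Rn_lebR:
  assumes "B \<in> sets borel" shows "B \<inter> Rn n \<in> sets (lebR n)"
proof -
  have "(\<lambda>x. x) \<in> measurable (lebR n) borel"
  proof (rule measurable_coordinatewise_then_product)
    fix i
    show "(\<lambda>x. x i) \<in> borel_measurable (lebR n)"
    proof (cases "i < n")
      case False
      then have "(\<lambda>x. x i) \<in> borel_measurable (lebR n) \<longleftrightarrow> (\<lambda>x::vec. undefined :: real) \<in> borel_measurable (lebR n)"
        by (intro measurable_cong) (auto simp: space_lebR Rn_def PiE_iff extensional_def)
      then show ?thesis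
        by simp
    qed simp
  qed
  from measurable_sets[OF this assms] show ?thesis
    by (simp add: space_lebR)
qed

lemma sets_lebR_borel:
  assumes "A \<in> sets (lebR n)"
  obtains B where "B \<in> sets borel" "A = B \<inter> Rn n"
proof -
  have "(\<lambda>x. x) \<in> measurable (restrict_space borel (Rn n)) (lebR n)"
  proof (rule measurable_lebRI)
    show "(\<lambda>x. x i) \<in> borel_measurable (restrict_space borel (Rn n))" for i
      by (intro measurable_restrict_space1 borel_measurable_continuous_onI continuous_on_product_coordinates)
  qed (simp add: space_restrict_space)
  from measurable_sets[OF this assms] have "A \<inter> Rn n \<in> sets (restrict_space borel (Rn n))"
    by (simp add: space_restrict_space)
  moreover have "A \<subseteq> Rn n"
    using sets.sets_into_space[OF assms] by (simp add: space_lebR)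
  ultimately have "A \<in> sets (restrict_space borel (Rn n))"
    by (simp add: Int_absorb2)
  then show ?thesis
    using that by (auto simp: sets_restrict_space Int_commute)
qed

definition cube :: "nat \<Rightarrow> real \<Rightarrow> vec set" where
  "cube n R = (\<Pi>\<^sub>E i\<in>{..<n}. {- R..R})"

lemma cube_subset: "cube n R \<subseteq> Rn n"
  by (auto simp: cube_def Rn_def)

lemma cube_sets [measurable]: "cube n R \<in> sets (lebR n)"
  unfolding cube_def by (rule sets_lebR_box) auto

lemma emeasure_cube_finite: "emeasure (lebR n) (cube n R) < \<infinity>"
  unfolding cube_def
  by (subst emeasure_lebR_box) (auto simp: power_less_top_ennreal emeasure_lborel_Icc_eq)

lemma mem_cube: "x \<in> cube n R \<longleftrightarrow> x \<in> Rn n \<and> (\<forall>i<n. \<bar>x i\<bar> \<le> R)"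
  by (auto simp: cube_def Rn_def PiE_iff abs_le_iff minus_le_iff)

lemma integrable_indicator_cube:
  assumes "A \<in> sets (lebR n)" shows "integrable (lebR n) (indicat_real (A \<inter> cube n R))"
proof -
  have "emeasure (lebR n) (A \<inter> cube n R) \<le> emeasure (lebR n) (cube n R)"
    by (intro emeasure_mono) auto
  then have "emeasure (lebR n) (A \<inter> cube n R) < \<infinity>"
    using emeasure_cube_finite le_less_trans by blast
  then show ?thesis
    using assms by simp
qed

text \<open>Continuity of translations is phrased along a null sequence of shifts because it is used
  inside dominated convergence. A translation sees the coordinates below \<open>n\<close>
  only.\<close>

locale shift_sequence =
  fixes n :: nat and u :: "nat \<Rightarrow> vec"
  assumes u_tendsto: "i < n \<Longrightarrow> (\<lambda>k. u k i) \<longlonglongrightarrow> 0"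
begin

definition shift_cont :: "(vec \<Rightarrow> real) \<Rightarrow> bool" where
  "shift_cont f \<longleftrightarrow> integrable (lebR n) f \<and>
     (\<lambda>k. LINT t|lebR n. \<bar>f (vadd n t (u k)) - f t\<bar>) \<longlonglongrightarrow> 0"

lemma shift_cont_integrable: "shift_cont f \<Longrightarrow> integrable (lebR n) f"
  by (simp add: shift_cont_def)

lemma shift_integrable:
  "integrable (lebR n) f \<Longrightarrow> integrable (lebR n) (\<lambda>t. f (vadd n t a) :: real)"
  using integrable_vadd_iff[of f n a] by simp

text \<open>The three-term estimate: translation preserves the integral, so the approximation error
  enters twice with the same value.\<close>

lemma shift_cont_limit:
  assumes g: "\<And>j. shift_cont (g j)" and f: "integrable (lebR n) f"
    and lim: "(\<lambda>j. LINT t|lebR n. \<bar>g j t - f t\<bar>) \<longlonglongrightarrow> 0"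
  shows "shift_cont f"
proof -
  have gi: "integrable (lebR n) (g j)" for j
    using g by (rule shift_cont_integrable)
  have "(\<lambda>k. LINT t|lebR n. \<bar>f (vadd n t (u k)) - f t\<bar>) \<longlonglongrightarrow> 0"
  proof (rule LIMSEQ_I)
    fix r :: real assume "r > 0"
    then have "\<forall>\<^sub>F j in sequentially. (LINT t|lebR n. \<bar>g j t - f t\<bar>) < r / 4"
      using lim by (intro order_tendstoD(2)) auto
    then obtain j where j: "(LINT t|lebR n. \<bar>g j t - f t\<bar>) < r / 4"
      by (auto simp: eventually_sequentially)
    have "\<forall>\<^sub>F k in sequentially. (LINT t|lebR n. \<bar>g j (vadd n t (u k)) - g j t\<bar>) < r / 2"
      using g[of j] \<open>r > 0\<close> unfolding shift_cont_def by (intro order_tendstoD(2)) auto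
    then obtain k0 where k0: "\<And>k. k \<ge> k0 \<Longrightarrow> (LINT t|lebR n. \<bar>g j (vadd n t (u k)) - g j t\<bar>) < r / 2"
      by (auto simp: eventually_sequentially)
    have "norm ((LINT t|lebR n. \<bar>f (vadd n t (u k)) - f t\<bar>) - 0) < r" if k: "k \<ge> k0" for k
    proof -
      have "(LINT t|lebR n. \<bar>f (vadd n t (u k)) - f t\<bar>) \<le>
        (LINT t|lebR n. \<bar>g j (vadd n t (u k)) - f (vadd n t (u k))\<bar> + \<bar>g j (vadd n t (u k)) - g j t\<bar> + \<bar>g j t - f t\<bar>)"
        using gi f shift_integrable[OF gi] shift_integrable[OF f]
        by (intro integral_mono Bochner_Integration.integrable_add integrable_abs
          Bochner_Integration.integrable_diff) auto
      also have "\<dots> = (LINT t|lebR n. \<bar>g j (vadd n t (u k)) - f (vadd n t (u k))\<bar>)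
          + (LINT t|lebR n. \<bar>g j (vadd n t (u k)) - g j t\<bar>) + (LINT t|lebR n. \<bar>g j t - f t\<bar>)"
        using gi f shift_integrable[OF gi] shift_integrable[OF f] by simp
      also have "(LINT t|lebR n. \<bar>g j (vadd n t (u k)) - f (vadd n t (u k))\<bar>) = (LINT t|lebR n. \<bar>g j t - f t\<bar>)"
        using gi[of j] f by (intro integral_vadd[of "\<lambda>t. \<bar>g j t - f t\<bar>"]) auto
      finally show ?thesis
        using j k0[OF k] by simp
    qed
    then show "\<exists>no. \<forall>k\<ge>no. norm ((LINT t|lebR n. \<bar>f (vadd n t (u k)) - f t\<bar>) - 0) < r"
      by blast
  qed
  then show ?thesis
    using f by (simp add: shift_cont_def)
qed

lemma shift_cont_add:
  assumes "shift_cont f" "shift_cont g"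
  shows "shift_cont (\<lambda>t. f t + g t)"
proof -
  note [simp] = shift_cont_integrable[OF assms(1)] shift_cont_integrable[OF assms(2)]
    shift_integrable[OF shift_cont_integrable[OF assms(1)]]
    shift_integrable[OF shift_cont_integrable[OF assms(2)]]
  have "(\<lambda>k. LINT t|lebR n. \<bar>(f (vadd n t (u k)) + g (vadd n t (u k))) - (f t + g t)\<bar>) \<longlonglongrightarrow> 0"
  proof (rule tendsto_sandwich[where f = "\<lambda>_. 0"])
    show "(\<lambda>k. (LINT t|lebR n. \<bar>f (vadd n t (u k)) - f t\<bar>) + (LINT t|lebR n. \<bar>g (vadd n t (u k)) - g t\<bar>)) \<longlonglongrightarrow> 0"
      using assms tendsto_add[of _ 0 sequentially _ 0] by (simp add: shift_cont_def)
    have "(LINT t|lebR n. \<bar>(f (vadd n t (u k)) + g (vadd n t (u k))) - (f t + g t)\<bar>)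
      \<le> (LINT t|lebR n. \<bar>f (vadd n t (u k)) - f t\<bar> + \<bar>g (vadd n t (u k)) - g t\<bar>)" for k
      by (rule integral_mono) auto
    then show "\<forall>\<^sub>F k in sequentially. (LINT t|lebR n. \<bar>(f (vadd n t (u k)) + g (vadd n t (u k))) - (f t + g t)\<bar>)
      \<le> (LINT t|lebR n. \<bar>f (vadd n t (u k)) - f t\<bar>) + (LINT t|lebR n. \<bar>g (vadd n t (u k)) - g t\<bar>)"
      by simp
  qed auto
  then show ?thesis
    by (simp add: shift_cont_def)
qed

lemma shift_cont_scale:
  assumes "shift_cont f" shows "shift_cont (\<lambda>t. c * f t)"
proof -
  have "\<bar>c * f (vadd n t (u k)) - c * f t\<bar> = \<bar>c\<bar> * \<bar>f (vadd n t (u k)) - f t\<bar>" for t k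
    by (simp add: abs_mult flip: right_diff_distrib)
  then show ?thesis
    using assms tendsto_mult_right_zero[of _ sequentially "\<bar>c\<bar>"] by (simp add: shift_cont_def)
qed

lemma shift_cont_sum:
  "(\<And>j. j \<in> J \<Longrightarrow> shift_cont (f j)) \<Longrightarrow> shift_cont (\<lambda>t. \<Sum>j\<in>J. f j t)"
proof (induction J rule: infinite_finite_induct)
  case (insert x F)
  then show ?case
    by (auto intro!: shift_cont_add)
qed (auto simp: shift_cont_def)

text \<open>A set and its translate have equal measure, so it suffices to treat the part of the
  translate outside the set. Its indicator tends to 0 at every point, because the complement of a
  closed set is open.\<close>

lemma shift_cont_closed:
  assumes "closed S"
  shows "shift_cont (indicat_real (S \<inter> Rn n \<inter> cube n R))" (is "shift_cont ?g")
proof -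
  have g_int: "integrable (lebR n) ?g"
    using assms by (intro integrable_indicator_cube borel_Int_Rn_lebR) auto
  have gm [measurable]: "?g \<in> borel_measurable (lebR n)"
    using g_int by (rule borel_measurable_integrable)
  have "\<exists>C. \<forall>k. \<bar>u k i\<bar> \<le> C" if "i < n" for i
    using convergent_imp_Bseq[OF convergentI[OF u_tendsto[OF that]]] by (auto simp: Bseq_def)
  then obtain C where C: "\<And>i k. i < n \<Longrightarrow> \<bar>u k i\<bar> \<le> C i"
    by metis
  \<comment> \<open>A common bound for all shifts: the translated cubes stay inside one larger cube,
    whose indicator dominates.\<close>
  define D where "D = (\<Sum>i<n. \<bar>C i\<bar>)"
  have D: "\<bar>u k i\<bar> \<le> D" if "i < n" for i k
  proof -
    have "\<bar>u k i\<bar> \<le> \<bar>C i\<bar>"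
      using C[OF that, of k] by simp
    also have "\<dots> \<le> D"
      unfolding D_def using that by (intro member_le_sum) auto
    finally show ?thesis .
  qed
  let ?p = "\<lambda>k t. ?g (vadd n t (u k)) * (1 - ?g t)"
  have "(\<lambda>k. LINT t|lebR n. ?p k t) \<longlonglongrightarrow> (LINT t|lebR n. 0)"
  proof (rule integral_dominated_convergence[where w = "indicat_real (cube n (R + D))"])
    show "integrable (lebR n) (indicat_real (cube n (R + D)))"
      using integrable_indicator_cube[of "cube n (R + D)" n "R + D"] by simp
    show "AE t in lebR n. (\<lambda>k. ?p k t) \<longlonglongrightarrow> 0"
    proof (rule AE_I2)
      fix t assume t: "t \<in> space (lebR n)"
      then have tR: "t \<in> Rn n"
        by (simp add: space_lebR)
      let ?Q = "{x. \<forall>i<n. \<bar>x i\<bar> \<le> R}"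
      have Q: "closed ?Q"
      proof -
        have "?Q = (\<Inter>i\<in>{..<n}. {x. \<bar>x i\<bar> \<le> R})"
          by auto
        then show ?thesis
          by (auto intro!: closed_INT closed_Collect_le continuous_intros continuous_on_product_coordinates)
      qed
      have SQ: "x \<in> S \<inter> Rn n \<inter> cube n R \<longleftrightarrow> x \<in> S \<inter> ?Q" if "x \<in> Rn n" for x
        using that by (auto simp: mem_cube)
      show "(\<lambda>k. ?p k t) \<longlonglongrightarrow> 0"
      proof (cases "t \<in> S \<inter> ?Q")
        case True
        then show ?thesis
          using SQ[OF tR] by (simp add: indicator_def)
      next
        case False
        have "(\<lambda>k. vadd n t (u k)) \<longlonglongrightarrow> t"
        proof (rule tendsto_vecI)
          fix i
          show "(\<lambda>k. vadd n t (u k) i) \<longlonglongrightarrow> t i"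
          proof (cases "i < n")
            case True
            then show ?thesis
              using tendsto_add[OF tendsto_const[of "t i"] u_tendsto[OF True]] by (simp add: vadd_def)
          next
            case False
            then show ?thesis
              using tR by (simp add: vadd_def Rn_def PiE_iff extensional_def)
          qed
        qed
        moreover have "open (- (S \<inter> ?Q))"
          using assms Q by (intro open_Compl closed_Int)
        ultimately have "\<forall>\<^sub>F k in sequentially. vadd n t (u k) \<in> - (S \<inter> ?Q)"
          using False by (intro topological_tendstoD) auto
        then have "\<forall>\<^sub>F k in sequentially. ?p k t = 0"
        proof eventually_elim
          case (elim k)
          have "vadd n t (u k) \<in> Rn n"
            by (simp add: vadd_def Rn_def)
          from SQ[OF this] elim show ?case
            by (simp add: indicator_def)
        qed
        then show ?thesis
          by (rule tendsto_eventually)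
      qed
    qed
    show "AE t in lebR n. norm (?p k t) \<le> indicat_real (cube n (R + D)) t" for k
    proof (rule AE_I2)
      fix t assume "t \<in> space (lebR n)"
      then have tR: "t \<in> Rn n"
        by (simp add: space_lebR)
      have "t \<in> cube n (R + D)" if "vadd n t (u k) \<in> cube n R"
        unfolding mem_cube
      proof (intro conjI tR allI impI)
        fix i assume i: "i < n"
        then have "\<bar>t i + u k i\<bar> \<le> R"
          using that by (auto simp: mem_cube vadd_def)
        then show "\<bar>t i\<bar> \<le> R + D"
          using D[OF i, of k] by linarith
      qed
      then show "norm (?p k t) \<le> indicat_real (cube n (R + D)) t"
        by (auto simp: indicator_def)
    qed
  qed (auto intro!: borel_measurable_times borel_measurable_diff gm
      measurable_compose[OF _ gm] measurable_vadd[where g = "\<lambda>_. u k" for k] simp: vadd_aff_map)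
  moreover have "(LINT t|lebR n. \<bar>?g (vadd n t (u k)) - ?g t\<bar>) = 2 * (LINT t|lebR n. ?p k t)" for k
  proof -
    note gs = shift_integrable[OF g_int, of "u k"]
    have pi: "integrable (lebR n) (\<lambda>t. ?g (vadd n t (u k)) * ?g t)"
    proof (rule Bochner_Integration.integrable_bound[OF g_int])
      show "(\<lambda>t. ?g (vadd n t (u k)) * ?g t) \<in> borel_measurable (lebR n)"
        by (rule borel_measurable_times[OF borel_measurable_integrable[OF gs] gm])
    qed (auto simp: indicator_def)
    \<comment> \<open>For values in {0, 1} one has |a - b| = a + b - 2 a b.\<close>
    have "(LINT t|lebR n. \<bar>?g (vadd n t (u k)) - ?g t\<bar>) =
      (LINT t|lebR n. ?g (vadd n t (u k)) + ?g t - 2 * (?g (vadd n t (u k)) * ?g t))"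
      by (intro Bochner_Integration.integral_cong) (auto simp: indicator_def)
    also have "\<dots> = (LINT t|lebR n. ?g (vadd n t (u k))) + (LINT t|lebR n. ?g t)
        - 2 * (LINT t|lebR n. ?g (vadd n t (u k)) * ?g t)"
      using gs g_int pi by simp
    also have "(LINT t|lebR n. ?g t) = (LINT t|lebR n. ?g (vadd n t (u k)))"
      by (rule integral_vadd[symmetric]) (rule gm)
    also have "(LINT t|lebR n. ?g (vadd n t (u k))) + (LINT t|lebR n. ?g (vadd n t (u k)))
        - 2 * (LINT t|lebR n. ?g (vadd n t (u k)) * ?g t) = 2 * (LINT t|lebR n. ?p k t)"
      using gs pi by (simp add: right_diff_distrib)
    finally show ?thesis .
  qed
  ultimately show ?thesis
    using g_int tendsto_mult_right_zero[of _ sequentially 2] by (simp add: shift_cont_def)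
qed

lemma shift_cont_dominated:
  assumes g: "\<And>j. shift_cont (g j)" and f [measurable]: "f \<in> borel_measurable (lebR n)"
    and w: "integrable (lebR n) w"
    and lim: "\<And>t. t \<in> space (lebR n) \<Longrightarrow> (\<lambda>j. g j t) \<longlonglongrightarrow> f t"
    and dom: "\<And>j t. t \<in> space (lebR n) \<Longrightarrow> \<bar>g j t\<bar> \<le> w t"
  shows "shift_cont f"
proof -
  have gm [measurable]: "g j \<in> borel_measurable (lebR n)" for j
    using shift_cont_integrable[OF g] by (rule borel_measurable_integrable)
  have fw: "\<bar>f t\<bar> \<le> w t" if "t \<in> space (lebR n)" for t
    by (rule LIMSEQ_le_const2[OF tendsto_rabs[OF lim[OF that]]]) (use dom that in auto)
  have fi: "integrable (lebR n) f"
  proof (rule Bochner_Integration.integrable_bound[OF w f])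
    show "AE t in lebR n. norm (f t) \<le> norm (w t)"
      using fw by (intro AE_I2) force
  qed
  have "(\<lambda>j. LINT t|lebR n. \<bar>g j t - f t\<bar>) \<longlonglongrightarrow> (LINT t|lebR n. 0)"
  proof (rule integral_dominated_convergence[where w = "\<lambda>t. 2 * w t"])
    show "AE t in lebR n. (\<lambda>j. \<bar>g j t - f t\<bar>) \<longlonglongrightarrow> 0"
    proof (rule AE_I2)
      fix t assume "t \<in> space (lebR n)"
      from tendsto_rabs[OF tendsto_diff[OF lim[OF this] tendsto_const[of "f t"]]]
      show "(\<lambda>j. \<bar>g j t - f t\<bar>) \<longlonglongrightarrow> 0"
        by simp
    qed
    show "AE t in lebR n. norm \<bar>g j t - f t\<bar> \<le> 2 * w t" for j
    proof (rule AE_I2)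
      fix t assume "t \<in> space (lebR n)"
      from dom[OF this, of j] fw[OF this] show "norm \<bar>g j t - f t\<bar> \<le> 2 * w t"
        by simp
    qed
  qed (use w in auto)
  then show ?thesis
    by (intro shift_cont_limit[OF g fi]) simp
qed

text \<open>Closed sets form an intersection-stable generator, so the pi-lambda argument applies.
  Cutting with a cube keeps all measures finite, as the complement and union steps require.\<close>

lemma shift_cont_indicator_cube:
  assumes "B \<in> sets borel"
  shows "shift_cont (indicat_real (B \<inter> Rn n \<inter> cube n R))"
proof -
  let ?P = "\<lambda>B. shift_cont (indicat_real (B \<inter> Rn n \<inter> cube n R))"
  have stable: "Int_stable (Collect (closed :: vec set \<Rightarrow> bool))"
    by (auto simp: Int_stable_def)
  have B: "B \<in> sigma_sets UNIV (Collect closed)"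
    using assms by (simp add: borel_eq_closed)
  have sets: "A \<in> sets borel" if "A \<in> sigma_sets UNIV (Collect (closed :: vec set \<Rightarrow> bool))" for A
    using that by (simp add: borel_eq_closed)
  have subset: "Collect (closed :: vec set \<Rightarrow> bool) \<subseteq> Pow UNIV"
    by simp
  have "?P B"
    using stable subset B
  proof (induction rule: sigma_sets_induct_disjoint)
    case (basic A)
    then show ?case
      by (simp add: shift_cont_closed)
  next
    case empty
    then show ?case
      by (simp add: shift_cont_def)
  next
    case (compl A)
    have "shift_cont (\<lambda>t. indicat_real (UNIV \<inter> Rn n \<inter> cube n R) t + (- 1) * indicat_real (A \<inter> Rn n \<inter> cube n R) t)"
      by (intro shift_cont_add shift_cont_scale shift_cont_closed compl.IH closed_UNIV)
    also have "(\<lambda>t. indicat_real (UNIV \<inter> Rn n \<inter> cube n R) t + (- 1) * indicat_real (A \<inter> Rn n \<inter> cube n R) t)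
        = indicat_real ((UNIV - A) \<inter> Rn n \<inter> cube n R)"
      by (auto simp: indicator_def fun_eq_iff)
    finally show ?case .
  next
    case (union A)
    have "(\<Union>i. A i) \<in> sets borel"
      using union.hyps(2) sets by blast
    then have m: "(\<Union>i. A i) \<inter> Rn n \<inter> cube n R \<in> sets (lebR n)"
      by (intro sets.Int borel_Int_Rn_lebR cube_sets)
    have eq: "(\<Sum>i<j. indicat_real (A i \<inter> Rn n \<inter> cube n R) t) = indicat_real ((\<Union>i<j. A i) \<inter> Rn n \<inter> cube n R) t"
      for j t
    proof -
      have "(\<Sum>i<j. indicat_real (A i \<inter> Rn n \<inter> cube n R) t) = (\<Sum>i<j. indicat_real (A i) t) * indicat_real (Rn n \<inter> cube n R) t"
        by (simp add: sum_distrib_right indicator_inter_arith mult.assoc)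
      also have "(\<Sum>i<j. indicat_real (A i) t) = indicat_real (\<Union>i<j. A i) t"
        using union.hyps(1) by (subst indicator_UN_disjoint) (auto simp: disjoint_family_on_def)
      finally show ?thesis
        by (simp add: indicator_inter_arith mult.assoc)
    qed
    show ?case
    proof (rule shift_cont_dominated)
      show "shift_cont (\<lambda>t. \<Sum>i<j. indicat_real (A i \<inter> Rn n \<inter> cube n R) t)" for j
        by (intro shift_cont_sum union.IH)
      show "indicat_real ((\<Union>i. A i) \<inter> Rn n \<inter> cube n R) \<in> borel_measurable (lebR n)"
        using m by simp
      show "integrable (lebR n) (indicat_real (cube n R))"
        using integrable_indicator_cube[of "cube n R" n R] by simp
      show "\<bar>\<Sum>i<j. indicat_real (A i \<inter> Rn n \<inter> cube n R) t\<bar> \<le> indicat_real (cube n R) t" for j t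
        unfolding eq by (simp add: indicator_def)
      show "(\<lambda>j. \<Sum>i<j. indicat_real (A i \<inter> Rn n \<inter> cube n R) t) \<longlonglongrightarrow> indicat_real ((\<Union>i. A i) \<inter> Rn n \<inter> cube n R) t" for t
      proof (cases "t \<in> (\<Union>i. A i)")
        case True
        then obtain i where i: "t \<in> A i"
          by blast
        have "\<forall>\<^sub>F j in sequentially. indicat_real ((\<Union>i<j. A i) \<inter> Rn n \<inter> cube n R) t
            = indicat_real ((\<Union>i. A i) \<inter> Rn n \<inter> cube n R) t"
          using eventually_gt_at_top[of i] by eventually_elim (use i in \<open>auto simp: indicator_def\<close>)
        then show ?thesis
          unfolding eq by (rule tendsto_eventually)
      next
        case False
        then show ?thesis
          unfolding eq by (auto simp: indicator_def)
      qed
    qed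
  qed
  then show ?thesis .
qed

lemma shift_cont_indicator:
  assumes "A \<in> sets (lebR n)" "emeasure (lebR n) A < \<infinity>"
  shows "shift_cont (indicat_real A)"
proof -
  obtain B where B: "B \<in> sets borel" "A = B \<inter> Rn n"
    using sets_lebR_borel[OF assms(1)] .
  show ?thesis
  proof (rule shift_cont_dominated)
    show "shift_cont (indicat_real (A \<inter> cube n (real j)))" for j
      using shift_cont_indicator_cube[OF B(1)] B(2) by simp
    show "(\<lambda>j. indicat_real (A \<inter> cube n (real j)) t) \<longlonglongrightarrow> indicat_real A t" if t: "t \<in> space (lebR n)" for t
    proof (rule tendsto_eventually)
      obtain j0 where j0: "(\<Sum>i<n. \<bar>t i\<bar>) < real j0"
        using reals_Archimedean2 by blast
      show "\<forall>\<^sub>F j in sequentially. indicat_real (A \<inter> cube n (real j)) t = indicat_real A t"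
        using eventually_ge_at_top[of j0]
      proof eventually_elim
        case (elim j)
        have "\<bar>t i\<bar> \<le> real j" if "i < n" for i
        proof -
          have "\<bar>t i\<bar> \<le> (\<Sum>i<n. \<bar>t i\<bar>)"
            using that by (intro member_le_sum) auto
          then show ?thesis
            using j0 elim by linarith
        qed
        then have "t \<in> cube n (real j)"
          using t by (simp add: mem_cube space_lebR)
        then show ?case
          by (simp add: indicator_def)
      qed
    qed
    show "\<bar>indicat_real (A \<inter> cube n (real j)) t\<bar> \<le> indicat_real A t" for j t
      by (simp add: indicator_def)
  qed (use assms in auto)
qed

theorem shift_cont_L1:
  assumes "integrable (lebR n) f" shows "shift_cont f"
  using assms
proof (induction rule: integrable_induct)
  case (base A c)
  then show ?case
    using shift_cont_scale[OF shift_cont_indicator[OF base], of c] by (simp add: mult.commute)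
next
  case (add f g)
  then show ?case
    by (intro shift_cont_add)
next
  case (lim f s)
  show ?case
  proof (rule shift_cont_dominated)
    show "shift_cont (s j)" for j
      by (rule lim)
    show "integrable (lebR n) (\<lambda>t. 2 * \<bar>f t\<bar>)"
      using lim by simp
  qed (use lim in auto)
qed

text \<open>The inequality \<open>(a - b)\<^sup>2 \<le> 2 |a |a| - b |b||\<close> reduces continuity in \<open>L\<^sup>2\<close> to continuity in \<open>L\<^sup>1\<close>.\<close>

theorem shift_L2:
  assumes "f \<in> sq_int (lebR n)"
  shows "(\<lambda>k. sq_norm (lebR n) (\<lambda>t. f (vadd n t (u k)) - f t)) \<longlonglongrightarrow> 0"
proof -
  have [measurable]: "f \<in> borel_measurable (lebR n)"
    using assms by (rule sq_int_measurable)
  define p where "p r = r * \<bar>r\<bar>" for r :: real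
  have [measurable]: "p \<in> borel_measurable borel"
    unfolding p_def[abs_def] by measurable
  \<comment> \<open>For equal signs the right-hand difference is |a - b| (|a| + |b|). For opposite
    signs it is a^2 + b^2, and the parallelogram identity supplies the factor 2.\<close>
  have p: "(a - b)\<^sup>2 \<le> 2 * \<bar>p a - p b\<bar>" for a b :: real
  proof (cases "0 \<le> a * b")
    case True
    have "\<bar>p a - p b\<bar> = \<bar>a - b\<bar> * (\<bar>a\<bar> + \<bar>b\<bar>)"
    proof -
      consider "a \<ge> 0" "b \<ge> 0" | "a \<le> 0" "b \<le> 0"
        using True by (auto simp: zero_le_mult_iff)
      then show ?thesis
      proof cases
        case 1
        then have "p a - p b = (a - b) * (\<bar>a\<bar> + \<bar>b\<bar>)"
          by (simp add: p_def algebra_simps)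
        then show ?thesis
          by (simp add: abs_mult)
      next
        case 2
        then have "p a - p b = (a - b) * (\<bar>a\<bar> + \<bar>b\<bar>)"
          by (simp add: p_def algebra_simps)
        then show ?thesis
          by (simp add: abs_mult)
      qed
    qed
    moreover have "\<bar>a - b\<bar> * \<bar>a - b\<bar> \<le> \<bar>a - b\<bar> * (\<bar>a\<bar> + \<bar>b\<bar>)"
      by (intro mult_left_mono) auto
    moreover have "\<bar>a - b\<bar> * \<bar>a - b\<bar> = (a - b)\<^sup>2"
      by (simp add: power2_eq_square)
    ultimately show ?thesis
      using zero_le_power2[of "a - b"] by linarith
  next
    case False
    then have "a > 0 \<and> b < 0 \<or> a < 0 \<and> b > 0"
      by (auto simp: not_le mult_less_0_iff)
    then have "\<bar>p a - p b\<bar> = a\<^sup>2 + b\<^sup>2"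
    proof
      assume "a > 0 \<and> b < 0"
      then have "p a - p b = a\<^sup>2 + b\<^sup>2"
        by (simp add: p_def power2_eq_square)
      then show ?thesis
        by simp
    next
      assume "a < 0 \<and> b > 0"
      then have "p a - p b = - (a\<^sup>2 + b\<^sup>2)"
        by (simp add: p_def power2_eq_square)
      then show ?thesis
        using sum_power2_ge_zero[of a b] by (simp only: abs_minus_cancel abs_of_nonneg)
    qed
    moreover have "(a - b)\<^sup>2 + (a + b)\<^sup>2 = 2 * (a\<^sup>2 + b\<^sup>2)"
      by (simp add: power2_eq_square algebra_simps)
    ultimately have "2 * \<bar>p a - p b\<bar> = (a - b)\<^sup>2 + (a + b)\<^sup>2"
      by (simp only:)
    then show ?thesis
      by simp
  qed
  have int: "integrable (lebR n) (\<lambda>t. p (q (f t)))" if q: "q = Re \<or> q = Im" for q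
  proof (rule Bochner_Integration.integrable_bound[OF sq_int_integrable[OF assms]])
    show "(\<lambda>t. p (q (f t))) \<in> borel_measurable (lebR n)"
      using q by auto
    have "\<bar>q z\<bar> \<le> cmod z" for z
      using q abs_Re_le_cmod abs_Im_le_cmod by auto
    then have "(q z)\<^sup>2 \<le> (cmod z)\<^sup>2" for z
      by (metis abs_ge_zero power2_abs power_mono)
    then show "AE t in lebR n. norm (p (q (f t))) \<le> norm ((cmod (f t))\<^sup>2)"
      by (simp add: p_def abs_mult power2_eq_square)
  qed
  have lim: "(\<lambda>k. LINT t|lebR n. \<bar>p (q (f (vadd n t (u k)))) - p (q (f t))\<bar>) \<longlonglongrightarrow> 0" if "q = Re \<or> q = Im" for q
    using shift_cont_L1[OF int[OF that]] by (simp add: shift_cont_def)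
  show ?thesis
  proof (rule tendsto_sandwich[where f = "\<lambda>_. 0"])
    let ?I = "\<lambda>q k. LINT t|lebR n. \<bar>p (q (f (vadd n t (u k)))) - p (q (f t))\<bar>"
    show "(\<lambda>k. 2 * ?I Re k + 2 * ?I Im k) \<longlonglongrightarrow> 0"
      using tendsto_add[OF tendsto_mult_right_zero[OF lim[of Re], of 2] tendsto_mult_right_zero[OF lim[of Im], of 2]]
      by simp
    have intd: "integrable (lebR n) (\<lambda>t. \<bar>p (q (f (vadd n t (u k)))) - p (q (f t))\<bar>)" if "q = Re \<or> q = Im" for q k
      using int[OF that] shift_integrable[OF int[OF that], of "u k"] by auto
    have "sq_norm (lebR n) (\<lambda>t. f (vadd n t (u k)) - f t) \<le> 2 * ?I Re k + 2 * ?I Im k" for k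
    proof -
      have "sq_norm (lebR n) (\<lambda>t. f (vadd n t (u k)) - f t) \<le>
        (LINT t|lebR n. 2 * \<bar>p (Re (f (vadd n t (u k)))) - p (Re (f t))\<bar> + 2 * \<bar>p (Im (f (vadd n t (u k)))) - p (Im (f t))\<bar>)"
        unfolding sq_norm_def
      proof (rule integral_mono)
        have "(\<lambda>t. f (vadd n t (u k))) \<in> sq_int (lebR n)"
          using assms integrable_vadd_iff[of "\<lambda>t. (cmod (f t))\<^sup>2" n "u k"]
          by (auto simp: sq_int_def vadd_aff_map)
        then show "integrable (lebR n) (\<lambda>t. (cmod (f (vadd n t (u k)) - f t))\<^sup>2)"
          by (intro sq_int_integrable sq_int_diff assms)
        show "(cmod (f (vadd n t (u k)) - f t))\<^sup>2 \<le> 2 * \<bar>p (Re (f (vadd n t (u k)))) - p (Re (f t))\<bar>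
            + 2 * \<bar>p (Im (f (vadd n t (u k)))) - p (Im (f t))\<bar>" for t
          unfolding cmod_power2 using p[of "Re (f (vadd n t (u k)))" "Re (f t)"]
            p[of "Im (f (vadd n t (u k)))" "Im (f t)"] by simp
      qed (use intd[of Re k] intd[of Im k] in auto)
      also have "\<dots> = 2 * ?I Re k + 2 * ?I Im k"
        using intd[of Re k] intd[of Im k] by simp
      finally show ?thesis .
    qed
    then show "\<forall>\<^sub>F k in sequentially. sq_norm (lebR n) (\<lambda>t. f (vadd n t (u k)) - f t) \<le> 2 * ?I Re k + 2 * ?I Im k"
      by simp
  qed auto
qed

end

section \<open>Translations and perimeter\<close>

lemma has_real_derivative_max_square:
  "((\<lambda>r::real. (max 0 r)\<^sup>2) has_real_derivative 2 * max 0 r) (at r)"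
proof -
  consider "r > 0" | "r < 0" | "r = 0"
    by linarith
  then show ?thesis
  proof cases
    case 1
    have "((\<lambda>r::real. r\<^sup>2) has_real_derivative 2 * r) (at r)"
      by (auto intro!: derivative_eq_intros)
    then have "((\<lambda>r::real. (max 0 r)\<^sup>2) has_real_derivative 2 * r) (at r)"
      by (rule has_field_derivative_transform_within_open[where S = "{0<..}"]) (use 1 in auto)
    then show ?thesis
      using 1 by simp
  next
    case 2
    have "((\<lambda>r::real. 0) has_real_derivative 0) (at r)"
      by simp
    then have "((\<lambda>r::real. (max 0 r)\<^sup>2) has_real_derivative 0) (at r)"
      by (rule has_field_derivative_transform_within_open[where S = "{..<0}"]) (use 2 in auto)
    then show ?thesis
      using 2 by simp
  next
    case 3
    have "((\<lambda>s::real. max 0 s) \<longlongrightarrow> max 0 0) (at 0)"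
      by (intro tendsto_intros)
    then have "((\<lambda>s::real. ((max 0 s)\<^sup>2 - (max 0 0)\<^sup>2) / (s - 0)) \<longlongrightarrow> 0) (at 0)"
      by (rule filterlim_cong[THEN iffD1, rotated -1])
        (auto simp: eventually_at_filter max_def power2_eq_square)
    then show ?thesis
      using 3 by (simp add: has_field_derivative_iff)
  qed
qed

text \<open>Test fields need one continuous derivative, so the square of a truncated parabola is
  smooth enough. The factor 15/16 normalises the integral, since (1 - s^2)^2 has integral 16/15 over
  [-1, 1].\<close>

definition bump :: "real \<Rightarrow> real" where
  "bump s = 15 / 16 * (max 0 (1 - s\<^sup>2))\<^sup>2"

definition bump' :: "real \<Rightarrow> real" where
  "bump' s = - (15 / 4) * s * max 0 (1 - s\<^sup>2)"

lemma bump_deriv: "(bump has_real_derivative bump' s) (at s)"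
proof -
  have "((\<lambda>s. 1 - s\<^sup>2) has_real_derivative - 2 * s) (at s)"
    by (auto intro!: derivative_eq_intros)
  from DERIV_chain2[OF has_real_derivative_max_square this]
  have "((\<lambda>s. 15 / 16 * (max 0 (1 - s\<^sup>2))\<^sup>2) has_real_derivative 15 / 16 * (2 * max 0 (1 - s\<^sup>2) * (- 2 * s))) (at s)"
    by (intro DERIV_cmult)
  then show ?thesis
    by (simp add: bump_def[abs_def] bump'_def mult_ac)
qed

lemma bump_nonneg: "0 \<le> bump s"
  by (simp add: bump_def)

lemma bump_eq_0: "1 \<le> \<bar>s\<bar> \<Longrightarrow> bump s = 0"
  using abs_le_square_iff[of 1 s] by (simp add: bump_def)

lemma bump'_eq_0: "1 \<le> \<bar>s\<bar> \<Longrightarrow> bump' s = 0"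
  using abs_le_square_iff[of 1 s] by (simp add: bump'_def)

lemma bump_le: "bump s \<le> 4"
proof -
  have "(max 0 (1 - s\<^sup>2))\<^sup>2 \<le> 1\<^sup>2"
    by (intro power_mono) auto
  then show ?thesis
    by (simp add: bump_def)
qed

lemma bump'_le: "\<bar>bump' s\<bar> \<le> 4"
proof (cases "1 \<le> \<bar>s\<bar>")
  case False
  have "\<bar>s\<bar> * max 0 (1 - s\<^sup>2) \<le> 1 * 1"
    using False by (intro mult_mono) auto
  then show ?thesis
    by (simp add: bump'_def abs_mult)
qed (simp add: bump'_eq_0)

lemma continuous_bump': "continuous_on A bump'"
  unfolding bump'_def[abs_def] by (intro continuous_intros)

lemma bump_integral: "has_bochner_integral lborel bump 1"
proof -
  let ?F = "\<lambda>s::real. 15 / 16 * (s - 2 * s ^ 3 / 3 + s ^ 5 / 5)"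
  have 1: "(?F has_real_derivative bump s) (at s)" if "- 1 \<le> s" "s \<le> 1" for s
  proof -
    have "1 - s\<^sup>2 \<ge> 0"
      using abs_le_square_iff[of s 1] that by (simp add: abs_le_iff)
    then have "bump s = 15 / 16 * (1 - 2 * s\<^sup>2 + s ^ 4)"
      by (simp add: bump_def power2_diff)
    then show ?thesis
      by (auto intro!: derivative_eq_intros simp: field_simps eval_nat_numeral)
  qed
  have "has_bochner_integral lborel (\<lambda>x. bump x * indicator {-1 .. 1} x) (?F 1 - ?F (- 1))"
    using bump_deriv by (intro has_bochner_integral_FTC_Icc_real 1 DERIV_isCont) auto
  moreover have "(\<lambda>x. bump x * indicator {-1 .. 1} x) = bump"
  proof
    fix x :: real
    show "bump x * indicator {-1 .. 1} x = bump x"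
    proof (cases "1 \<le> \<bar>x\<bar>")
      case False
      then have "x \<in> {-1 .. 1}"
        by auto
      then show ?thesis
        by simp
    qed (simp add: bump_eq_0)
  qed
  ultimately show ?thesis
    by simp
qed

lemma bump_lipschitz: "\<bar>bump r - bump s\<bar> \<le> 4 * \<bar>r - s\<bar>"
  using field_differentiable_bound[of UNIV bump bump' 4 r s] bump_deriv bump'_le by simp

lemma continuous_bump: "continuous_on A bump"
  using bump_deriv by (meson DERIV_isCont continuous_at_imp_continuous_on)

definition kern :: "nat \<Rightarrow> real \<Rightarrow> vec \<Rightarrow> real" where
  "kern n \<epsilon> x = (\<Prod>i<n. bump (x i / \<epsilon>) / \<epsilon>)"

definition kern' :: "nat \<Rightarrow> real \<Rightarrow> nat \<Rightarrow> vec \<Rightarrow> real" where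
  "kern' n \<epsilon> i x = bump' (x i / \<epsilon>) / \<epsilon>\<^sup>2 * (\<Prod>j\<in>{..<n} - {i}. bump (x j / \<epsilon>) / \<epsilon>)"

lemma kern_cong: "(\<And>i. i < n \<Longrightarrow> x i = y i) \<Longrightarrow> kern n \<epsilon> x = kern n \<epsilon> y"
  unfolding kern_def by (intro prod.cong) auto

lemma kern_upd:
  assumes "i < n"
  shows "kern n \<epsilon> (x(i := r)) = bump (r / \<epsilon>) / \<epsilon> * (\<Prod>j\<in>{..<n} - {i}. bump (x j / \<epsilon>) / \<epsilon>)"
proof -
  have "kern n \<epsilon> (x(i := r)) = bump (r / \<epsilon>) / \<epsilon> * (\<Prod>j\<in>{..<n} - {i}. bump ((x(i := r)) j / \<epsilon>) / \<epsilon>)"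
    unfolding kern_def using assms by (subst prod.remove[of _ i]) auto
  also have "(\<Prod>j\<in>{..<n} - {i}. bump ((x(i := r)) j / \<epsilon>) / \<epsilon>) = (\<Prod>j\<in>{..<n} - {i}. bump (x j / \<epsilon>) / \<epsilon>)"
    by (intro prod.cong) auto
  finally show ?thesis .
qed

lemma bump_scaled_deriv:
  assumes "\<epsilon> > 0"
  shows "((\<lambda>r. bump (r / \<epsilon>) / \<epsilon>) has_real_derivative bump' (r / \<epsilon>) / \<epsilon>\<^sup>2) (at r)"
proof -
  have "((\<lambda>r. r / \<epsilon>) has_real_derivative 1 / \<epsilon>) (at r)"
    using assms by (auto intro!: derivative_eq_intros)
  from DERIV_cdivide[OF DERIV_chain2[OF bump_deriv this], of \<epsilon>] show ?thesis
    by (simp add: power2_eq_square)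
qed

lemma kern_deriv:
  assumes "\<epsilon> > 0" "i < n"
  shows "((\<lambda>r. kern n \<epsilon> (x(i := r))) has_real_derivative kern' n \<epsilon> i x) (at (x i))"
  unfolding kern_upd[OF assms(2)] kern'_def
  by (intro DERIV_cmult_right bump_scaled_deriv assms)

text \<open>The directional derivative of the kernel along \<open>- h\<close>. It will make the
  divergence of the test field an exact derivative in the segment parameter.\<close>

lemma kern_line_deriv:
  assumes "\<epsilon> > 0"
  shows "((\<lambda>s. kern n \<epsilon> (\<lambda>i. y i - s * h i)) has_real_derivative
    - (\<Sum>i<n. h i * kern' n \<epsilon> i (\<lambda>i. y i - s * h i))) (at s)"
proof -
  have "((\<lambda>s. bump ((y i - s * h i) / \<epsilon>) / \<epsilon>) has_real_derivative
      bump' ((y i - s * h i) / \<epsilon>) / \<epsilon>\<^sup>2 * (- h i)) (at s)" for i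
  proof -
    have "((\<lambda>s. y i - s * h i) has_real_derivative - h i) (at s)"
      by (auto intro!: derivative_eq_intros)
    from DERIV_chain2[OF bump_scaled_deriv[OF assms] this] show ?thesis .
  qed
  then have "((\<lambda>s. \<Prod>i<n. bump ((y i - s * h i) / \<epsilon>) / \<epsilon>) has_real_derivative
    (\<Sum>i<n. bump' ((y i - s * h i) / \<epsilon>) / \<epsilon>\<^sup>2 * (- h i) *
      (\<Prod>j\<in>{..<n} - {i}. bump ((y j - s * h j) / \<epsilon>) / \<epsilon>))) (at s)"
    by (intro has_field_derivative_prod) auto
  then show ?thesis
    by (simp add: kern_def kern'_def mult_ac flip: sum_negf)
qed

lemma tendsto_bump: "(f \<longlongrightarrow> l) F \<Longrightarrow> ((\<lambda>x. bump (f x)) \<longlongrightarrow> bump l) F"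
  using continuous_bump[of UNIV] by (auto simp: continuous_on_eq_continuous_at isCont_tendsto_compose)

lemma tendsto_bump': "(f \<longlongrightarrow> l) F \<Longrightarrow> ((\<lambda>x. bump' (f x)) \<longlongrightarrow> bump' l) F"
  using continuous_bump'[of UNIV] by (auto simp: continuous_on_eq_continuous_at isCont_tendsto_compose)

lemma tendsto_kern:
  assumes "\<epsilon> > 0" "\<And>i. i < n \<Longrightarrow> ((\<lambda>k. f k i) \<longlongrightarrow> x i) F"
  shows "((\<lambda>k. kern n \<epsilon> (f k)) \<longlongrightarrow> kern n \<epsilon> x) F"
  unfolding kern_def using assms
  by (intro tendsto_prod tendsto_divide tendsto_bump tendsto_const) auto

lemma tendsto_kern':
  assumes "\<epsilon> > 0" "i < n" "\<And>i. i < n \<Longrightarrow> ((\<lambda>k. f k i) \<longlongrightarrow> x i) F"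
  shows "((\<lambda>k. kern' n \<epsilon> i (f k)) \<longlongrightarrow> kern' n \<epsilon> i x) F"
  unfolding kern'_def using assms
  by (intro tendsto_mult tendsto_prod tendsto_divide tendsto_bump tendsto_bump' tendsto_const) auto

lemma kern_nonneg: "\<epsilon> > 0 \<Longrightarrow> 0 \<le> kern n \<epsilon> x"
  unfolding kern_def by (intro prod_nonneg) (simp add: bump_nonneg)

lemma kern_eq_0:
  assumes "\<epsilon> > 0" "i < n" "\<epsilon> \<le> \<bar>x i\<bar>" shows "kern n \<epsilon> x = 0"
proof -
  have "bump (x i / \<epsilon>) = 0"
    using assms by (intro bump_eq_0) simp
  then show ?thesis
    unfolding kern_def using assms(2) by (auto simp: prod_zero_iff)
qed

text \<open>This bound and the next one dominate integrands for a fixed scale. They grow with the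
  dimension, but do not reach the final constant.\<close>

definition kern_bound :: "nat \<Rightarrow> real \<Rightarrow> real" where
  "kern_bound n \<epsilon> = (4 / \<epsilon>) ^ n"

definition kern'_bound :: "nat \<Rightarrow> real \<Rightarrow> real" where
  "kern'_bound n \<epsilon> = 4 / \<epsilon>\<^sup>2 * (4 / \<epsilon>) ^ (n - 1)"

lemma kern_le: "\<epsilon> > 0 \<Longrightarrow> kern n \<epsilon> x \<le> kern_bound n \<epsilon>"
  unfolding kern_def kern_bound_def
  by (rule order_trans[OF prod_mono[where g = "\<lambda>_. 4 / \<epsilon>"]])
    (auto simp: bump_nonneg bump_le divide_right_mono)

lemma prod_bump_le:
  assumes "\<epsilon> > 0" "i < n"
  shows "0 \<le> (\<Prod>j\<in>{..<n} - {i}. bump (x j / \<epsilon>) / \<epsilon>)"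
    "(\<Prod>j\<in>{..<n} - {i}. bump (x j / \<epsilon>) / \<epsilon>) \<le> (4 / \<epsilon>) ^ (n - 1)"
proof -
  show "0 \<le> (\<Prod>j\<in>{..<n} - {i}. bump (x j / \<epsilon>) / \<epsilon>)"
    using assms by (intro prod_nonneg) (simp add: bump_nonneg)
  have "(\<Prod>j\<in>{..<n} - {i}. bump (x j / \<epsilon>) / \<epsilon>) \<le> (\<Prod>j\<in>{..<n} - {i}. 4 / \<epsilon>)"
    using assms by (intro prod_mono) (auto simp: bump_nonneg bump_le divide_right_mono)
  then show "(\<Prod>j\<in>{..<n} - {i}. bump (x j / \<epsilon>) / \<epsilon>) \<le> (4 / \<epsilon>) ^ (n - 1)"
    using assms by simp
qed

lemma kern'_le:
  assumes "\<epsilon> > 0" "i < n" shows "\<bar>kern' n \<epsilon> i x\<bar> \<le> kern'_bound n \<epsilon>"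
  unfolding kern'_def kern'_bound_def abs_mult using assms prod_bump_le[OF assms, of x] bump'_le
  by (intro mult_mono) (auto simp: abs_divide divide_right_mono)

lemma kern_lipschitz:
  assumes "\<epsilon> > 0" "i < n"
  shows "\<bar>kern n \<epsilon> (x(i := r)) - kern n \<epsilon> (x(i := s))\<bar> \<le> kern'_bound n \<epsilon> * \<bar>r - s\<bar>"
proof -
  have "\<bar>kern n \<epsilon> (x(i := r)) - kern n \<epsilon> (x(i := s))\<bar> =
    \<bar>bump (r / \<epsilon>) - bump (s / \<epsilon>)\<bar> / \<epsilon> * (\<Prod>j\<in>{..<n} - {i}. bump (x j / \<epsilon>) / \<epsilon>)"
    using assms(1) prod_bump_le(1)[OF assms, of x]
    by (simp add: kern_upd[OF assms(2)] abs_mult flip: left_diff_distrib diff_divide_distrib)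
  also have "\<dots> \<le> (4 * \<bar>r / \<epsilon> - s / \<epsilon>\<bar>) / \<epsilon> * (4 / \<epsilon>) ^ (n - 1)"
    using assms prod_bump_le[OF assms, of x]
    by (intro mult_mono divide_right_mono bump_lipschitz) auto
  also have "\<dots> = kern'_bound n \<epsilon> * \<bar>r - s\<bar>"
    using assms(1) by (simp add: kern'_bound_def power2_eq_square flip: diff_divide_distrib)
  finally show ?thesis .
qed

lemma borel_measurable_bump [measurable]: "bump \<in> borel_measurable borel" "bump' \<in> borel_measurable borel"
  unfolding bump_def[abs_def] bump'_def[abs_def] by measurable

lemma borel_measurable_kern [measurable (raw)]:
  "(\<And>i. i < n \<Longrightarrow> (\<lambda>x. f x i) \<in> borel_measurable M) \<Longrightarrow> (\<lambda>x. kern n \<epsilon> (f x)) \<in> borel_measurable M"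
  unfolding kern_def by (intro borel_measurable_prod borel_measurable_divide measurable_compose[OF _ borel_measurable_bump(1)]) auto

lemma borel_measurable_kern' [measurable (raw)]:
  "(\<And>i. i < n \<Longrightarrow> (\<lambda>x. f x i) \<in> borel_measurable M) \<Longrightarrow> i < n \<Longrightarrow> (\<lambda>x. kern' n \<epsilon> i (f x)) \<in> borel_measurable M"
  unfolding kern'_def
  by (intro borel_measurable_times borel_measurable_prod borel_measurable_divide
    measurable_compose[OF _ borel_measurable_bump(1)] measurable_compose[OF _ borel_measurable_bump(2)]) auto

lemma nn_integral_kern:
  assumes "\<epsilon> > 0" shows "(\<integral>\<^sup>+x. ennreal (kern n \<epsilon> x) \<partial>lebR n) = 1"
proof -
  have "(\<integral>\<^sup>+r. ennreal (bump (r / \<epsilon>) / \<epsilon>) \<partial>lborel) = 1"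
  proof -
    have "(\<integral>\<^sup>+r. ennreal (bump r) \<partial>lborel) = 1"
      using has_bochner_integral_iff[of lborel bump 1] bump_integral bump_nonneg
      by (subst nn_integral_eq_integral) auto
    then have "1 = ennreal \<bar>inverse \<epsilon>\<bar> * (\<integral>\<^sup>+r. ennreal (bump (0 + inverse \<epsilon> * r)) \<partial>lborel)"
      using assms nn_integral_real_affine[of "\<lambda>r. ennreal (bump r)" "inverse \<epsilon>" 0] by simp
    also have "\<dots> = (\<integral>\<^sup>+r. ennreal (bump (r / \<epsilon>) / \<epsilon>) \<partial>lborel)"
      using assms by (subst nn_integral_cmult[symmetric])
        (auto intro!: nn_integral_cong simp: ennreal_mult'[symmetric] field_simps)
    finally show ?thesis
      by simp
  qed
  then have "(\<integral>\<^sup>+x. (\<Prod>i\<in>{..<n}. ennreal (bump (x i / \<epsilon>) / \<epsilon>)) \<partial>lebR n) = 1"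
    unfolding lebR_def by (subst lborel_product.product_nn_integral_prod) auto
  then show ?thesis
    using assms by (simp add: kern_def prod_ennreal bump_nonneg)
qed

lemma nn_integral_kern_reflect:
  assumes "\<epsilon> > 0" shows "(\<integral>\<^sup>+y. ennreal (kern n \<epsilon> (\<lambda>i. a i - y i)) \<partial>lebR n) = 1"
proof -
  have "(\<integral>\<^sup>+y. ennreal (kern n \<epsilon> (\<lambda>i. a i - y i)) \<partial>lebR n) = (\<integral>\<^sup>+y. ennreal (kern n \<epsilon> (vdiff n a y)) \<partial>lebR n)"
    by (intro nn_integral_cong arg_cong[where f = ennreal] kern_cong) (simp add: vdiff_def)
  also have "\<dots> = (\<integral>\<^sup>+y. ennreal (kern n \<epsilon> y) \<partial>lebR n)"
    by (rule nn_integral_vdiff_right) measurable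
  finally show ?thesis
    using nn_integral_kern[OF assms] by simp
qed

text \<open>Dominated convergence for the difference quotients at \<open>a\<close>; the Lipschitz
  condition at this single point provides the dominating function
  \<open>L * \<bar>w p\<bar>\<close>.\<close>

lemma deriv_integral_lipschitz:
  fixes f :: "'a \<Rightarrow> real \<Rightarrow> real"
  assumes w: "integrable P w"
    and meas: "f' \<in> borel_measurable P" "\<And>r. (\<lambda>p. f p r) \<in> borel_measurable P"
    and bdd: "\<And>p r. p \<in> space P \<Longrightarrow> \<bar>f p r\<bar> \<le> C"
    and deriv: "\<And>p. p \<in> space P \<Longrightarrow> (f p has_real_derivative f' p) (at a)"
    and lip: "\<And>p r. p \<in> space P \<Longrightarrow> \<bar>f p r - f p a\<bar> \<le> L * \<bar>r - a\<bar>"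
  shows "((\<lambda>r. LINT p|P. w p * f p r) has_real_derivative (LINT p|P. w p * f' p)) (at a)"
proof -
  have wm [measurable]: "w \<in> borel_measurable P"
    using w by simp
  note meas [measurable]
  have int: "integrable P (\<lambda>p. w p * f p r)" for r
  proof (rule Bochner_Integration.integrable_bound[of P "\<lambda>p. C * w p"])
    show "AE p in P. norm (w p * f p r) \<le> norm (C * w p)"
    proof (rule AE_I2)
      fix p assume "p \<in> space P"
      from bdd[OF this, of r] have "\<bar>w p\<bar> * \<bar>f p r\<bar> \<le> \<bar>w p\<bar> * \<bar>C\<bar>"
        by (intro mult_left_mono) auto
      then show "norm (w p * f p r) \<le> norm (C * w p)"
        by (simp add: abs_mult mult.commute)
    qed
  qed (use w in auto)
  have "((\<lambda>r. ((LINT p|P. w p * f p r) - (LINT p|P. w p * f p a)) / (r - a)) \<longlongrightarrow> (LINT p|P. w p * f' p)) (at a)"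
    unfolding tendsto_at_iff_sequentially o_def
  proof (intro allI impI)
    fix X :: "nat \<Rightarrow> real" assume X: "\<forall>i. X i \<in> UNIV - {a}" "X \<longlonglongrightarrow> a"
    then have ne: "X i \<noteq> a" for i
      by auto
    have "(\<lambda>i. LINT p|P. w p * ((f p (X i) - f p a) / (X i - a))) \<longlonglongrightarrow> (LINT p|P. w p * f' p)"
    proof (rule integral_dominated_convergence[where w = "\<lambda>p. L * \<bar>w p\<bar>"])
      show "AE p in P. (\<lambda>i. w p * ((f p (X i) - f p a) / (X i - a))) \<longlonglongrightarrow> w p * f' p"
      proof (rule AE_I2)
        fix p assume "p \<in> space P"
        from deriv[OF this] X have "(\<lambda>i. (f p (X i) - f p a) / (X i - a)) \<longlonglongrightarrow> f' p"
          unfolding has_field_derivative_iff tendsto_at_iff_sequentially o_def by blast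
        then show "(\<lambda>i. w p * ((f p (X i) - f p a) / (X i - a))) \<longlonglongrightarrow> w p * f' p"
          by (intro tendsto_intros)
      qed
      show "AE p in P. norm (w p * ((f p (X i) - f p a) / (X i - a))) \<le> L * \<bar>w p\<bar>" for i
      proof (rule AE_I2)
        fix p assume "p \<in> space P"
        from lip[OF this, of "X i"] ne[of i] have "\<bar>(f p (X i) - f p a) / (X i - a)\<bar> \<le> L"
          by (simp add: abs_divide pos_divide_le_eq)
        then have "\<bar>(f p (X i) - f p a) / (X i - a)\<bar> * \<bar>w p\<bar> \<le> L * \<bar>w p\<bar>"
          by (rule mult_right_mono) simp
        then show "norm (w p * ((f p (X i) - f p a) / (X i - a))) \<le> L * \<bar>w p\<bar>"
          unfolding real_norm_def abs_mult by (simp only: mult.commute)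
      qed
    qed (use w in auto)
    moreover have "(LINT p|P. w p * ((f p (X i) - f p a) / (X i - a))) =
        ((LINT p|P. w p * f p (X i)) - (LINT p|P. w p * f p a)) / (X i - a)" for i
    proof -
      have "(LINT p|P. w p * ((f p (X i) - f p a) / (X i - a))) =
          (LINT p|P. (w p * f p (X i) - w p * f p a) / (X i - a))"
        by (simp only: right_diff_distrib times_divide_eq_right)
      then show ?thesis
        using int by simp
    qed
    ultimately show "(\<lambda>i. ((LINT p|P. w p * f p (X i)) - (LINT p|P. w p * f p a)) / (X i - a)) \<longlonglongrightarrow> (LINT p|P. w p * f' p)"
      by (simp only:)
  qed
  then show ?thesis
    by (simp add: has_field_derivative_iff)
qed

text \<open>\<open>\<Phi>\<close> is the convolution of \<open>S\<close> with the mollifier, averaged over the segment from \<open>0\<close> to \<open>h\<close>;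
  the divergence of \<open>h \<Phi>\<close> telescopes along the segment.\<close>

locale mollified =
  fixes n :: nat and \<epsilon> :: real and h :: vec and S :: "vec \<Rightarrow> real" and r :: real
  assumes eps: "\<epsilon> > 0"
    and S_int: "integrable (lebR n) S"
    and S_le: "\<bar>S y\<bar> \<le> 1"
    and S_supp: "y \<in> Rn n \<Longrightarrow> S y \<noteq> 0 \<Longrightarrow> y \<in> cube n r"
begin

abbreviation P where "P \<equiv> lebR n \<Otimes>\<^sub>M (lborel :: real measure)"

sublocale L: sigma_finite_measure "lebR n"
  by (rule sigma_finite_lebR)

sublocale LP: pair_sigma_finite "lebR n" "lborel :: real measure"
  by standard

definition W :: "vec \<times> real \<Rightarrow> real" where
  "W p = S (fst p) * indicator {0..1} (snd p)"

definition shift :: "vec \<Rightarrow> vec \<times> real \<Rightarrow> vec" where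
  "shift x p = (\<lambda>i. x i - fst p i - snd p * h i)"

definition \<Phi> :: "vec \<Rightarrow> real" where
  "\<Phi> x = (LINT p|P. W p * kern n \<epsilon> (shift x p))"

definition \<Phi>' :: "nat \<Rightarrow> vec \<Rightarrow> real" where
  "\<Phi>' i x = (LINT p|P. W p * kern' n \<epsilon> i (shift x p))"

lemma S_meas [measurable]: "S \<in> borel_measurable (lebR n)"
  using S_int by simp

lemma W_meas [measurable]: "W \<in> borel_measurable P"
  unfolding W_def[abs_def] by measurable

lemma W_int: "integrable P W"
proof -
  have "integrable P (\<lambda>(y, s). S y * indicator {0..1::real} s)"
  proof (rule LP.Fubini_integrable)
    have int: "integrable lborel (\<lambda>s. S y * indicat_real {0..1::real} s)" for y
      by (intro integrable_mult_right integrable_real_indicator) auto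
    show "AE y in lebR n. integrable lborel (\<lambda>s. case (y, s) of (y, s) \<Rightarrow> S y * indicator {0..1::real} s)"
      unfolding prod.case by (intro AE_I2 int)
    have "(LINT s|lborel. norm (S y * indicator {0..1::real} s)) = \<bar>S y\<bar>" for y
      by (simp add: abs_mult)
    then show "integrable (lebR n) (\<lambda>y. LINT s|lborel. norm (case (y, s) of (y, s) \<Rightarrow> S y * indicator {0..1::real} s))"
      using S_int by simp
  qed measurable
  then show ?thesis
    by (simp only: W_def[abs_def] case_prod_unfold)
qed

lemma shift_meas: "i < n \<Longrightarrow> (\<lambda>p. shift x p i) \<in> borel_measurable P"
  unfolding shift_def by measurable

lemma kern_shift_meas [measurable]: "(\<lambda>p. kern n \<epsilon> (shift x p)) \<in> borel_measurable P"
  by (intro borel_measurable_kern shift_meas)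

lemma kern'_shift_meas: "i < n \<Longrightarrow> (\<lambda>p. kern' n \<epsilon> i (shift x p)) \<in> borel_measurable P"
  by (intro borel_measurable_kern' shift_meas)

lemma \<Phi>_deriv:
  assumes i: "i < n"
  shows "((\<lambda>r. \<Phi> (x(i := r))) has_real_derivative \<Phi>' i x) (at (x i))"
proof -
  \<comment> \<open>Moving one coordinate of \<open>x\<close> moves the same coordinate of the
    shifted point and no other, so the one-variable facts on \<open>kern\<close> apply under the
    integral.\<close>
  have upd: "shift (x(i := r)) p = (shift x p)(i := r - (fst p i + snd p * h i))" for r p
    by (auto simp: shift_def fun_eq_iff)
  show ?thesis
    unfolding \<Phi>_def \<Phi>'_def
  proof (rule deriv_integral_lipschitz[where C = "kern_bound n \<epsilon>" and L = "kern'_bound n \<epsilon>"])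
    show "(\<lambda>p. kern' n \<epsilon> i (shift x p)) \<in> borel_measurable P"
      by (rule kern'_shift_meas[OF i])
    show "\<bar>kern n \<epsilon> (shift (x(i := r)) p)\<bar> \<le> kern_bound n \<epsilon>" for p r
      using kern_nonneg[OF eps] kern_le[OF eps] by simp
    show "((\<lambda>r. kern n \<epsilon> (shift (x(i := r)) p)) has_real_derivative kern' n \<epsilon> i (shift x p)) (at (x i))" for p
    proof -
      have 1: "((\<lambda>r. r - (fst p i + snd p * h i)) has_real_derivative 1) (at (x i))"
        by (auto intro!: derivative_eq_intros)
      have "((\<lambda>r. kern n \<epsilon> ((shift x p)(i := r))) has_real_derivative kern' n \<epsilon> i (shift x p))
          (at (x i - (fst p i + snd p * h i)))"
        using kern_deriv[OF eps i, of "shift x p"] by (simp add: shift_def diff_diff_eq)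
      from DERIV_chain2[OF this 1] show ?thesis
        by (simp add: upd)
    qed
    show "\<bar>kern n \<epsilon> (shift (x(i := r)) p) - kern n \<epsilon> (shift (x(i := x i)) p)\<bar> \<le> kern'_bound n \<epsilon> * \<bar>r - x i\<bar>" for p r
      unfolding upd by (rule order_trans[OF kern_lipschitz[OF eps i]]) simp
  qed (auto intro: W_int)
qed

lemma tendsto_shift:
  assumes "X \<longlonglongrightarrow> x" shows "(\<lambda>k. shift (X k) p i) \<longlonglongrightarrow> shift x p i"
  unfolding shift_def by (intro tendsto_intros tendsto_vecD[OF assms])

lemma \<Phi>_cont: "continuous_on A \<Phi>"
proof (rule continuous_on_sequentiallyI)
  fix X :: "nat \<Rightarrow> vec" and x assume X: "X \<longlonglongrightarrow> x"
  show "(\<lambda>k. \<Phi> (X k)) \<longlonglongrightarrow> \<Phi> x"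
    unfolding \<Phi>_def
  proof (rule integral_dominated_convergence[where w = "\<lambda>p. kern_bound n \<epsilon> * \<bar>W p\<bar>"])
    show "AE p in P. (\<lambda>k. W p * kern n \<epsilon> (shift (X k) p)) \<longlonglongrightarrow> W p * kern n \<epsilon> (shift x p)"
      by (intro AE_I2 tendsto_mult tendsto_const tendsto_kern[OF eps] tendsto_shift[OF X])
    show "AE p in P. norm (W p * kern n \<epsilon> (shift (X k) p)) \<le> kern_bound n \<epsilon> * \<bar>W p\<bar>" for k
      using kern_nonneg[OF eps] kern_le[OF eps]
      by (intro AE_I2) (simp add: abs_mult mult.commute[of _ "kern n \<epsilon> _"] mult_right_mono)
  qed (use W_int in auto)
qed

lemma \<Phi>'_cont:
  assumes i: "i < n" shows "continuous_on A (\<Phi>' i)"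
proof (rule continuous_on_sequentiallyI)
  fix X :: "nat \<Rightarrow> vec" and x assume X: "X \<longlonglongrightarrow> x"
  show "(\<lambda>k. \<Phi>' i (X k)) \<longlonglongrightarrow> \<Phi>' i x"
    unfolding \<Phi>'_def
  proof (rule integral_dominated_convergence[where w = "\<lambda>p. kern'_bound n \<epsilon> * \<bar>W p\<bar>"])
    show "AE p in P. (\<lambda>k. W p * kern' n \<epsilon> i (shift (X k) p)) \<longlonglongrightarrow> W p * kern' n \<epsilon> i (shift x p)"
      by (intro AE_I2 tendsto_mult tendsto_const tendsto_kern'[OF eps i] tendsto_shift[OF X])
    show "AE p in P. norm (W p * kern' n \<epsilon> i (shift (X k) p)) \<le> kern'_bound n \<epsilon> * \<bar>W p\<bar>" for k
      using kern'_le[OF eps i]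
      by (intro AE_I2) (simp add: abs_mult mult.commute[of _ "\<bar>kern' n \<epsilon> _ _\<bar>"] mult_right_mono)
  qed (use W_int kern'_shift_meas[OF i] in auto)
qed

text \<open>\<open>S\<close> is bounded by 1, the kernel has mass 1 around every centre, and the
  segment parameter runs over an interval of length 1.\<close>

lemma \<Phi>_le: "\<bar>\<Phi> x\<bar> \<le> 1"
proof -
  have "(\<integral>\<^sup>+p. ennreal (norm (W p * kern n \<epsilon> (shift x p))) \<partial>P)
      = (\<integral>\<^sup>+s. \<integral>\<^sup>+y. ennreal (norm (W (y, s) * kern n \<epsilon> (shift x (y, s)))) \<partial>lebR n \<partial>lborel)"
    by (subst LP.nn_integral_snd[symmetric]) auto
  also have "\<dots> \<le> (\<integral>\<^sup>+s. \<integral>\<^sup>+y. indicator {0..1} s * ennreal (kern n \<epsilon> (\<lambda>i. (x i - s * h i) - y i)) \<partial>lebR n \<partial>lborel)"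
  proof (intro nn_integral_mono)
    fix y s
    have "shift x (y, s) = (\<lambda>i. (x i - s * h i) - y i)"
      by (auto simp: shift_def)
    moreover have "\<bar>S y\<bar> * kern n \<epsilon> z \<le> kern n \<epsilon> z" for z
      using S_le[of y] kern_nonneg[OF eps, of n z] by (simp add: mult_left_le_one_le)
    ultimately show "ennreal (norm (W (y, s) * kern n \<epsilon> (shift x (y, s)))) \<le>
        indicator {0..1} s * ennreal (kern n \<epsilon> (\<lambda>i. (x i - s * h i) - y i))"
      using kern_nonneg[OF eps] by (auto simp: W_def indicator_def abs_mult)
  qed
  also have "\<dots> = (\<integral>\<^sup>+s. indicator {0..1} s * 1 \<partial>(lborel :: real measure))"
    by (intro nn_integral_cong)
      (simp add: nn_integral_cmult nn_integral_kern_reflect[OF eps, of n "\<lambda>i. x i - _ i"])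
  also have "\<dots> = 1"
    by simp
  finally have le: "(\<integral>\<^sup>+p. ennreal (norm (W p * kern n \<epsilon> (shift x p))) \<partial>P) \<le> 1" .
  have "\<bar>\<Phi> x\<bar> \<le> (LINT p|P. norm (W p * kern n \<epsilon> (shift x p)))"
    unfolding \<Phi>_def real_norm_def[symmetric] by (rule integral_norm_bound)
  also have "\<dots> = enn2real (\<integral>\<^sup>+p. ennreal (norm (W p * kern n \<epsilon> (shift x p))) \<partial>P)"
    by (intro integral_eq_nn_integral) auto
  also have "\<dots> \<le> 1"
    using enn2real_mono[OF le] by simp
  finally show ?thesis .
qed

text \<open>In some coordinate such a point is at least \<open>\<epsilon>\<close> away from every
  point of the support of \<open>S\<close> moved along the segment, and there the kernel
  vanishes.\<close>

lemma \<Phi>_supp: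
  assumes x: "x \<in> Rn n" "x \<notin> cube n (r + (\<Sum>i<n. \<bar>h i\<bar>) + \<epsilon>)"
  shows "\<Phi> x = 0"
proof -
  obtain i where i: "i < n" "\<bar>x i\<bar> > r + (\<Sum>i<n. \<bar>h i\<bar>) + \<epsilon>"
    using x by (auto simp: mem_cube not_le)
  have "W p * kern n \<epsilon> (shift x p) = 0" if p: "p \<in> space P" for p
  proof (cases "W p = 0")
    case False
    then have "S (fst p) \<noteq> 0" and s: "0 \<le> snd p" "snd p \<le> 1"
      by (auto simp: W_def indicator_def split: if_splits)
    moreover have "fst p \<in> Rn n"
      using p by (auto simp: space_pair_measure space_lebR)
    ultimately have "\<bar>fst p i\<bar> \<le> r"
      using S_supp i(1) by (auto simp: mem_cube)
    moreover have "\<bar>snd p * h i\<bar> \<le> (\<Sum>i<n. \<bar>h i\<bar>)"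
    proof -
      have "\<bar>snd p * h i\<bar> \<le> \<bar>h i\<bar>"
        using s by (simp add: abs_mult mult_left_le_one_le)
      also have "\<dots> \<le> (\<Sum>i<n. \<bar>h i\<bar>)"
        using i(1) by (intro member_le_sum) auto
      finally show ?thesis .
    qed
    ultimately have "\<epsilon> \<le> \<bar>shift x p i\<bar>"
      using i(2) unfolding shift_def by linarith
    then show ?thesis
      using kern_eq_0[OF eps i(1)] by simp
  qed simp
  then have "\<Phi> x = (LINT p|P. 0)"
    unfolding \<Phi>_def by (intro Bochner_Integration.integral_cong) auto
  then show ?thesis
    by simp
qed

end

text \<open>Tychonoff's theorem concerns all coordinates of the function space; beyond
  \<open>n\<close>, extensionality makes each factor the singleton of
  \<open>undefined\<close>.\<close>

lemma compact_cube: "compact (cube n R)"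
proof -
  have "compactin (product_topology (\<lambda>_::nat. euclideanreal) UNIV) (\<Pi>\<^sub>E i\<in>UNIV. if i < n then {- R..R} else {undefined})"
    by (subst compactin_PiE) auto
  moreover have "(\<Pi>\<^sub>E i\<in>UNIV. if i < n then {- R..R} else {undefined}) = cube n R"
  proof (intro set_eqI)
    fix x :: vec
    have "x \<in> (\<Pi>\<^sub>E i\<in>UNIV. if i < n then {- R..R} else {undefined}) \<longleftrightarrow>
        (\<forall>i. (i < n \<longrightarrow> x i \<in> {- R..R}) \<and> (\<not> i < n \<longrightarrow> x i = undefined))"
      unfolding PiE_UNIV_domain Pi_iff ball_UNIV by (intro iff_allI) simp
    also have "\<dots> \<longleftrightarrow> x \<in> cube n R"
      unfolding all_conj_distrib cube_def PiE_iff extensional_def by auto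
    finally show "x \<in> (\<Pi>\<^sub>E i\<in>UNIV. if i < n then {- R..R} else {undefined}) \<longleftrightarrow> x \<in> cube n R" .
  qed
  ultimately show ?thesis
    by (simp add: euclidean_product_topology)
qed

lemma (in pair_sigma_finite) integrable_pair_mult:
  fixes f g :: "_ \<Rightarrow> real"
  assumes "integrable M1 f" "integrable M2 g"
  shows "integrable (M1 \<Otimes>\<^sub>M M2) (\<lambda>(x, y). f x * g y)"
proof (rule Fubini_integrable)
  have [measurable]: "f \<in> borel_measurable M1" "g \<in> borel_measurable M2"
    using assms by auto
  show "(\<lambda>(x, y). f x * g y) \<in> borel_measurable (M1 \<Otimes>\<^sub>M M2)"
    by measurable
  show "integrable M1 (\<lambda>x. LINT y|M2. norm (case (x, y) of (x, y) \<Rightarrow> f x * g y))"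
    using assms by (simp add: abs_mult)
  show "AE x in M1. integrable M2 (\<lambda>y. case (x, y) of (x, y) \<Rightarrow> f x * g y)"
    using assms by simp
qed

lemma perimeter_ge:
  assumes "finite_perimeter n \<Omega>" "\<phi> \<in> test_fields n"
  shows "(LINT x|lebR n. indicat_real \<Omega> x * divergence n \<phi> x) \<le> perimeter n \<Omega>"
proof -
  have 1: "ereal (LINT x|lebR n. indicat_real \<Omega> x * divergence n \<phi> x) \<le> variation n (indicat_real \<Omega>)"
    unfolding variation_def by (rule SUP_upper) (rule assms(2))
  \<comment> \<open>The variation is finite above by hypothesis and bounded below by a real
    integral. Hence it is a real number and \<open>perimeter\<close> does not fall back on the
    default value 0.\<close>
  then have "ereal (real_of_ereal (variation n (indicat_real \<Omega>))) = variation n (indicat_real \<Omega>)"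
    using assms(1) by (intro ereal_real') (auto simp: finite_perimeter_def)
  then show ?thesis
    using 1 unfolding perimeter_def by (metis ereal_less_eq(3))
qed

context mollified
begin

text \<open>The segment parameter is integrated first. Its integrand is the derivative of minus the
  kernel along the segment, and the fundamental theorem of calculus leaves the two endpoint
  values.\<close>

lemma divergence_formula:
  "(\<Sum>i<n. h i * \<Phi>' i x) =
    (LINT y|lebR n. S y * (kern n \<epsilon> (\<lambda>i. x i - y i) - kern n \<epsilon> (\<lambda>i. x i - y i - h i)))"
proof -
  let ?k = "\<lambda>p. \<Sum>i<n. h i * kern' n \<epsilon> i (shift x p)"
  have int: "integrable P (\<lambda>p. W p * kern' n \<epsilon> i (shift x p))" if i: "i < n" for i
  proof (rule Bochner_Integration.integrable_bound[of P "\<lambda>p. kern'_bound n \<epsilon> * \<bar>W p\<bar>"])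
    show "AE p in P. norm (W p * kern' n \<epsilon> i (shift x p)) \<le> norm (kern'_bound n \<epsilon> * \<bar>W p\<bar>)"
    proof (rule AE_I2)
      fix p
      have "\<bar>kern' n \<epsilon> i (shift x p)\<bar> * \<bar>W p\<bar> \<le> \<bar>kern'_bound n \<epsilon>\<bar> * \<bar>W p\<bar>"
        using kern'_le[OF eps i, of "shift x p"] by (intro mult_right_mono) auto
      then show "norm (W p * kern' n \<epsilon> i (shift x p)) \<le> norm (kern'_bound n \<epsilon> * \<bar>W p\<bar>)"
        by (simp add: abs_mult mult.commute)
    qed
  qed (use W_int kern'_shift_meas[OF i] in auto)
  have "(\<Sum>i<n. h i * \<Phi>' i x) = (\<Sum>i<n. LINT p|P. h i * (W p * kern' n \<epsilon> i (shift x p)))"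
    by (simp add: \<Phi>'_def)
  also have "\<dots> = (LINT p|P. (\<Sum>i<n. h i * (W p * kern' n \<epsilon> i (shift x p))))"
    using int by (subst Bochner_Integration.integral_sum) auto
  also have "\<dots> = (LINT p|P. W p * ?k p)"
    by (simp add: sum_distrib_left mult_ac)
  also have "\<dots> = (LINT y|lebR n. LINT s|lborel. W (y, s) * ?k (y, s))"
  proof (rule LP.integral_fst'[symmetric])
    have "integrable P (\<lambda>p. \<Sum>i<n. h i * (W p * kern' n \<epsilon> i (shift x p)))"
      using int by auto
    then show "integrable P (\<lambda>p. W p * ?k p)"
      by (simp add: sum_distrib_left mult_ac)
  qed
  also have "\<dots> = (LINT y|lebR n. S y * (kern n \<epsilon> (\<lambda>i. x i - y i) - kern n \<epsilon> (\<lambda>i. x i - y i - h i)))"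
  proof (intro Bochner_Integration.integral_cong refl)
    fix y
    let ?f = "\<lambda>s. \<Sum>i<n. h i * kern' n \<epsilon> i (\<lambda>i. (x i - y i) - s * h i)"
    let ?F = "\<lambda>s. - kern n \<epsilon> (\<lambda>i. (x i - y i) - s * h i)"
    have F: "(?F has_real_derivative ?f s) (at s)" for s
      using DERIV_minus[OF kern_line_deriv[OF eps, of n "\<lambda>i. x i - y i" h s]] by simp
    have "isCont ?f s" for s
      unfolding isCont_def
      by (intro tendsto_sum tendsto_mult tendsto_const tendsto_kern'[OF eps])
        (auto intro!: tendsto_intros)
    then have "(LINT s|lborel. ?f s * indicator {0..1} s) = ?F 1 - ?F 0"
      using F by (intro integral_FTC_Icc_real) auto
    moreover have "(LINT s|lborel. W (y, s) * ?k (y, s)) = S y * (LINT s|lborel. ?f s * indicator {0..1} s)"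
      by (simp add: W_def shift_def mult_ac)
    ultimately show "(LINT s|lborel. W (y, s) * ?k (y, s)) =
        S y * (kern n \<epsilon> (\<lambda>i. x i - y i) - kern n \<epsilon> (\<lambda>i. x i - y i - h i))"
      by simp
  qed
  finally show ?thesis .
qed

text \<open>\<open>\<Phi>_le\<close> makes this field admissible; normalising \<open>h\<close> costs
  the factor \<open>enorm n h\<close> in the translation bound.\<close>

definition field :: "vec \<Rightarrow> vec" where
  "field x = (\<lambda>i\<in>{..<n}. h i / enorm n h * \<Phi> x)"

context
  assumes h_pos: "enorm n h > 0"
begin

lemma field_component_deriv:
  assumes "i < n" "j < n"
  shows "((\<lambda>s. field (x(j := s)) i) has_real_derivative h i / enorm n h * \<Phi>' j x) (at (x j))"
  unfolding field_def using assms(1) DERIV_cmult[OF \<Phi>_deriv[OF assms(2)], of "h i / enorm n h" x]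
  by simp

lemma field_partial_derivative:
  "i < n \<Longrightarrow> j < n \<Longrightarrow> partial_derivative j (\<lambda>x. field x i) x = h i / enorm n h * \<Phi>' j x"
  unfolding partial_derivative_def by (rule DERIV_imp_deriv) (rule field_component_deriv)

lemma field_test: "field \<in> test_fields n"
proof -
  have "C1_on_Rn n (\<lambda>x. field x i)" if i: "i < n" for i
    unfolding C1_on_Rn_def
  proof (intro conjI allI impI ballI)
    show "continuous_on (Rn n) (\<lambda>x. field x i)"
      unfolding field_def using i h_pos \<Phi>_cont[of "Rn n"] by (auto intro!: continuous_intros)
    fix j assume j: "j < n"
    show "(\<lambda>s. field (x(j := s)) i) differentiable at (x j)" for x
      using field_component_deriv[OF i j] by (auto simp: real_differentiable_def)
    have "partial_derivative j (\<lambda>x. field x i) = (\<lambda>x. h i / enorm n h * \<Phi>' j x)"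
      using field_partial_derivative[OF i j] by (simp add: fun_eq_iff)
    then show "continuous_on (Rn n) (partial_derivative j (\<lambda>x. field x i))"
      using \<Phi>'_cont[OF j, of "Rn n"] h_pos by (auto intro!: continuous_intros)
  qed
  moreover have "enorm n (field x) \<le> 1" for x
  proof -
    have "enorm n (field x) = sqrt (\<Sum>i<n. (\<Phi> x / enorm n h)\<^sup>2 * (h i)\<^sup>2)"
      by (simp add: L2_set_def field_def power_mult_distrib power_divide mult_ac)
    also have "\<dots> = \<bar>\<Phi> x / enorm n h\<bar> * enorm n h"
      by (simp add: L2_set_def real_sqrt_mult flip: sum_distrib_left)
    also have "\<dots> = \<bar>\<Phi> x\<bar>"
      using h_pos by (simp add: abs_divide)
    finally show ?thesis
      using \<Phi>_le[of x] by simp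
  qed
  moreover have "field \<in> Rn n \<rightarrow> Rn n"
    by (auto simp: field_def Rn_def)
  moreover have "\<exists>K. compact K \<and> K \<subseteq> Rn n \<and> (\<forall>x\<in>Rn n - K. \<forall>i<n. field x i = 0)"
    using \<Phi>_supp
    by (intro exI[of _ "cube n (r + (\<Sum>i<n. \<bar>h i\<bar>) + \<epsilon>)"]) (auto simp: compact_cube cube_subset field_def)
  ultimately show ?thesis
    by (simp add: test_fields_def)
qed

lemma divergence_field: "divergence n field x = (\<Sum>i<n. h i * \<Phi>' i x) / enorm n h"
  by (simp add: divergence_def field_partial_derivative sum_divide_distrib)

end

end

lemma vadd_in_Rn [simp]: "vadd n x y \<in> Rn n"
  by (simp add: vadd_def Rn_def)

lemma vadd_vadd: "vadd n u (vadd n y h) = vadd n (vadd n y u) h"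
  by (auto simp: vadd_def fun_eq_iff)

text \<open>The L^1 norm of a function is its pairing with its sign, and a function with values -1,
  0, 1 is its own sign. This is why the test field is built from \<open>S\<close> itself.\<close>

locale mollified_set = mollified n \<epsilon> h S r
  for n \<epsilon> h S r +
  fixes \<Omega> :: "vec set"
  assumes \<Omega>_int: "integrable (lebR n) (indicat_real \<Omega>)"
    and S_eq: "y \<in> Rn n \<Longrightarrow> S y = indicat_real \<Omega> y - indicat_real \<Omega> (vadd n y h)"
begin

sublocale LL: pair_sigma_finite "lebR n" "lebR n"
  by standard

lemma \<Omega>_meas [measurable]: "indicat_real \<Omega> \<in> borel_measurable (lebR n)"
  using \<Omega>_int by simp

lemma kern_int: "integrable (lebR n) (kern n \<epsilon>)"
  using nn_integral_kern[OF eps, of n]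
  by (intro integrableI_nonneg) (auto simp: kern_nonneg[OF eps])

lemma S_vadd_meas [measurable]: "(\<lambda>p. S (vadd n (fst p) (snd p))) \<in> borel_measurable (lebR n \<Otimes>\<^sub>M lebR n)"
  by (intro measurable_compose[OF _ S_meas] measurable_vadd) auto

text \<open>After Fubini, the substitutions x = u + y and x = u + y + h turn the two kernel terms
  into values of the indicator of \<Omega>, whose difference is again a value of \<open>S\<close>.
  What remains is the autocorrelation of \<open>S\<close> smoothed by the kernel.\<close>

lemma integral_divergence:
  "(LINT x|lebR n. indicat_real \<Omega> x * (\<Sum>i<n. h i * \<Phi>' i x)) =
    (LINT u|lebR n. kern n \<epsilon> u * (LINT y|lebR n. S y * S (vadd n y u)))"
proof -
  let ?kk = "\<lambda>x y. kern n \<epsilon> (\<lambda>i. x i - y i) - kern n \<epsilon> (\<lambda>i. x i - y i - h i)"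
  have kk: "\<bar>?kk x y\<bar> \<le> kern_bound n \<epsilon>" for x y
    using kern_nonneg[OF eps, of n] kern_le[OF eps, of n] by (smt (verit))
  have kk_meas: "(\<lambda>p. ?kk (fst p) (snd p)) \<in> borel_measurable (lebR n \<Otimes>\<^sub>M lebR n)"
    by measurable
  have int1: "integrable (lebR n \<Otimes>\<^sub>M lebR n) (\<lambda>(x, y). indicat_real \<Omega> x * (S y * ?kk x y))"
  proof (rule Bochner_Integration.integrable_bound)
    show "integrable (lebR n \<Otimes>\<^sub>M lebR n) (\<lambda>p. kern_bound n \<epsilon> * (case p of (x, y) \<Rightarrow> indicat_real \<Omega> x * S y))"
      using LL.integrable_pair_mult[OF \<Omega>_int S_int] by (rule integrable_mult_right)
    show "AE p in lebR n \<Otimes>\<^sub>M lebR n. norm (case p of (x, y) \<Rightarrow> indicat_real \<Omega> x * (S y * ?kk x y))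
        \<le> norm (kern_bound n \<epsilon> * (case p of (x, y) \<Rightarrow> indicat_real \<Omega> x * S y))"
    proof (rule AE_I2, clarify)
      fix x y
      have "\<bar>?kk x y\<bar> * (\<bar>indicat_real \<Omega> x\<bar> * \<bar>S y\<bar>) \<le> \<bar>kern_bound n \<epsilon>\<bar> * (\<bar>indicat_real \<Omega> x\<bar> * \<bar>S y\<bar>)"
        using kk[of x y] by (intro mult_right_mono) auto
      then show "norm (indicat_real \<Omega> x * (S y * ?kk x y)) \<le> norm (kern_bound n \<epsilon> * (indicat_real \<Omega> x * S y))"
        by (simp add: abs_mult mult_ac)
    qed
    have "(\<lambda>p. indicat_real \<Omega> (fst p) * (S (snd p) * ?kk (fst p) (snd p))) \<in> borel_measurable (lebR n \<Otimes>\<^sub>M lebR n)"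
      by (intro borel_measurable_times kk_meas) measurable
    then show "(\<lambda>(x, y). indicat_real \<Omega> x * (S y * ?kk x y)) \<in> borel_measurable (lebR n \<Otimes>\<^sub>M lebR n)"
      by (simp only: case_prod_unfold)
  qed
  have inner: "(LINT x|lebR n. indicat_real \<Omega> x * (S y * ?kk x y)) =
      S y * (LINT u|lebR n. kern n \<epsilon> u * S (vadd n y u))" for y
  proof -
    have shift: "(LINT x|lebR n. indicat_real \<Omega> x * kern n \<epsilon> (\<lambda>i. x i - a i)) =
        (LINT u|lebR n. kern n \<epsilon> u * indicat_real \<Omega> (vadd n u a))" for a
    proof -
      have "(LINT x|lebR n. indicat_real \<Omega> x * kern n \<epsilon> (\<lambda>i. x i - a i)) =
          (LINT u|lebR n. indicat_real \<Omega> (vadd n u a) * kern n \<epsilon> (\<lambda>i. vadd n u a i - a i))"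
        by (rule integral_vadd[symmetric]) measurable
      also have "\<dots> = (LINT u|lebR n. kern n \<epsilon> u * indicat_real \<Omega> (vadd n u a))"
      proof (intro Bochner_Integration.integral_cong refl)
        fix u
        have "kern n \<epsilon> (\<lambda>i. vadd n u a i - a i) = kern n \<epsilon> u"
          by (rule kern_cong) (simp add: vadd_def)
        then show "indicat_real \<Omega> (vadd n u a) * kern n \<epsilon> (\<lambda>i. vadd n u a i - a i) =
            kern n \<epsilon> u * indicat_real \<Omega> (vadd n u a)"
          by simp
      qed
      finally show ?thesis .
    qed
    have int: "integrable (lebR n) (\<lambda>x. indicat_real \<Omega> x * kern n \<epsilon> (\<lambda>i. x i - a i))" for a
    proof (rule Bochner_Integration.integrable_bound[of _ "\<lambda>x. kern_bound n \<epsilon> * indicat_real \<Omega> x"])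
      show "AE x in lebR n. norm (indicat_real \<Omega> x * kern n \<epsilon> (\<lambda>i. x i - a i)) \<le> norm (kern_bound n \<epsilon> * indicat_real \<Omega> x)"
        using kern_nonneg[OF eps, of n] kern_le[OF eps, of n]
        by (intro AE_I2) (auto simp: indicator_def intro: order_trans[OF _ abs_ge_self])
    qed (use \<Omega>_int in auto)
    have int2: "integrable (lebR n) (\<lambda>u. kern n \<epsilon> u * indicat_real \<Omega> (vadd n u a))" for a
    proof (rule Bochner_Integration.integrable_bound[OF kern_int])
      show "(\<lambda>u. kern n \<epsilon> u * indicat_real \<Omega> (vadd n u a)) \<in> borel_measurable (lebR n)"
        unfolding vadd_aff_map by measurable
    qed (auto simp: indicator_def)
    have h_eq: "kern n \<epsilon> (\<lambda>i. x i - y i - h i) = kern n \<epsilon> (\<lambda>i. x i - vadd n y h i)" for x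
      by (rule kern_cong) (simp add: vadd_def)
    have "(LINT x|lebR n. indicat_real \<Omega> x * (S y * ?kk x y)) =
       S y * ((LINT x|lebR n. indicat_real \<Omega> x * kern n \<epsilon> (\<lambda>i. x i - y i)) -
         (LINT x|lebR n. indicat_real \<Omega> x * kern n \<epsilon> (\<lambda>i. x i - vadd n y h i)))"
    proof -
      have "(LINT x|lebR n. indicat_real \<Omega> x * (S y * ?kk x y)) =
        (LINT x|lebR n. S y * (indicat_real \<Omega> x * kern n \<epsilon> (\<lambda>i. x i - y i) -
          indicat_real \<Omega> x * kern n \<epsilon> (\<lambda>i. x i - vadd n y h i)))"
        unfolding h_eq by (intro Bochner_Integration.integral_cong refl) (simp add: right_diff_distrib)
      then show ?thesis
        using int by simp
    qed
    also have "\<dots> = S y * (LINT u|lebR n. kern n \<epsilon> u * indicat_real \<Omega> (vadd n u y) -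
        kern n \<epsilon> u * indicat_real \<Omega> (vadd n u (vadd n y h)))"
      unfolding shift using int2 by simp
    also have "(LINT u|lebR n. kern n \<epsilon> u * indicat_real \<Omega> (vadd n u y) -
        kern n \<epsilon> u * indicat_real \<Omega> (vadd n u (vadd n y h))) =
        (LINT u|lebR n. kern n \<epsilon> u * S (vadd n y u))"
    proof (intro Bochner_Integration.integral_cong refl)
      fix u
      have "vadd n u y = vadd n y u"
        by (simp add: vadd_def add.commute)
      then show "kern n \<epsilon> u * indicat_real \<Omega> (vadd n u y) - kern n \<epsilon> u * indicat_real \<Omega> (vadd n u (vadd n y h)) =
          kern n \<epsilon> u * S (vadd n y u)"
        by (simp add: S_eq vadd_vadd right_diff_distrib)
    qed
    finally show ?thesis .
  qed
  have int3: "integrable (lebR n \<Otimes>\<^sub>M lebR n) (\<lambda>(y, u). S y * (kern n \<epsilon> u * S (vadd n y u)))"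
  proof (rule Bochner_Integration.integrable_bound[OF LL.integrable_pair_mult[OF S_int kern_int]])
    show "AE p in lebR n \<Otimes>\<^sub>M lebR n. norm (case p of (y, u) \<Rightarrow> S y * (kern n \<epsilon> u * S (vadd n y u)))
        \<le> norm (case p of (y, u) \<Rightarrow> S y * kern n \<epsilon> u)"
    proof (rule AE_I2, clarify)
      fix y u
      have "\<bar>S y * kern n \<epsilon> u\<bar> * \<bar>S (vadd n y u)\<bar> \<le> \<bar>S y * kern n \<epsilon> u\<bar> * 1"
        by (intro mult_left_mono S_le) auto
      then show "norm (S y * (kern n \<epsilon> u * S (vadd n y u))) \<le> norm (S y * kern n \<epsilon> u)"
        by (simp add: abs_mult mult_ac)
    qed
    have "(\<lambda>p. S (fst p) * (kern n \<epsilon> (snd p) * S (vadd n (fst p) (snd p)))) \<in> borel_measurable (lebR n \<Otimes>\<^sub>M lebR n)"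
      by measurable
    then show "(\<lambda>(y, u). S y * (kern n \<epsilon> u * S (vadd n y u))) \<in> borel_measurable (lebR n \<Otimes>\<^sub>M lebR n)"
      by (simp only: case_prod_unfold)
  qed
  have "(LINT x|lebR n. indicat_real \<Omega> x * (\<Sum>i<n. h i * \<Phi>' i x)) =
      (LINT x|lebR n. LINT y|lebR n. indicat_real \<Omega> x * (S y * ?kk x y))"
    by (simp add: divergence_formula)
  also have "\<dots> = (LINT y|lebR n. LINT x|lebR n. indicat_real \<Omega> x * (S y * ?kk x y))"
    by (rule LL.Fubini_integral[OF int1, symmetric])
  also have "\<dots> = (LINT y|lebR n. LINT u|lebR n. S y * (kern n \<epsilon> u * S (vadd n y u)))"
    by (simp add: inner)
  also have "\<dots> = (LINT u|lebR n. LINT y|lebR n. S y * (kern n \<epsilon> u * S (vadd n y u)))"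
    by (rule LL.Fubini_integral[OF int3, symmetric])
  also have "\<dots> = (LINT u|lebR n. kern n \<epsilon> u * (LINT y|lebR n. S y * S (vadd n y u)))"
    by (simp add: mult.left_commute flip: integral_mult_right_zero)
  finally show ?thesis .
qed

end

lemma kern_scaled:
  assumes "\<epsilon> > 0" shows "\<epsilon> ^ n * kern n \<epsilon> (aff_map n (\<lambda>_. 0) \<epsilon> v) = kern n 1 v"
proof -
  have "kern n \<epsilon> (aff_map n (\<lambda>_. 0) \<epsilon> v) = (\<Prod>i<n. bump (v i) / \<epsilon>)"
    unfolding kern_def using assms by (intro prod.cong) (auto simp: aff_map_def)
  then show ?thesis
    using assms by (simp add: kern_def prod_dividef)
qed

text \<open>Boundedness of \<open>S\<close> reduces the claim to continuity of translations in
  L^1.\<close>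

lemma autocorrelation_tendsto:
  assumes S: "integrable (lebR n) S" and S_le: "\<And>y. \<bar>S y :: real\<bar> \<le> 1"
    and u: "\<And>i. i < n \<Longrightarrow> (\<lambda>k. u k i) \<longlonglongrightarrow> 0"
  shows "(\<lambda>k. LINT y|lebR n. S y * S (vadd n y (u k))) \<longlonglongrightarrow> (LINT y|lebR n. S y * S y)"
proof -
  interpret shift_sequence n u
    by standard (rule u)
  have Sv: "integrable (lebR n) (\<lambda>y. S (vadd n y a))" for a
    by (rule shift_integrable[OF S])
  have mult: "integrable (lebR n) (\<lambda>y. S y * f y)" if f: "integrable (lebR n) f" for f
  proof (rule Bochner_Integration.integrable_bound[OF f])
    show "AE y in lebR n. norm (S y * f y) \<le> norm (f y)"
      using S_le by (intro AE_I2) (simp add: abs_mult mult_left_le_one_le)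
  qed (use S f in auto)
  have lim: "(\<lambda>k. LINT y|lebR n. \<bar>S (vadd n y (u k)) - S y\<bar>) \<longlonglongrightarrow> 0"
    using shift_cont_L1[OF S] by (simp add: shift_cont_def)
  have "norm ((LINT y|lebR n. S y * S (vadd n y (u k))) - (LINT y|lebR n. S y * S y))
      \<le> (LINT y|lebR n. \<bar>S (vadd n y (u k)) - S y\<bar>)" for k
  proof -
    have "(LINT y|lebR n. S y * S (vadd n y (u k))) - (LINT y|lebR n. S y * S y)
        = (LINT y|lebR n. S y * (S (vadd n y (u k)) - S y))"
      using mult[OF Sv[of "u k"]] mult[OF S] by (simp add: right_diff_distrib)
    also have "norm \<dots> \<le> (LINT y|lebR n. norm (S y * (S (vadd n y (u k)) - S y)))"
      by (rule integral_norm_bound)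
    also have "\<dots> \<le> (LINT y|lebR n. \<bar>S (vadd n y (u k)) - S y\<bar>)"
      using S Sv[of "u k"] S_le
      by (intro integral_mono integrable_norm mult) (auto simp: abs_mult mult_left_le_one_le)
    finally show ?thesis .
  qed
  then have "(\<lambda>k. (LINT y|lebR n. S y * S (vadd n y (u k))) - (LINT y|lebR n. S y * S y)) \<longlonglongrightarrow> 0"
    by (intro Lim_null_comparison[OF _ lim]) simp
  then show ?thesis
    by (simp add: LIM_zero_iff)
qed

text \<open>For every scale the test field bounds the smoothed autocorrelation of \<open>S\<close>.
  As the scale tends to 0 the smoothing disappears, and the autocorrelation at the origin is the
  integral of S^2, which equals that of |S|.\<close>

theorem translation_le_perimeter:
  assumes fin: "finite_perimeter n \<Omega>" and \<Omega>: "\<Omega> \<subseteq> cube n r0"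
  shows "(LINT y|lebR n. \<bar>indicat_real \<Omega> y - indicat_real \<Omega> (vadd n y h)\<bar>) \<le> enorm n h * perimeter n \<Omega>"
proof (cases "enorm n h = 0")
  \<comment> \<open>Treated apart because the test field divides by
    \<open>enorm n h\<close>.\<close>
  case True
  then have h0: "h i = 0" if "i < n" for i
    using that by (simp add: L2_set_eq_0_iff)
  have "vadd n y h = y" if "y \<in> space (lebR n)" for y
    using that h0 by (auto simp: vadd_def space_lebR Rn_def PiE_iff extensional_def fun_eq_iff)
  then have "(LINT y|lebR n. \<bar>indicat_real \<Omega> y - indicat_real \<Omega> (vadd n y h)\<bar>) = (LINT y|lebR n. 0)"
    by (intro Bochner_Integration.integral_cong) auto
  then show ?thesis
    using True by simp
next
  case False
  then have H: "enorm n h > 0"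
    using L2_set_nonneg[of h "{..<n}"] by linarith
  have \<Omega>_int: "integrable (lebR n) (indicat_real \<Omega>)"
    using fin by (simp add: finite_perimeter_def)
  then have [measurable]: "indicat_real \<Omega> \<in> borel_measurable (lebR n)"
    by simp
  define S where "S y = indicat_real \<Omega> y - indicat_real \<Omega> (vadd n y h)" for y
  have S_int: "integrable (lebR n) S"
    unfolding S_def[abs_def] using \<Omega>_int integrable_vadd_iff[of "indicat_real \<Omega>" n h] by simp
  have S_le: "\<bar>S y\<bar> \<le> 1" for y
    by (simp add: S_def indicator_def)
  have S_meas [measurable]: "S \<in> borel_measurable (lebR n)"
    using S_int by simp
  define r where "r = r0 + (\<Sum>i<n. \<bar>h i\<bar>)"
  have S_supp: "y \<in> cube n r" if y: "y \<in> Rn n" "S y \<noteq> 0" for y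
  proof -
    have sum: "\<bar>h i\<bar> \<le> (\<Sum>i<n. \<bar>h i\<bar>)" if "i < n" for i
      using that by (intro member_le_sum) auto
    have "y \<in> cube n r0 \<or> vadd n y h \<in> cube n r0"
      using y(2) \<Omega> unfolding S_def by (cases "y \<in> \<Omega>"; cases "vadd n y h \<in> \<Omega>") auto
    then have "\<bar>y i\<bar> \<le> r" if "i < n" for i
    proof
      assume "y \<in> cube n r0"
      then have "\<bar>y i\<bar> \<le> r0"
        using that by (simp add: mem_cube)
      then show ?thesis
        using sum[OF that] unfolding r_def by linarith
    next
      assume "vadd n y h \<in> cube n r0"
      then have "\<bar>y i + h i\<bar> \<le> r0"
        using that by (auto simp: mem_cube vadd_def)
      then show ?thesis
        using sum[OF that] unfolding r_def by linarith
    qed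
    then show ?thesis
      using y(1) by (simp add: mem_cube)
  qed
  define B where "B u = (LINT y|lebR n. S y * S (vadd n y u))" for u
  have B_meas [measurable]: "B \<in> borel_measurable (lebR n)"
  proof -
    interpret sigma_finite_measure "lebR n"
      by (rule sigma_finite_lebR)
    have "(\<lambda>p. S (snd p) * S (vadd n (snd p) (fst p))) \<in> borel_measurable (lebR n \<Otimes>\<^sub>M lebR n)"
      by (intro borel_measurable_times measurable_compose[OF _ S_meas] measurable_vadd) auto
    then have "(\<lambda>(u, y). S y * S (vadd n y u)) \<in> borel_measurable (lebR n \<Otimes>\<^sub>M lebR n)"
      by (simp only: case_prod_unfold)
    then show ?thesis
      unfolding B_def[abs_def] by (rule borel_measurable_lebesgue_integral)
  qed
  have B_le: "\<bar>B u\<bar> \<le> (LINT y|lebR n. \<bar>S y\<bar>)" for u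
  proof -
    have Sv: "integrable (lebR n) (\<lambda>y. S y * S (vadd n y u))"
    proof (rule Bochner_Integration.integrable_bound[OF S_int])
      show "AE y in lebR n. norm (S y * S (vadd n y u)) \<le> norm (S y)"
        using S_le by (intro AE_I2) (simp add: abs_mult mult_right_le_one_le)
      show "(\<lambda>y. S y * S (vadd n y u)) \<in> borel_measurable (lebR n)"
        unfolding vadd_aff_map by measurable
    qed
    have "\<bar>B u\<bar> \<le> (LINT y|lebR n. norm (S y * S (vadd n y u)))"
      unfolding B_def real_norm_def[symmetric] by (rule integral_norm_bound)
    also have "\<dots> \<le> (LINT y|lebR n. \<bar>S y\<bar>)"
      using S_int Sv S_le
      by (intro integral_mono integrable_norm integrable_abs) (auto simp: abs_mult mult_right_le_one_le)
    finally show ?thesis .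
  qed
  have main: "(LINT u|lebR n. kern n \<epsilon> u * B u) \<le> enorm n h * perimeter n \<Omega>" if eps: "\<epsilon> > 0" for \<epsilon>
  proof -
    interpret mollified_set n \<epsilon> h S r \<Omega>
      by unfold_locales (use eps S_int S_le S_supp \<Omega>_int in \<open>auto simp: S_def\<close>)
    have "(LINT u|lebR n. kern n \<epsilon> u * B u) = (LINT x|lebR n. indicat_real \<Omega> x * (\<Sum>i<n. h i * \<Phi>' i x))"
      unfolding B_def by (rule integral_divergence[symmetric])
    also have "\<dots> = enorm n h * (LINT x|lebR n. indicat_real \<Omega> x * divergence n field x)"
      using H by (simp add: divergence_field[OF H])
    also have "\<dots> \<le> enorm n h * perimeter n \<Omega>"
      using H by (intro mult_left_mono perimeter_ge[OF fin field_test[OF H]]) auto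
    finally show ?thesis .
  qed
  have kern1: "integrable (lebR n) (kern n 1)" "(LINT v|lebR n. kern n 1 v) = 1"
    using nn_integral_kern[of 1 n] kern_nonneg[of 1 n]
    by (auto intro!: integrableI_nonneg simp: integral_eq_nn_integral)
  let ?e = "\<lambda>m::nat. inverse (real (Suc m))"
  \<comment> \<open>Dilation replaces the shrinking kernel by the fixed density
    \<open>kern n 1\<close> and moves the scale into the argument of \<open>B\<close>, so that
    dominated convergence applies.\<close>
  have scale: "(LINT u|lebR n. kern n (?e m) u * B u) = (LINT v|lebR n. kern n 1 v * B (aff_map n (\<lambda>_. 0) (?e m) v))" for m
  proof -
    have "(LINT u|lebR n. kern n (?e m) u * B u) =
      \<bar>?e m\<bar> ^ n *\<^sub>R (LINT v|lebR n. kern n (?e m) (aff_map n (\<lambda>_. 0) (?e m) v) * B (aff_map n (\<lambda>_. 0) (?e m) v))"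
      by (rule integral_aff_map) auto
    also have "\<dots> = (LINT v|lebR n. ?e m ^ n * kern n (?e m) (aff_map n (\<lambda>_. 0) (?e m) v) * B (aff_map n (\<lambda>_. 0) (?e m) v))"
      by (simp add: mult.assoc)
    also have "\<dots> = (LINT v|lebR n. kern n 1 v * B (aff_map n (\<lambda>_. 0) (?e m) v))"
      by (subst kern_scaled) auto
    finally show ?thesis .
  qed
  have "(\<lambda>m. LINT v|lebR n. kern n 1 v * B (aff_map n (\<lambda>_. 0) (?e m) v)) \<longlonglongrightarrow>
      (LINT v|lebR n. kern n 1 v * (LINT y|lebR n. S y * S y))"
  proof (rule integral_dominated_convergence[where w = "\<lambda>v. kern n 1 v * (LINT y|lebR n. \<bar>S y\<bar>)"])
    show "AE v in lebR n. (\<lambda>m. kern n 1 v * B (aff_map n (\<lambda>_. 0) (?e m) v)) \<longlonglongrightarrow>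
        kern n 1 v * (LINT y|lebR n. S y * S y)"
    proof (intro AE_I2 tendsto_mult tendsto_const)
      fix v
      show "(\<lambda>m. B (aff_map n (\<lambda>_. 0) (?e m) v)) \<longlonglongrightarrow> (LINT y|lebR n. S y * S y)"
        unfolding B_def
      proof (rule autocorrelation_tendsto[OF S_int S_le])
        fix i assume "i < n"
        then show "(\<lambda>m. aff_map n (\<lambda>_. 0) (?e m) v i) \<longlonglongrightarrow> 0"
          using tendsto_mult_left_zero[OF LIMSEQ_inverse_real_of_nat, of "v i"] by (simp add: aff_map_def)
      qed
    qed
    show "AE v in lebR n. norm (kern n 1 v * B (aff_map n (\<lambda>_. 0) (?e m) v)) \<le> kern n 1 v * (LINT y|lebR n. \<bar>S y\<bar>)" for m
      using B_le kern_nonneg[of 1 n] by (intro AE_I2) (simp add: abs_mult mult_left_mono)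
  qed (use kern1 in auto)
  also have "(LINT v|lebR n. kern n 1 v * (LINT y|lebR n. S y * S y)) = (LINT y|lebR n. S y * S y)"
    using kern1 by simp
  finally have lim: "(\<lambda>m. LINT v|lebR n. kern n 1 v * B (aff_map n (\<lambda>_. 0) (?e m) v)) \<longlonglongrightarrow>
      (LINT y|lebR n. S y * S y)" .
  have "(LINT v|lebR n. kern n 1 v * B (aff_map n (\<lambda>_. 0) (?e m) v)) \<le> enorm n h * perimeter n \<Omega>" for m
    unfolding scale[symmetric] by (rule main) simp
  then have "(LINT y|lebR n. S y * S y) \<le> enorm n h * perimeter n \<Omega>"
    by (intro LIMSEQ_le_const2[OF lim]) blast
  moreover have "S y * S y = \<bar>S y\<bar>" for y
    by (simp add: S_def indicator_def)
  ultimately show ?thesis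
    by (simp add: S_def)
qed

section \<open>Plancherel and Moyal\<close>

lemma cis_sum: "finite A \<Longrightarrow> cis (\<Sum>i\<in>A. f i) = (\<Prod>i\<in>A. cis (f i))"
  by (induction A rule: finite_induct) (auto simp: cis_mult[symmetric])

lemma integrable_gaussian_cis:
  assumes "\<sigma> > 0"
  shows "integrable lborel (\<lambda>x. complex_of_real (exp (- (\<sigma> * x)\<^sup>2 / 2)) * cis (b * x))"
proof (rule Bochner_Integration.integrable_bound)
  have "integrable lborel (\<lambda>x. std_normal_density (0 + \<sigma> * x))"
    using assms integrable_normal_density[of 1 0] by (intro lborel_integrable_real_affine) auto
  then have "integrable lborel (\<lambda>x. sqrt (2 * pi) * std_normal_density (0 + \<sigma> * x))"
    by (rule integrable_mult_right)
  then show "integrable lborel (\<lambda>x. exp (- (\<sigma> * x)\<^sup>2 / 2))"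
    by (simp add: std_normal_density_def)
  have [measurable]: "(\<lambda>x. cis (b * x)) \<in> borel_measurable borel"
    by (intro borel_measurable_continuous_onI continuous_intros)
  show "(\<lambda>x. complex_of_real (exp (- (\<sigma> * x)\<^sup>2 / 2)) * cis (b * x)) \<in> borel_measurable lborel"
    by (intro borel_measurable_times) simp_all
qed (auto simp: norm_mult)

text \<open>The characteristic function of the standard normal law at \<open>b / \<sigma>\<close>,
  after rescaling by \<sigma>.\<close>

lemma integral_gaussian_cis:
  assumes "\<sigma> > 0"
  shows "(CLINT x|lborel. complex_of_real (exp (- (\<sigma> * x)\<^sup>2 / 2)) * cis (b * x)) =
    complex_of_real (sqrt (2 * pi) / \<sigma> * exp (- (b / \<sigma>)\<^sup>2 / 2))"
proof -
  let ?I = "CLINT x|lborel. complex_of_real (exp (- (\<sigma> * x)\<^sup>2 / 2)) * cis (b * x)"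
  have "complex_of_real (exp (- (b / \<sigma>)\<^sup>2 / 2)) = char std_normal_distribution (b / \<sigma>)"
    by (simp add: char_std_normal_distribution)
  also have "\<dots> = (CLINT x|lborel. std_normal_density x *\<^sub>R iexp (b / \<sigma> * x))"
    unfolding char_def by (subst integral_density) auto
  also have "\<dots> = \<bar>\<sigma>\<bar> *\<^sub>R (CLINT x|lborel. std_normal_density (0 + \<sigma> * x) *\<^sub>R iexp (b / \<sigma> * (0 + \<sigma> * x)))"
    using assms by (intro lborel_integral_real_affine) auto
  also have "(CLINT x|lborel. std_normal_density (0 + \<sigma> * x) *\<^sub>R iexp (b / \<sigma> * (0 + \<sigma> * x))) =
      (CLINT x|lborel. complex_of_real (1 / sqrt (2 * pi)) * (complex_of_real (exp (- (\<sigma> * x)\<^sup>2 / 2)) * cis (b * x)))"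
    using assms by (intro Bochner_Integration.integral_cong refl)
      (simp add: std_normal_density_def scaleR_conv_of_real cis_conv_exp)
  also have "\<dots> = complex_of_real (1 / sqrt (2 * pi)) * ?I"
    by (rule integral_mult_right_zero)
  finally have "complex_of_real (exp (- (b / \<sigma>)\<^sup>2 / 2)) = complex_of_real (\<sigma> / sqrt (2 * pi)) * ?I"
    using assms by (simp add: scaleR_conv_of_real)
  then have "complex_of_real (sqrt (2 * pi) / \<sigma>) * complex_of_real (exp (- (b / \<sigma>)\<^sup>2 / 2)) =
      complex_of_real (sqrt (2 * pi) / \<sigma>) * complex_of_real (\<sigma> / sqrt (2 * pi)) * ?I"
    by (simp only: mult.assoc)
  also have "complex_of_real (sqrt (2 * pi) / \<sigma>) * complex_of_real (\<sigma> / sqrt (2 * pi)) = 1"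
    using assms by (simp flip: of_real_mult)
  finally show ?thesis
    by (simp only: of_real_mult mult_1_left)
qed

section \<open>Gaussian weights and their Fourier transforms\<close>

definition gauss_weight :: "nat \<Rightarrow> real \<Rightarrow> vec \<Rightarrow> real" where
  "gauss_weight d \<sigma> \<xi> = (\<Prod>i<d. exp (- (\<sigma> * \<xi> i)\<^sup>2 / 2))"

text \<open>The Fourier transform of \<open>gauss_weight\<close>, a Gaussian that concentrates at
  the origin as \<sigma> decreases.\<close>

definition gauss_dual :: "nat \<Rightarrow> real \<Rightarrow> vec \<Rightarrow> real" where
  "gauss_dual d \<sigma> u = (\<Prod>i<d. sqrt (2 * pi) / \<sigma> * exp (- (2 * pi * u i / \<sigma>)\<^sup>2 / 2))"

definition gauss_density :: "nat \<Rightarrow> vec \<Rightarrow> real" where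
  "gauss_density d v = (\<Prod>i<d. std_normal_density (v i))"

lemma gauss_weight_pos: "0 < gauss_weight d \<sigma> \<xi>"
  unfolding gauss_weight_def by (intro prod_pos) auto

lemma gauss_weight_antimono:
  assumes "0 \<le> \<sigma>" "\<sigma> \<le> \<tau>" shows "gauss_weight d \<tau> \<xi> \<le> gauss_weight d \<sigma> \<xi>"
  unfolding gauss_weight_def
proof (intro prod_mono conjI)
  fix i
  have "(\<sigma> * \<xi> i)\<^sup>2 \<le> (\<tau> * \<xi> i)\<^sup>2"
    unfolding power_mult_distrib using assms by (intro mult_right_mono power_mono) auto
  then show "exp (- (\<tau> * \<xi> i)\<^sup>2 / 2) \<le> exp (- (\<sigma> * \<xi> i)\<^sup>2 / 2)"
    by simp
qed simp

lemma gauss_weight_measurable [measurable]: "gauss_weight d \<sigma> \<in> borel_measurable (lebR d)"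
  unfolding gauss_weight_def[abs_def] by measurable

lemma gauss_dual_measurable [measurable]: "gauss_dual d \<sigma> \<in> borel_measurable (lebR d)"
  unfolding gauss_dual_def[abs_def] by measurable

lemma cis_dotp_measurable [measurable]:
  assumes "f \<in> measurable M (lebR d)" "g \<in> measurable M (lebR d)"
  shows "(\<lambda>x. cis (c * dotp d (f x) (g x))) \<in> borel_measurable M"
proof -
  have "(\<lambda>r. cis (c * r)) \<in> borel_measurable borel"
    by (intro borel_measurable_continuous_onI continuous_intros)
  from measurable_compose[OF measurable_dotp[OF assms] this] show ?thesis .
qed

lemma gauss_weight_cis:
  "complex_of_real (gauss_weight d \<sigma> \<xi>) * cis (- 2 * pi * dotp d \<xi> u) =
    (\<Prod>i<d. complex_of_real (exp (- (\<sigma> * \<xi> i)\<^sup>2 / 2)) * cis (- 2 * pi * u i * \<xi> i))"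
proof -
  have "- 2 * pi * dotp d \<xi> u = (\<Sum>i<d. - 2 * pi * u i * \<xi> i)"
    unfolding dotp_def sum_distrib_left by (intro sum.cong) auto
  then show ?thesis
    by (simp only: gauss_weight_def cis_sum finite_lessThan prod.distrib of_real_prod)
qed

lemma gauss_weight_transform:
  assumes "\<sigma> > 0"
  shows "(CLINT \<xi>|lebR d. complex_of_real (gauss_weight d \<sigma> \<xi>) * cis (- 2 * pi * dotp d \<xi> u)) =
    complex_of_real (gauss_dual d \<sigma> u)"
proof -
  have "(CLINT \<xi>|lebR d. complex_of_real (gauss_weight d \<sigma> \<xi>) * cis (- 2 * pi * dotp d \<xi> u)) =
    (\<Prod>i<d. CLINT x|lborel. complex_of_real (exp (- (\<sigma> * x)\<^sup>2 / 2)) * cis (- 2 * pi * u i * x))"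
    unfolding gauss_weight_cis lebR_def
    by (intro lborel_product.product_integral_prod finite_lessThan integrable_gaussian_cis assms)
  also have "\<dots> = (\<Prod>i<d. complex_of_real (sqrt (2 * pi) / \<sigma> * exp (- (- 2 * pi * u i / \<sigma>)\<^sup>2 / 2)))"
    using assms by (simp only: integral_gaussian_cis)
  finally show ?thesis
    by (simp add: gauss_dual_def)
qed

lemma gauss_weight_integrable:
  assumes "\<sigma> > 0" shows "integrable (lebR d) (gauss_weight d \<sigma>)"
proof -
  have "integrable lborel (\<lambda>x. exp (- (\<sigma> * x)\<^sup>2 / 2))"
    using integrable_norm[OF integrable_gaussian_cis[OF assms, of 0]] by (simp add: norm_mult)
  then show ?thesis
    unfolding gauss_weight_def[abs_def] lebR_def by (intro lborel_product.product_integrable_prod) auto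
qed

lemma gauss_density_nonneg: "0 \<le> gauss_density d v"
  unfolding gauss_density_def by (intro prod_nonneg) simp

lemma gauss_density_integrable: "integrable (lebR d) (gauss_density d)"
  unfolding gauss_density_def[abs_def] lebR_def
  by (intro lborel_product.product_integrable_prod) (auto intro: integrable_normal_density)

lemma integral_gauss_density: "(LINT v|lebR d. gauss_density d v) = 1"
  unfolding gauss_density_def[abs_def] lebR_def
  by (subst lborel_product.product_integral_prod) (auto intro: integrable_normal_density)

text \<open>A dilation by \<open>\<sigma> / (2 * pi)\<close> turns all these Gaussians into one
  normal density. The limit in \<sigma> then takes place in the argument of the correlation
  only.\<close>

lemma gauss_dual_scaled:
  assumes "\<sigma> > 0"
  shows "(\<sigma> / (2 * pi)) ^ d * gauss_dual d \<sigma> (aff_map d (\<lambda>_. 0) (\<sigma> / (2 * pi)) v) = gauss_density d v"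
proof -
  have "(\<sigma> / (2 * pi)) ^ d * gauss_dual d \<sigma> (aff_map d (\<lambda>_. 0) (\<sigma> / (2 * pi)) v) =
    (\<Prod>i<d. \<sigma> / (2 * pi) * (sqrt (2 * pi) / \<sigma> * exp (- (v i)\<^sup>2 / 2)))"
    unfolding gauss_dual_def prod.distrib[of "\<lambda>_. \<sigma> / (2 * pi)"] using assms
    by (auto simp: aff_map_def intro!: prod.cong)
  also have "\<dots> = gauss_density d v"
    unfolding gauss_density_def
  proof (rule prod.cong[OF refl])
    fix i
    have "2 * pi = sqrt (2 * pi) * sqrt (2 * pi)"
      by simp
    then have "\<sigma> / (2 * pi) * (sqrt (2 * pi) / \<sigma>) = 1 / sqrt (2 * pi)"
      using assms by (simp add: divide_simps)
    then show "\<sigma> / (2 * pi) * (sqrt (2 * pi) / \<sigma> * exp (- (v i)\<^sup>2 / 2)) = std_normal_density (v i)"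
      unfolding std_normal_density_def by (simp only: mult.assoc[symmetric])
  qed
  finally show ?thesis .
qed

section \<open>Plancherel's formula for integrable, square-integrable functions\<close>

definition fourier :: "nat \<Rightarrow> (vec \<Rightarrow> complex) \<Rightarrow> vec \<Rightarrow> complex" where
  "fourier d F \<xi> = (CLINT t|lebR d. F t * cis (- 2 * pi * dotp d \<xi> t))"

text \<open>Integrability makes the transform a genuine integral and permits Fubini; square
  integrability makes the autocorrelation bounded and continuous at 0.\<close>

locale L1_L2 =
  fixes d :: nat and F :: "vec \<Rightarrow> complex"
  assumes F_int: "integrable (lebR d) F" and F_sq: "F \<in> sq_int (lebR d)"
begin

sublocale L: sigma_finite_measure "lebR d"
  by (rule sigma_finite_lebR)

sublocale LL: pair_sigma_finite "lebR d" "lebR d"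
  by standard

lemma F_meas [measurable]: "F \<in> borel_measurable (lebR d)"
  using F_int by simp

definition corr :: "vec \<Rightarrow> complex" where
  "corr u = (CLINT s|lebR d. F (vadd d s u) * cnj (F s))"

lemma corr_int: "integrable (lebR d \<Otimes>\<^sub>M lebR d) (\<lambda>(s, u). F (vadd d s u) * cnj (F s))"
proof (rule LL.Fubini_integrable)
  have "(\<lambda>p. F (vadd d (fst p) (snd p)) * cnj (F (fst p))) \<in> borel_measurable (lebR d \<Otimes>\<^sub>M lebR d)"
    by (intro borel_measurable_times borel_measurable_cnj measurable_compose[OF _ F_meas] measurable_vadd) auto
  then show "(\<lambda>(s, u). F (vadd d s u) * cnj (F s)) \<in> borel_measurable (lebR d \<Otimes>\<^sub>M lebR d)"
    by (simp only: case_prod_unfold)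
  have comm: "vadd d s u = vadd d u s" for s u
    by (simp add: vadd_def add.commute)
  have 1: "integrable (lebR d) (\<lambda>u. F (vadd d s u))" for s
    unfolding comm[of s] using F_int integrable_vadd_iff[of F d s] by simp
  then show "AE s in lebR d. integrable (lebR d) (\<lambda>u. case (s, u) of (s, u) \<Rightarrow> F (vadd d s u) * cnj (F s))"
    by simp
  have "(LINT u|lebR d. norm (F (vadd d s u) * cnj (F s))) = (LINT t|lebR d. norm (F t)) * norm (F s)" for s
    unfolding comm[of s] norm_mult using integral_vadd[of "\<lambda>t. norm (F t)" d s] by simp
  then show "integrable (lebR d) (\<lambda>s. LINT u|lebR d. norm (case (s, u) of (s, u) \<Rightarrow> F (vadd d s u) * cnj (F s)))"
    using F_int by simp
qed

lemma corr_integrable: "integrable (lebR d) corr"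
  using LL.integrable_snd[OF corr_int] by (simp add: corr_def[abs_def])

lemma corr_measurable [measurable]: "corr \<in> borel_measurable (lebR d)"
  using corr_integrable by simp

lemma dotp_vadd: "dotp d \<xi> (vadd d s u) = dotp d \<xi> s + dotp d \<xi> u"
  by (simp add: dotp_def vadd_def distrib_left sum.distrib)

text \<open>In the product of the conjugate integral over s with the integral over t, substitute t =
  s + u: the combined phase depends on u alone, and the integral over s is the
  autocorrelation.\<close>

lemma fourier_norm_square:
  assumes "\<xi> \<in> Rn d"
  shows "complex_of_real ((cmod (fourier d F \<xi>))\<^sup>2) = (CLINT u|lebR d. corr u * cis (- 2 * pi * dotp d \<xi> u))"
proof -
  have [simp]: "\<xi> \<in> space (lebR d)"
    using assms by (simp add: space_lebR)
  have int: "integrable (lebR d \<Otimes>\<^sub>M lebR d)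
      (\<lambda>(s, u). F (vadd d s u) * cnj (F s) * cis (- 2 * pi * dotp d \<xi> u))"
  proof (rule Bochner_Integration.integrable_bound[OF corr_int])
    have "(\<lambda>p. F (vadd d (fst p) (snd p)) * cnj (F (fst p)) * cis (- 2 * pi * dotp d \<xi> (snd p))) \<in>
        borel_measurable (lebR d \<Otimes>\<^sub>M lebR d)"
      by (intro borel_measurable_times borel_measurable_cnj measurable_compose[OF _ F_meas] measurable_vadd
        cis_dotp_measurable) auto
    then show "(\<lambda>(s, u). F (vadd d s u) * cnj (F s) * cis (- 2 * pi * dotp d \<xi> u)) \<in>
        borel_measurable (lebR d \<Otimes>\<^sub>M lebR d)"
      by (simp only: case_prod_unfold)
  qed (auto simp: norm_mult)
  have inner: "cnj (F s) * cis (2 * pi * dotp d \<xi> s) * fourier d F \<xi> =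
      (CLINT u|lebR d. F (vadd d s u) * cnj (F s) * cis (- 2 * pi * dotp d \<xi> u))" for s
  proof -
    have comm: "vadd d u s = vadd d s u" for u
      by (simp add: vadd_def add.commute)
    have "fourier d F \<xi> = (CLINT u|lebR d. F (vadd d u s) * cis (- 2 * pi * dotp d \<xi> (vadd d u s)))"
      unfolding fourier_def by (rule integral_vadd[symmetric]) measurable
    then have "cnj (F s) * cis (2 * pi * dotp d \<xi> s) * fourier d F \<xi> = (CLINT u|lebR d.
        cnj (F s) * cis (2 * pi * dotp d \<xi> s) * (F (vadd d u s) * cis (- 2 * pi * dotp d \<xi> (vadd d u s))))"
      unfolding integral_mult_right_zero by (rule arg_cong)
    also have "\<dots> = (CLINT u|lebR d. F (vadd d s u) * cnj (F s) * cis (- 2 * pi * dotp d \<xi> u))"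
    proof (intro Bochner_Integration.integral_cong refl)
      fix u
      have eq: "cis (2 * pi * dotp d \<xi> s) * cis (- 2 * pi * dotp d \<xi> (vadd d u s)) = cis (- 2 * pi * dotp d \<xi> u)"
        by (simp add: cis_mult dotp_vadd algebra_simps)
      have "cnj (F s) * cis (2 * pi * dotp d \<xi> s) * (F (vadd d u s) * cis (- 2 * pi * dotp d \<xi> (vadd d u s)))
          = F (vadd d u s) * cnj (F s) * (cis (2 * pi * dotp d \<xi> s) * cis (- 2 * pi * dotp d \<xi> (vadd d u s)))"
        by (simp only: mult_ac)
      from this[unfolded eq, unfolded comm[of u]]
      show "cnj (F s) * cis (2 * pi * dotp d \<xi> s) * (F (vadd d u s) * cis (- 2 * pi * dotp d \<xi> (vadd d u s)))
          = F (vadd d s u) * cnj (F s) * cis (- 2 * pi * dotp d \<xi> u)"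
        unfolding comm[of u] .
    qed
    finally show ?thesis .
  qed
  have "complex_of_real ((cmod (fourier d F \<xi>))\<^sup>2) = cnj (fourier d F \<xi>) * fourier d F \<xi>"
    using complex_norm_square[of "fourier d F \<xi>"] by (simp only: mult.commute of_real_power)
  also have "cnj (fourier d F \<xi>) = (CLINT s|lebR d. cnj (F s) * cis (2 * pi * dotp d \<xi> s))"
  proof -
    have "cnj (fourier d F \<xi>) = (CLINT s|lebR d. cnj (F s * cis (- 2 * pi * dotp d \<xi> s)))"
      by (simp only: fourier_def Bochner_Integration.integral_cnj)
    also have "\<dots> = (CLINT s|lebR d. cnj (F s) * cis (2 * pi * dotp d \<xi> s))"
      by (intro Bochner_Integration.integral_cong refl) (simp add: cis_cnj)
    finally show ?thesis .
  qed
  also have "\<dots> * fourier d F \<xi> = (CLINT s|lebR d. cnj (F s) * cis (2 * pi * dotp d \<xi> s) * fourier d F \<xi>)"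
    by simp
  also have "\<dots> = (CLINT s|lebR d. CLINT u|lebR d. F (vadd d s u) * cnj (F s) * cis (- 2 * pi * dotp d \<xi> u))"
    by (simp only: inner)
  also have "\<dots> = (CLINT u|lebR d. CLINT s|lebR d. F (vadd d s u) * cnj (F s) * cis (- 2 * pi * dotp d \<xi> u))"
    by (rule LL.Fubini_integral[OF int, symmetric])
  also have "\<dots> = (CLINT u|lebR d. corr u * cis (- 2 * pi * dotp d \<xi> u))"
    by (simp add: corr_def)
  finally show ?thesis .
qed

lemma corr_eq_ip: "corr u = ip (lebR d) (\<lambda>s. F (vadd d s u)) F"
  by (simp add: corr_def ip_def)

lemma shifted_sq: "(\<lambda>s. F (vadd d s u)) \<in> sq_int (lebR d)"
  using F_sq integrable_vadd_iff[of "\<lambda>t. (cmod (F t))\<^sup>2" d u] by (auto simp: sq_int_def vadd_aff_map)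

lemma sq_norm_shifted: "sq_norm (lebR d) (\<lambda>s. F (vadd d s u)) = sq_norm (lebR d) F"
  unfolding sq_norm_def by (rule integral_vadd) measurable

lemma corr_le: "cmod (corr u) \<le> sq_norm (lebR d) F"
proof (rule power2_le_imp_le)
  show "(cmod (corr u))\<^sup>2 \<le> (sq_norm (lebR d) F)\<^sup>2"
    using ip_Cauchy_Schwarz[OF shifted_sq F_sq, of u]
    by (simp add: corr_eq_ip sq_norm_shifted power2_eq_square)
qed simp

text \<open>Cauchy-Schwarz reduces this to continuity of translations in L^2.\<close>

lemma corr_tendsto:
  assumes u: "\<And>i. i < d \<Longrightarrow> (\<lambda>k. u k i) \<longlonglongrightarrow> 0"
  shows "(\<lambda>k. corr (u k)) \<longlonglongrightarrow> complex_of_real (sq_norm (lebR d) F)"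
proof -
  interpret shift_sequence d u
    by standard (rule u)
  let ?D = "\<lambda>k s. F (vadd d s (u k)) - F s"
  have D: "?D k \<in> sq_int (lebR d)" for k
    by (intro sq_int_diff shifted_sq F_sq)
  have bound: "cmod (corr (u k) - complex_of_real (sq_norm (lebR d) F)) \<le> sqrt (sq_norm (lebR d) (?D k) * sq_norm (lebR d) F)" for k
  proof (rule real_le_rsqrt)
    have "corr (u k) - complex_of_real (sq_norm (lebR d) F) = ip (lebR d) (?D k) F"
      using ip_diff_left[OF shifted_sq F_sq F_sq, of "u k"] by (simp add: corr_eq_ip ip_self)
    then show "(cmod (corr (u k) - complex_of_real (sq_norm (lebR d) F)))\<^sup>2 \<le> sq_norm (lebR d) (?D k) * sq_norm (lebR d) F"
      using ip_Cauchy_Schwarz[OF D F_sq, of k] by simp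
  qed
  have lim: "(\<lambda>k. sqrt (sq_norm (lebR d) (?D k) * sq_norm (lebR d) F)) \<longlonglongrightarrow> 0"
    using tendsto_real_sqrt[OF tendsto_mult_left_zero[OF shift_L2[OF F_sq]]] by simp
  have "(\<lambda>k. corr (u k) - complex_of_real (sq_norm (lebR d) F)) \<longlonglongrightarrow> 0"
    by (rule Lim_null_comparison[OF always_eventually lim]) (intro allI bound)
  then show ?thesis
    by (simp add: LIM_zero_iff)
qed

lemma fourier_measurable [measurable]: "fourier d F \<in> borel_measurable (lebR d)"
proof -
  have "(\<lambda>p. F (snd p) * cis (- 2 * pi * dotp d (fst p) (snd p))) \<in> borel_measurable (lebR d \<Otimes>\<^sub>M lebR d)"
    by (intro borel_measurable_times cis_dotp_measurable measurable_compose[OF _ F_meas]) auto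
  then have "(\<lambda>(\<xi>, t). F t * cis (- 2 * pi * dotp d \<xi> t)) \<in> borel_measurable (lebR d \<Otimes>\<^sub>M lebR d)"
    by (simp only: case_prod_unfold)
  then show ?thesis
    unfolding fourier_def[abs_def] by (rule L.borel_measurable_lebesgue_integral)
qed

lemma cmod_fourier_le: "cmod (fourier d F \<xi>) \<le> (LINT t|lebR d. cmod (F t))"
proof -
  have "cmod (fourier d F \<xi>) \<le> (LINT t|lebR d. norm (F t * cis (- 2 * pi * dotp d \<xi> t)))"
    unfolding fourier_def by (rule integral_norm_bound)
  then show ?thesis
    by (simp add: norm_mult)
qed

lemma weighted_int:
  assumes "\<sigma> > 0"
  shows "integrable (lebR d) (\<lambda>\<xi>. gauss_weight d \<sigma> \<xi> * (cmod (fourier d F \<xi>))\<^sup>2)"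
proof (rule Bochner_Integration.integrable_bound)
  show "integrable (lebR d) (\<lambda>\<xi>. gauss_weight d \<sigma> \<xi> * (LINT t|lebR d. cmod (F t))\<^sup>2)"
    using gauss_weight_integrable[OF assms] by simp
  show "AE \<xi> in lebR d. norm (gauss_weight d \<sigma> \<xi> * (cmod (fourier d F \<xi>))\<^sup>2)
      \<le> norm (gauss_weight d \<sigma> \<xi> * (LINT t|lebR d. cmod (F t))\<^sup>2)"
  proof (rule AE_I2)
    fix \<xi>
    have "(cmod (fourier d F \<xi>))\<^sup>2 \<le> (LINT t|lebR d. cmod (F t))\<^sup>2"
      by (rule power_mono[OF cmod_fourier_le]) simp
    from mult_left_mono[OF this less_imp_le[OF gauss_weight_pos]]
    show "norm (gauss_weight d \<sigma> \<xi> * (cmod (fourier d F \<xi>))\<^sup>2) \<le> norm (gauss_weight d \<sigma> \<xi> * (LINT t|lebR d. cmod (F t))\<^sup>2)"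
      using gauss_weight_pos[of d \<sigma> \<xi>] by (simp add: abs_mult)
  qed
qed measurable

text \<open>The weight makes the double integral absolutely convergent, and Fubini moves the
  transform from the autocorrelation to the Gaussian.\<close>

lemma weighted_integral:
  assumes "\<sigma> > 0"
  shows "complex_of_real (LINT \<xi>|lebR d. gauss_weight d \<sigma> \<xi> * (cmod (fourier d F \<xi>))\<^sup>2) =
    (CLINT v|lebR d. complex_of_real (gauss_density d v) * corr (aff_map d (\<lambda>_. 0) (\<sigma> / (2 * pi)) v))"
proof -
  let ?c = "\<lambda>\<xi> u. cis (- 2 * pi * dotp d \<xi> u)"
  have w_int: "integrable (lebR d) (\<lambda>\<xi>. norm (gauss_weight d \<sigma> \<xi>))"
    using gauss_weight_integrable[OF assms] by simp
  have int: "integrable (lebR d \<Otimes>\<^sub>M lebR d) (\<lambda>(\<xi>, u). complex_of_real (gauss_weight d \<sigma> \<xi>) * (corr u * ?c \<xi> u))"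
  proof (rule Bochner_Integration.integrable_bound[OF LL.integrable_pair_mult[OF w_int integrable_norm[OF corr_integrable]]])
    have "(\<lambda>p. complex_of_real (gauss_weight d \<sigma> (fst p)) * (corr (snd p) * ?c (fst p) (snd p)))
        \<in> borel_measurable (lebR d \<Otimes>\<^sub>M lebR d)"
      by (intro borel_measurable_times cis_dotp_measurable measurable_compose[OF _ corr_measurable]
        borel_measurable_of_real measurable_compose[OF _ gauss_weight_measurable]) auto
    then show "(\<lambda>(\<xi>, u). complex_of_real (gauss_weight d \<sigma> \<xi>) * (corr u * ?c \<xi> u)) \<in> borel_measurable (lebR d \<Otimes>\<^sub>M lebR d)"
      by (simp only: case_prod_unfold)
  qed (auto simp: norm_mult)
  have "complex_of_real (LINT \<xi>|lebR d. gauss_weight d \<sigma> \<xi> * (cmod (fourier d F \<xi>))\<^sup>2) =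
      (CLINT \<xi>|lebR d. complex_of_real (gauss_weight d \<sigma> \<xi>) * complex_of_real ((cmod (fourier d F \<xi>))\<^sup>2))"
    by (simp flip: integral_complex_of_real)
  also have "\<dots> = (CLINT \<xi>|lebR d. CLINT u|lebR d. complex_of_real (gauss_weight d \<sigma> \<xi>) * (corr u * ?c \<xi> u))"
    by (intro Bochner_Integration.integral_cong refl)
      (simp only: fourier_norm_square space_lebR integral_mult_right_zero)
  also have "\<dots> = (CLINT u|lebR d. CLINT \<xi>|lebR d. complex_of_real (gauss_weight d \<sigma> \<xi>) * (corr u * ?c \<xi> u))"
    by (rule LL.Fubini_integral[OF int, symmetric])
  also have "\<dots> = (CLINT u|lebR d. corr u * (CLINT \<xi>|lebR d. complex_of_real (gauss_weight d \<sigma> \<xi>) * ?c \<xi> u))"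
    by (simp only: mult.left_commute[of "complex_of_real _" "corr _"] integral_mult_right_zero)
  also have "\<dots> = (CLINT u|lebR d. corr u * complex_of_real (gauss_dual d \<sigma> u))"
    by (simp only: gauss_weight_transform[OF assms])
  also have "\<dots> = \<bar>\<sigma> / (2 * pi)\<bar> ^ d *\<^sub>R (CLINT v|lebR d. corr (aff_map d (\<lambda>_. 0) (\<sigma> / (2 * pi)) v) *
      complex_of_real (gauss_dual d \<sigma> (aff_map d (\<lambda>_. 0) (\<sigma> / (2 * pi)) v)))"
    using assms by (intro integral_aff_map) auto
  also have "\<dots> = (CLINT v|lebR d. complex_of_real ((\<sigma> / (2 * pi)) ^ d * gauss_dual d \<sigma> (aff_map d (\<lambda>_. 0) (\<sigma> / (2 * pi)) v))
      * corr (aff_map d (\<lambda>_. 0) (\<sigma> / (2 * pi)) v))"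
    unfolding scaleR_conv_of_real integral_mult_right_zero[symmetric]
    using assms by (intro Bochner_Integration.integral_cong refl) simp
  also have "\<dots> = (CLINT v|lebR d. complex_of_real (gauss_density d v) * corr (aff_map d (\<lambda>_. 0) (\<sigma> / (2 * pi)) v))"
    by (simp only: gauss_dual_scaled[OF assms])
  finally show ?thesis .
qed

text \<open>As the weights increase to 1, monotone convergence gives the full integral on one side.
  On the other side the normal density averages \<open>corr\<close> over arguments that shrink to 0,
  where its value is the squared norm. The nonnegative integral includes finiteness in the
  claim.\<close>

theorem plancherel:
  "(\<integral>\<^sup>+\<xi>. ennreal ((cmod (fourier d F \<xi>))\<^sup>2) \<partial>lebR d) = ennreal (sq_norm (lebR d) F)"
proof -
  let ?s = "\<lambda>m::nat. inverse (real (Suc m))"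
  let ?J = "\<lambda>m. LINT \<xi>|lebR d. gauss_weight d (?s m) \<xi> * (cmod (fourier d F \<xi>))\<^sup>2"
  have "(\<lambda>m. CLINT v|lebR d. complex_of_real (gauss_density d v) * corr (aff_map d (\<lambda>_. 0) (?s m / (2 * pi)) v))
      \<longlonglongrightarrow> (CLINT v|lebR d. complex_of_real (gauss_density d v) * complex_of_real (sq_norm (lebR d) F))"
  proof (rule integral_dominated_convergence[where w = "\<lambda>v. gauss_density d v * sq_norm (lebR d) F"])
    show "AE v in lebR d. (\<lambda>m. complex_of_real (gauss_density d v) * corr (aff_map d (\<lambda>_. 0) (?s m / (2 * pi)) v))
        \<longlonglongrightarrow> complex_of_real (gauss_density d v) * complex_of_real (sq_norm (lebR d) F)"
    proof (intro AE_I2 tendsto_mult tendsto_const corr_tendsto)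
      fix v i assume "i < d"
      then show "(\<lambda>m. aff_map d (\<lambda>_. 0) (?s m / (2 * pi)) v i) \<longlonglongrightarrow> 0"
        using tendsto_mult_left_zero[OF LIMSEQ_inverse_real_of_nat, of "v i / (2 * pi)"] by (simp add: aff_map_def)
    qed
    show "AE v in lebR d. norm (complex_of_real (gauss_density d v) * corr (aff_map d (\<lambda>_. 0) (?s m / (2 * pi)) v))
        \<le> gauss_density d v * sq_norm (lebR d) F" for m
      using corr_le gauss_density_nonneg by (intro AE_I2) (simp add: norm_mult mult_left_mono)
    have [measurable]: "gauss_density d \<in> borel_measurable (lebR d)"
      using gauss_density_integrable by simp
    show "(\<lambda>v. complex_of_real (gauss_density d v) * complex_of_real (sq_norm (lebR d) F)) \<in> borel_measurable (lebR d)"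
      "(\<lambda>v. complex_of_real (gauss_density d v) * corr (aff_map d (\<lambda>_. 0) (?s m / (2 * pi)) v)) \<in> borel_measurable (lebR d)" for m
      by measurable
  qed (use gauss_density_integrable in auto)
  moreover have "(CLINT v|lebR d. complex_of_real (gauss_density d v) * complex_of_real (sq_norm (lebR d) F)) =
      complex_of_real (sq_norm (lebR d) F)"
    by (simp add: integral_gauss_density)
  moreover have "(CLINT v|lebR d. complex_of_real (gauss_density d v) * corr (aff_map d (\<lambda>_. 0) (?s m / (2 * pi)) v)) =
      complex_of_real (?J m)" for m
    by (rule weighted_integral[symmetric]) simp
  ultimately have "(\<lambda>m. complex_of_real (?J m)) \<longlonglongrightarrow> complex_of_real (sq_norm (lebR d) F)"
    by (simp only:)
  then have J: "?J \<longlonglongrightarrow> sq_norm (lebR d) F"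
    by (simp only: tendsto_of_real_iff)
  have eq: "ennreal (?J m) = (\<integral>\<^sup>+\<xi>. ennreal (gauss_weight d (?s m) \<xi> * (cmod (fourier d F \<xi>))\<^sup>2) \<partial>lebR d)" for m
    using weighted_int[of "?s m"] gauss_weight_pos[of d "?s m", THEN less_imp_le]
    by (intro nn_integral_eq_integral[symmetric]) auto
  have "(\<lambda>m. \<integral>\<^sup>+\<xi>. ennreal (gauss_weight d (?s m) \<xi> * (cmod (fourier d F \<xi>))\<^sup>2) \<partial>lebR d)
      \<longlonglongrightarrow> (\<integral>\<^sup>+\<xi>. ennreal ((cmod (fourier d F \<xi>))\<^sup>2) \<partial>lebR d)"
  proof (rule nn_integral_LIMSEQ)
    show "incseq (\<lambda>m \<xi>. ennreal (gauss_weight d (?s m) \<xi> * (cmod (fourier d F \<xi>))\<^sup>2))"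
      by (intro incseq_SucI le_funI ennreal_leI mult_right_mono gauss_weight_antimono) (auto simp: field_simps)
    show "(\<lambda>m. ennreal (gauss_weight d (?s m) \<xi> * (cmod (fourier d F \<xi>))\<^sup>2)) \<longlonglongrightarrow> ennreal ((cmod (fourier d F \<xi>))\<^sup>2)" for \<xi>
    proof -
      have "(\<lambda>m. gauss_weight d (?s m) \<xi>) \<longlonglongrightarrow> (\<Prod>i<d. exp (- (0 * \<xi> i)\<^sup>2 / 2))"
        unfolding gauss_weight_def by (intro tendsto_intros LIMSEQ_inverse_real_of_nat) auto
      then have "(\<lambda>m. gauss_weight d (?s m) \<xi>) \<longlonglongrightarrow> 1"
        by simp
      from tendsto_mult[OF this tendsto_const[of "(cmod (fourier d F \<xi>))\<^sup>2"]] show ?thesis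
        by (intro tendsto_ennrealI) simp
    qed
  qed measurable
  moreover have "(\<lambda>m. ennreal (?J m)) \<longlonglongrightarrow> ennreal (sq_norm (lebR d) F)"
    by (intro tendsto_ennrealI J)
  ultimately show ?thesis
    unfolding eq by (rule LIMSEQ_unique)
qed

end

section \<open>The short-time Fourier transform and Moyal's identity\<close>

lemma L2_eq_sq_int: "L2 d = sq_int (lebR d)"
  by (simp add: L2_def sq_int_def)

lemma L2_inner_eq_ip: "L2_inner d f g = ip (lebR d) f g"
  by (simp add: L2_inner_def ip_def)

lemma L2_norm_eq_sq_norm: "L2_norm d f = sqrt (sq_norm (lebR d) f)"
  by (simp add: L2_norm_def sq_norm_def)

lemma nn_integral_norm_square:
  "f \<in> sq_int M \<Longrightarrow> (\<integral>\<^sup>+t. ennreal ((cmod (f t))\<^sup>2) \<partial>M) = ennreal (sq_norm M f)"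
  unfolding sq_norm_def by (rule nn_integral_eq_integral) (auto simp: sq_int_integrable)

text \<open>The time-frequency shift of \<open>g\<close>, usually written \<pi>(z) g. It turns the
  transform into a family of inner products, as \<open>vector_family\<close> requires.\<close>

definition tf_shift :: "nat \<Rightarrow> (vec \<Rightarrow> complex) \<Rightarrow> vec \<Rightarrow> vec \<Rightarrow> complex" where
  "tf_shift d g z t = g (vdiff d t (pos d z)) * cis (2 * pi * dotp d (freq d z) t)"

lemma stft_eq_ip: "stft d g f z = ip (lebR d) f (tf_shift d g z)"
  by (simp add: stft_def ip_def tf_shift_def cis_cnj mult.assoc)

context
  fixes d :: nat and g :: "vec \<Rightarrow> complex"
  assumes g_sq: "g \<in> sq_int (lebR d)"
begin

lemma g_meas [measurable]: "g \<in> borel_measurable (lebR d)"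
  using g_sq by (rule sq_int_measurable)

lemma shift_sq_int: "(\<lambda>t. g (vdiff d t x)) \<in> sq_int (lebR d)"
  using g_sq integrable_vdiff_iff[of "\<lambda>t. (cmod (g t))\<^sup>2" d x]
  by (auto simp: sq_int_def vdiff_aff_map)

lemma tf_shift_measurable:
  "(\<lambda>(z, t). tf_shift d g z t) \<in> borel_measurable (lebR (2 * d) \<Otimes>\<^sub>M lebR d)"
proof -
  have "(\<lambda>p. g (vdiff d (snd p) (pos d (fst p))) * cis (2 * pi * dotp d (freq d (fst p)) (snd p)))
      \<in> borel_measurable (lebR (2 * d) \<Otimes>\<^sub>M lebR d)"
    by (intro borel_measurable_times measurable_compose[OF _ g_meas] measurable_vdiff cis_dotp_measurable
      measurable_compose[OF _ measurable_pos] measurable_compose[OF _ measurable_freq]) auto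
  then show ?thesis
    by (simp only: tf_shift_def case_prod_unfold)
qed

lemma freq_in_Rn: "freq d z \<in> Rn d"
  by (simp add: freq_def Rn_def)

lemma tf_shift_sq_int: "tf_shift d g z \<in> sq_int (lebR d)"
proof -
  have "freq d z \<in> space (lebR d)"
    by (simp add: space_lebR freq_in_Rn)
  then have "(\<lambda>t. cis (2 * pi * dotp d (freq d z) t)) \<in> borel_measurable (lebR d)"
    by (intro cis_dotp_measurable) auto
  then show ?thesis
    using shift_sq_int[of "pos d z"] by (auto simp: sq_int_def tf_shift_def[abs_def] norm_mult)
qed

lemma sq_norm_tf_shift: "sq_norm (lebR d) (tf_shift d g z) = sq_norm (lebR d) g"
proof -
  have "sq_norm (lebR d) (tf_shift d g z) = (LINT t|lebR d. (cmod (g (vdiff d t (pos d z))))\<^sup>2)"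
    by (simp add: sq_norm_def tf_shift_def norm_mult)
  also have "\<dots> = sq_norm (lebR d) g"
    unfolding sq_norm_def by (rule integral_vdiff) measurable
  finally show ?thesis .
qed

lemma stft_measurable:
  assumes f: "f \<in> sq_int (lebR d)"
  shows "stft d g f \<in> borel_measurable (lebR (2 * d))"
proof -
  interpret sigma_finite_measure "lebR d"
    by (rule sigma_finite_lebR)
  have "(\<lambda>p. f (snd p) * cnj (tf_shift d g (fst p) (snd p))) \<in> borel_measurable (lebR (2 * d) \<Otimes>\<^sub>M lebR d)"
    using tf_shift_measurable
    by (intro borel_measurable_times borel_measurable_cnj measurable_compose[OF _ sq_int_measurable[OF f]])
      (auto simp: case_prod_unfold)
  then have "(\<lambda>(z, t). f t * cnj (tf_shift d g z t)) \<in> borel_measurable (lebR (2 * d) \<Otimes>\<^sub>M lebR d)"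
    by (simp only: case_prod_unfold)
  then have "(\<lambda>z. LINT t|lebR d. f t * cnj (tf_shift d g z t)) \<in> borel_measurable (lebR (2 * d))"
    by (rule borel_measurable_lebesgue_integral)
  then show ?thesis
    by (simp add: stft_eq_ip[abs_def] ip_def)
qed

text \<open>At a fixed position the transform is the Fourier transform of \<open>f\<close> times the
  conjugate of a translate of \<open>g\<close>. This product is integrable at every position; its
  square is integrable at almost every position by Tonelli, and there Plancherel applies.\<close>

theorem moyal:
  assumes f: "f \<in> sq_int (lebR d)"
  shows "(\<integral>\<^sup>+z. ennreal ((cmod (stft d g f z))\<^sup>2) \<partial>lebR (2 * d)) = ennreal (sq_norm (lebR d) f * sq_norm (lebR d) g)"
proof -
  interpret L: sigma_finite_measure "lebR d"
    by (rule sigma_finite_lebR)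
  interpret LL: pair_sigma_finite "lebR d" "lebR d"
    by standard
  have [measurable]: "f \<in> borel_measurable (lebR d)" "stft d g f \<in> borel_measurable (lebR (2 * d))"
    using f stft_measurable by (auto simp: sq_int_measurable)
  let ?F = "\<lambda>x t. f t * cnj (g (vdiff d t x))"
  have F_meas: "(\<lambda>p. ?F (fst p) (snd p)) \<in> borel_measurable (lebR d \<Otimes>\<^sub>M lebR d)"
    by (intro borel_measurable_times borel_measurable_cnj measurable_compose[OF _ g_meas] measurable_vdiff) auto
  have F_int: "integrable (lebR d) (?F x)" for x
    by (rule sq_int_integrable_mult[OF f shift_sq_int])
  have stft: "stft d g f (vjoin d (x, \<xi>)) = fourier d (?F x) \<xi>" if "x \<in> Rn d" "\<xi> \<in> Rn d" for x \<xi>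
    using that by (simp add: stft_def fourier_def pos_vjoin freq_vjoin)
  have "(\<integral>\<^sup>+x. \<integral>\<^sup>+t. ennreal ((cmod (?F x t))\<^sup>2) \<partial>lebR d \<partial>lebR d) =
      (\<integral>\<^sup>+t. \<integral>\<^sup>+x. ennreal ((cmod (?F x t))\<^sup>2) \<partial>lebR d \<partial>lebR d)"
    using F_meas by (intro LL.Fubini'[symmetric]) (simp add: case_prod_unfold)
  also have "\<dots> = (\<integral>\<^sup>+t. ennreal ((cmod (f t))\<^sup>2) * ennreal (sq_norm (lebR d) g) \<partial>lebR d)"
  proof (intro nn_integral_cong)
    fix t assume t: "t \<in> space (lebR d)"
    have [measurable]: "(\<lambda>x. g (vdiff d t x)) \<in> borel_measurable (lebR d)"
      unfolding vdiff_aff_map_right by measurable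
    have "(\<integral>\<^sup>+x. ennreal ((cmod (?F x t))\<^sup>2) \<partial>lebR d) =
        (\<integral>\<^sup>+x. ennreal ((cmod (f t))\<^sup>2) * ennreal ((cmod (g (vdiff d t x)))\<^sup>2) \<partial>lebR d)"
      by (simp add: norm_mult power_mult_distrib ennreal_mult)
    also have "\<dots> = ennreal ((cmod (f t))\<^sup>2) * (\<integral>\<^sup>+x. ennreal ((cmod (g (vdiff d t x)))\<^sup>2) \<partial>lebR d)"
      by (rule nn_integral_cmult) measurable
    also have "(\<integral>\<^sup>+x. ennreal ((cmod (g (vdiff d t x)))\<^sup>2) \<partial>lebR d) = (\<integral>\<^sup>+x. ennreal ((cmod (g x))\<^sup>2) \<partial>lebR d)"
      by (rule nn_integral_vdiff_right) measurable
    finally show "(\<integral>\<^sup>+x. ennreal ((cmod (?F x t))\<^sup>2) \<partial>lebR d) = ennreal ((cmod (f t))\<^sup>2) * ennreal (sq_norm (lebR d) g)"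
      by (simp add: nn_integral_norm_square[OF g_sq])
  qed
  also have "\<dots> = ennreal (sq_norm (lebR d) f * sq_norm (lebR d) g)"
    by (simp add: nn_integral_multc nn_integral_norm_square[OF f] ennreal_mult)
  finally have total: "(\<integral>\<^sup>+x. \<integral>\<^sup>+t. ennreal ((cmod (?F x t))\<^sup>2) \<partial>lebR d \<partial>lebR d) = ennreal (sq_norm (lebR d) f * sq_norm (lebR d) g)" .
  have inner_meas: "(\<lambda>x. \<integral>\<^sup>+t. ennreal ((cmod (?F x t))\<^sup>2) \<partial>lebR d) \<in> borel_measurable (lebR d)"
    using F_meas by (intro L.borel_measurable_nn_integral) (simp add: case_prod_unfold)
  have "AE x in lebR d. (\<integral>\<^sup>+t. ennreal ((cmod (?F x t))\<^sup>2) \<partial>lebR d) \<noteq> \<infinity>"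
    by (rule nn_integral_noteq_infinite[OF inner_meas]) (simp add: total)
  then have "AE x in lebR d. (\<integral>\<^sup>+\<xi>. ennreal ((cmod (stft d g f (vjoin d (x, \<xi>))))\<^sup>2) \<partial>lebR d) =
      (\<integral>\<^sup>+t. ennreal ((cmod (?F x t))\<^sup>2) \<partial>lebR d)"
    using AE_space[of "lebR d"]
  proof eventually_elim
    case (elim x)
    have Fm: "?F x \<in> borel_measurable (lebR d)"
      using F_int by (rule borel_measurable_integrable)
    have "integrable (lebR d) (\<lambda>t. (cmod (?F x t))\<^sup>2)"
      using elim(1) Fm by (intro integrableI_bounded) (auto simp: top.not_eq_extremum)
    then have sq: "?F x \<in> sq_int (lebR d)"
      using Fm unfolding sq_int_def by blast
    interpret L1_L2 d "?F x"
      by standard (rule F_int, rule sq)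
    have "(\<integral>\<^sup>+\<xi>. ennreal ((cmod (stft d g f (vjoin d (x, \<xi>))))\<^sup>2) \<partial>lebR d) =
        (\<integral>\<^sup>+\<xi>. ennreal ((cmod (fourier d (?F x) \<xi>))\<^sup>2) \<partial>lebR d)"
      using elim(2) by (intro nn_integral_cong) (simp add: space_lebR stft)
    then show ?case
      by (simp only: plancherel nn_integral_norm_square[OF sq])
  qed
  then have "(\<integral>\<^sup>+x. \<integral>\<^sup>+\<xi>. ennreal ((cmod (stft d g f (vjoin d (x, \<xi>))))\<^sup>2) \<partial>lebR d \<partial>lebR d) =
      ennreal (sq_norm (lebR d) f * sq_norm (lebR d) g)"
    unfolding total[symmetric] by (rule nn_integral_cong_AE)
  then show ?thesis
    by (subst nn_integral_vjoin) auto
qed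

lemma dotp_vdiff_left: "dotp d (vdiff d a b) s = dotp d a s - dotp d b s"
  by (simp add: dotp_def vdiff_def left_diff_distrib sum_subtractf)

lemma dotp_vadd_right: "dotp d a (vadd d s x) = dotp d a s + dotp d a x"
  by (simp add: dotp_def vadd_def distrib_left sum.distrib)

lemma pos_vdiff: "pos d (vdiff (2 * d) z w) = vdiff d (pos d z) (pos d w)"
  by (auto simp: pos_def vdiff_def fun_eq_iff)

lemma freq_vdiff: "freq d (vdiff (2 * d) z w) = vdiff d (freq d z) (freq d w)"
  by (auto simp: freq_def vdiff_def fun_eq_iff)

text \<open>The substitution t = s + \<open>pos d w\<close> pulls out a phase that does not depend
  on s, so covariance holds for the modulus.\<close>

lemma cmod_stft_tf_shift: "cmod (stft d g (tf_shift d g w) z) = cmod (stft d g g (vdiff (2 * d) z w))"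
proof -
  let ?c = "cis (2 * pi * (dotp d (freq d w) (pos d w) - dotp d (freq d z) (pos d w)))"
  have "(\<lambda>t. tf_shift d g w t * cnj (tf_shift d g z t)) \<in> borel_measurable (lebR d)"
    using sq_int_measurable[OF tf_shift_sq_int] by (intro borel_measurable_times borel_measurable_cnj)
  then have "stft d g (tf_shift d g w) z =
      (CLINT s|lebR d. tf_shift d g w (vadd d s (pos d w)) * cnj (tf_shift d g z (vadd d s (pos d w))))"
    unfolding stft_eq_ip ip_def by (rule integral_vadd[symmetric])
  also have "\<dots> = (CLINT s|lebR d. ?c * (g s * cnj (g (vdiff d s (pos d (vdiff (2 * d) z w)))) *
      cis (- 2 * pi * dotp d (freq d (vdiff (2 * d) z w)) s)))"
  proof (intro Bochner_Integration.integral_cong refl)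
    fix s assume "s \<in> space (lebR d)"
    then have 1: "vdiff d (vadd d s (pos d w)) (pos d w) = s"
      by (auto simp: vdiff_def vadd_def space_lebR Rn_def PiE_iff extensional_def fun_eq_iff)
    have 2: "vdiff d (vadd d s (pos d w)) (pos d z) = vdiff d s (pos d (vdiff (2 * d) z w))"
      unfolding pos_vdiff by (auto simp: vdiff_def vadd_def fun_eq_iff)
    have 3: "cis (2 * pi * dotp d (freq d w) (vadd d s (pos d w))) * cis (- (2 * pi * dotp d (freq d z) (vadd d s (pos d w)))) =
        ?c * cis (- 2 * pi * dotp d (freq d (vdiff (2 * d) z w)) s)"
      unfolding cis_mult freq_vdiff dotp_vdiff_left dotp_vadd_right by (simp add: algebra_simps)
    have "tf_shift d g w (vadd d s (pos d w)) * cnj (tf_shift d g z (vadd d s (pos d w))) =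
      g s * cnj (g (vdiff d s (pos d (vdiff (2 * d) z w)))) *
      (cis (2 * pi * dotp d (freq d w) (vadd d s (pos d w))) * cis (- (2 * pi * dotp d (freq d z) (vadd d s (pos d w)))))"
      by (simp only: tf_shift_def 1 2 complex_cnj_mult cis_cnj mult_ac)
    also have "\<dots> = ?c * (g s * cnj (g (vdiff d s (pos d (vdiff (2 * d) z w)))) *
        cis (- 2 * pi * dotp d (freq d (vdiff (2 * d) z w)) s))"
      unfolding 3 by (simp only: mult_ac)
    finally show "tf_shift d g w (vadd d s (pos d w)) * cnj (tf_shift d g z (vadd d s (pos d w))) = \<dots>" .
  qed
  also have "\<dots> = ?c * stft d g g (vdiff (2 * d) z w)"
    unfolding stft_def by (rule integral_mult_right_zero)
  finally show ?thesis
    by (simp add: norm_mult)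
qed

end

section \<open>Accumulated spectrograms\<close>

lemma eigen_indices_down: "k \<in> eigen_indices N \<Longrightarrow> 1 \<le> j \<Longrightarrow> j \<le> k \<Longrightarrow> j \<in> eigen_indices N"
  unfolding eigen_indices_def mem_Collect_eq by (meson enat_ord_simps(1) order_trans)

text \<open>In the application \<open>a k\<close> is the spectrogram of the \<open>k\<close>-th eigenfunction; \<open>gap\<close> is the truncation
  error of the expansion of \<open>\<Theta>\<close>.\<close>

locale spectrogram_expansion =
  fixes L :: "'z measure" and \<Omega> :: "'z set" and \<Theta> :: "'z \<Rightarrow> real" and D :: real
    and N :: enat and lam :: "nat \<Rightarrow> real" and a :: "nat \<Rightarrow> 'z \<Rightarrow> real"
  assumes \<Omega>_meas [measurable]: "\<Omega> \<in> sets L" and \<Omega>_int: "integrable L (indicat_real \<Omega>)"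
    and \<Theta>_int: "integrable L \<Theta>" and \<Theta>_nonneg: "0 \<le> \<Theta> z"
    and \<Theta>_total: "(LINT z|L. \<Theta> z) = measure L \<Omega>"
    and \<Theta>_close: "(LINT z|L. \<bar>\<Theta> z - indicat_real \<Omega> z\<bar>) \<le> D"
    and lam_pos: "k \<in> eigen_indices N \<Longrightarrow> 0 < lam k"
    and lam_le_1: "k \<in> eigen_indices N \<Longrightarrow> lam k \<le> 1"
    and lam_decr: "j \<in> eigen_indices N \<Longrightarrow> k \<in> eigen_indices N \<Longrightarrow> j \<le> k \<Longrightarrow> lam k \<le> lam j"
    and lam_sum: "finite A \<Longrightarrow> A \<subseteq> eigen_indices N \<Longrightarrow> (\<Sum>k\<in>A. lam k) \<le> measure L \<Omega>"
    and a_meas: "k \<in> eigen_indices N \<Longrightarrow> a k \<in> borel_measurable L"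
    and a_nonneg: "0 \<le> a k z"
    and a_total: "k \<in> eigen_indices N \<Longrightarrow> (\<integral>\<^sup>+z. ennreal (a k z) \<partial>L) \<le> 1"
    and a_local: "k \<in> eigen_indices N \<Longrightarrow> (\<integral>\<^sup>+z. indicator \<Omega> z * ennreal (a k z) \<partial>L) = ennreal (lam k)"
    and gap: "finite A \<Longrightarrow> A \<subseteq> eigen_indices N \<Longrightarrow> 0 \<le> c \<Longrightarrow> (\<And>k. k \<in> eigen_indices N - A \<Longrightarrow> lam k \<le> c) \<Longrightarrow>
      z \<in> space L \<Longrightarrow> \<bar>\<Theta> z - (\<Sum>k\<in>A. lam k * a k z)\<bar> \<le> c"
begin

abbreviation I where "I \<equiv> eigen_indices N"

text \<open>Extension by zero turns finitely or infinitely many eigenvalues into one series over the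
  naturals; index 0 lies outside \<open>I\<close> and has the value 0.\<close>

definition l :: "nat \<Rightarrow> real" where
  "l k = (if k \<in> I then lam k else 0)"

definition b :: "nat \<Rightarrow> 'z \<Rightarrow> real" where
  "b k z = (if k \<in> I then a k z else 0)"

lemma l_nonneg: "0 \<le> l k"
  using lam_pos by (auto simp: l_def intro: less_imp_le)

lemma l_le_1: "l k \<le> 1"
  using lam_le_1 by (auto simp: l_def)

lemma b_nonneg: "0 \<le> b k z"
  by (simp add: b_def a_nonneg)

lemma b_meas [measurable]: "b k \<in> borel_measurable L"
  using a_meas[of k] unfolding b_def[abs_def] by (cases "k \<in> I") auto

lemma b_total: "(\<integral>\<^sup>+z. ennreal (b k z) \<partial>L) \<le> 1"
  using a_total[of k] by (cases "k \<in> I") (auto simp: b_def)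

lemma b_local: "(\<integral>\<^sup>+z. indicator \<Omega> z * ennreal (b k z) \<partial>L) = ennreal (l k)"
  using a_local[of k] by (cases "k \<in> I") (auto simp: b_def l_def)

lemma zero_notin: "0 \<notin> I"
  by (simp add: eigen_indices_def)

lemma l_partial_sum: "(\<Sum>k\<le>n. l k) = (\<Sum>k\<in>I \<inter> {..n}. lam k)"
  unfolding l_def by (subst Int_commute, subst sum.inter_restrict) auto

lemma l_summable: "summable l"
proof (rule summableI_nonneg_bounded)
  show "(\<Sum>k<n. l k) \<le> measure L \<Omega>" for n
  proof -
    have "(\<Sum>k<n. l k) \<le> (\<Sum>k\<le>n. l k)"
      by (intro sum_mono2) (auto simp: l_nonneg)
    also have "\<dots> \<le> measure L \<Omega>"
      unfolding l_partial_sum by (rule lam_sum) auto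
    finally show ?thesis .
  qed
qed (rule l_nonneg)

lemma l_decr: "1 \<le> j \<Longrightarrow> j \<le> k \<Longrightarrow> l k \<le> l j"
  using lam_decr[of j k] eigen_indices_down[of k N j] l_nonneg[of j]
  by (cases "k \<in> I") (auto simp: l_def)

text \<open>By \<open>gap\<close>, the error after index \<open>n\<close> is at most the next value
  \<open>l (Suc n)\<close>, which tends to 0 because the eigenvalues are summable.\<close>

lemma \<Theta>_sums:
  assumes z: "z \<in> space L" shows "(\<lambda>k. l k * b k z) sums \<Theta> z"
proof -
  have eq: "(\<Sum>k\<le>n. l k * b k z) = (\<Sum>k\<in>I \<inter> {..n}. lam k * a k z)" for n
    by (subst Int_commute, subst sum.inter_restrict) (auto simp: l_def b_def intro!: sum.cong)
  have bound: "\<bar>\<Theta> z - (\<Sum>k\<le>n. l k * b k z)\<bar> \<le> l (Suc n)" for n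
    unfolding eq
  proof (rule gap[OF _ _ l_nonneg _ z])
    fix k assume "k \<in> I - I \<inter> {..n}"
    then have "l k = lam k" "Suc n \<le> k"
      by (auto simp: l_def)
    then show "lam k \<le> l (Suc n)"
      using l_decr[of "Suc n" k] by simp
  qed auto
  have lim: "(\<lambda>n. l (Suc n)) \<longlonglongrightarrow> 0"
    using summable_LIMSEQ_zero[OF l_summable] by (rule LIMSEQ_Suc)
  have "(\<lambda>n. (\<Sum>k\<le>n. l k * b k z) - \<Theta> z) \<longlonglongrightarrow> 0"
    by (rule Lim_null_comparison[OF always_eventually lim])
      (unfold real_norm_def, intro allI, subst abs_minus_commute, rule bound)
  then show ?thesis
    by (simp add: sums_def_le LIM_zero_iff)
qed

lemma \<Theta>_suminf: "z \<in> space L \<Longrightarrow> ennreal (\<Theta> z) = (\<Sum>k. ennreal (l k * b k z))"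
  using \<Theta>_sums[of z] sums_summable[OF \<Theta>_sums[of z]] sums_unique[OF \<Theta>_sums[of z]]
  by (subst suminf_ennreal2) (simp_all add: l_nonneg b_nonneg)

lemma suminf_l_ennreal: "(\<Sum>k. ennreal (l k)) = ennreal (\<Sum>k. l k)"
  by (rule suminf_ennreal2[OF l_nonneg l_summable])

text \<open>One inequality is the trace bound \<open>lam_sum\<close>. The other integrates the
  expansion of \<Theta> over the whole space, where each spectrogram has mass at most 1.\<close>

lemma sum_l: "(\<Sum>k. l k) = measure L \<Omega>"
proof (rule antisym)
  show "(\<Sum>k. l k) \<le> measure L \<Omega>"
  proof (rule suminf_le_const[OF l_summable])
    fix n
    have "(\<Sum>k<n. l k) \<le> (\<Sum>k\<le>n. l k)"
      by (intro sum_mono2) (auto simp: l_nonneg)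
    also have "\<dots> \<le> measure L \<Omega>"
      unfolding l_partial_sum by (rule lam_sum) auto
    finally show "(\<Sum>k<n. l k) \<le> measure L \<Omega>" .
  qed
  have "ennreal (measure L \<Omega>) = (\<integral>\<^sup>+z. ennreal (\<Theta> z) \<partial>L)"
    using \<Theta>_int by (subst nn_integral_eq_integral) (auto simp: \<Theta>_nonneg \<Theta>_total)
  also have "\<dots> = (\<integral>\<^sup>+z. (\<Sum>k. ennreal (l k * b k z)) \<partial>L)"
    by (intro nn_integral_cong \<Theta>_suminf)
  also have "\<dots> = (\<Sum>k. \<integral>\<^sup>+z. ennreal (l k * b k z) \<partial>L)"
    by (rule nn_integral_suminf) measurable
  also have "\<dots> = (\<Sum>k. ennreal (l k) * (\<integral>\<^sup>+z. ennreal (b k z) \<partial>L))"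
    by (simp add: ennreal_mult l_nonneg b_nonneg nn_integral_cmult)
  also have "\<dots> \<le> (\<Sum>k. ennreal (l k) * 1)"
    by (intro suminf_le mult_left_mono b_total) auto
  finally have "ennreal (measure L \<Omega>) \<le> ennreal (\<Sum>k. l k)"
    by (simp add: suminf_l_ennreal)
  then show "measure L \<Omega> \<le> (\<Sum>k. l k)"
    by (simp add: suminf_nonneg l_summable l_nonneg)
qed

lemma l_square_summable: "summable (\<lambda>k. l k * l k)"
  by (rule summable_comparison_test'[OF l_summable]) (simp add: abs_mult l_nonneg mult_left_le l_le_1)

text \<open>Over \<Omega> the k-th spectrogram has mass \<open>l k\<close>, so integrating the
  expansion there produces squares. What \<Theta> lacks over \<Omega> is at most its L^1 distance
  from the indicator.\<close>

lemma sum_l_squares: "measure L \<Omega> - D \<le> (\<Sum>k. l k * l k)"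
proof -
  have int: "integrable L (\<lambda>z. indicat_real \<Omega> z * \<Theta> z)"
    using integrable_mult_indicator[OF \<Omega>_meas \<Theta>_int] by simp
  have "ennreal (LINT z|L. indicat_real \<Omega> z * \<Theta> z) = (\<integral>\<^sup>+z. ennreal (indicat_real \<Omega> z * \<Theta> z) \<partial>L)"
    using int by (intro nn_integral_eq_integral[symmetric]) (auto simp: \<Theta>_nonneg)
  also have "\<dots> = (\<integral>\<^sup>+z. (\<Sum>k. indicator \<Omega> z * ennreal (l k * b k z)) \<partial>L)"
    by (intro nn_integral_cong) (simp add: \<Theta>_suminf ennreal_mult' indicator_def split: if_splits)
  also have "\<dots> = (\<Sum>k. \<integral>\<^sup>+z. indicator \<Omega> z * ennreal (l k * b k z) \<partial>L)"
    by (rule nn_integral_suminf) measurable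
  also have "\<dots> = (\<Sum>k. ennreal (l k) * (\<integral>\<^sup>+z. indicator \<Omega> z * ennreal (b k z) \<partial>L))"
    by (simp add: ennreal_mult l_nonneg b_nonneg mult.left_commute[of "indicator \<Omega> _"] nn_integral_cmult)
  also have "\<dots> = ennreal (\<Sum>k. l k * l k)"
    unfolding b_local using suminf_ennreal2[OF _ l_square_summable] l_nonneg
    by (simp add: ennreal_mult)
  finally have eq: "(LINT z|L. indicat_real \<Omega> z * \<Theta> z) = (\<Sum>k. l k * l k)"
    by (simp add: suminf_nonneg l_square_summable l_nonneg \<Theta>_nonneg)
  have "measure L \<Omega> - (LINT z|L. indicat_real \<Omega> z * \<Theta> z) = (LINT z|L. indicat_real \<Omega> z - indicat_real \<Omega> z * \<Theta> z)"
    using \<Omega>_int int by (subst Bochner_Integration.integral_diff) auto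
  also have "\<dots> \<le> (LINT z|L. \<bar>\<Theta> z - indicat_real \<Omega> z\<bar>)"
  proof (rule integral_mono)
    show "integrable L (\<lambda>z. indicat_real \<Omega> z - indicat_real \<Omega> z * \<Theta> z)"
      using \<Omega>_int int by (rule Bochner_Integration.integrable_diff)
    show "integrable L (\<lambda>z. \<bar>\<Theta> z - indicat_real \<Omega> z\<bar>)"
      using \<Theta>_int \<Omega>_int by (intro integrable_abs Bochner_Integration.integrable_diff)
    show "indicat_real \<Omega> z - indicat_real \<Omega> z * \<Theta> z \<le> \<bar>\<Theta> z - indicat_real \<Omega> z\<bar>" for z
      by (cases "z \<in> \<Omega>") auto
  qed
  also have "\<dots> \<le> D"
    by (rule \<Theta>_close)
  finally show ?thesis
    unfolding eq by linarith
qed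

definition A\<^sub>0 :: nat where
  "A\<^sub>0 = nat \<lceil>measure L \<Omega>\<rceil>"

lemma A0_bounds: "measure L \<Omega> \<le> real A\<^sub>0" "real A\<^sub>0 \<le> measure L \<Omega> + 1"
  unfolding A\<^sub>0_def using measure_nonneg[of L \<Omega>] by linarith+

text \<open>There are at least \<open>A\<^sub>0\<close> eigenvalues: they sum to \<open>|\<Omega>|\<close> and none exceeds 1.\<close>

lemma A0_indices:
  assumes "1 \<le> k" "k \<le> A\<^sub>0" shows "k \<in> I"
proof (rule ccontr)
  assume "k \<notin> I"
  then have out: "j \<notin> I" if "k \<le> j" for j
    using eigen_indices_down[of j N k] assms(1) that by auto
  have "(\<Sum>j. l j) = (\<Sum>j\<in>{1..<k}. l j)"
  proof (rule suminf_finite)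
    show "l j = 0" if "j \<notin> {1..<k}" for j
    proof (cases "j = 0")
      case False
      then show ?thesis
        using out[of j] that by (simp add: l_def)
    qed (use zero_notin in \<open>simp add: l_def\<close>)
  qed simp
  also have "\<dots> \<le> (\<Sum>j\<in>{1..<k}. 1)"
    by (intro sum_mono l_le_1)
  also have "\<dots> = real (k - 1)"
    by simp
  also have "\<dots> < measure L \<Omega>"
  proof -
    \<comment> \<open>An integer at most the ceiling of |\<Omega>| satisfies k - 1 < |\<Omega>|, the
      strict inequality that the contradiction needs.\<close>
    have "int k \<le> \<lceil>measure L \<Omega>\<rceil>"
      using assms unfolding A\<^sub>0_def by linarith
    then show ?thesis
      using assms(1) by linarith
  qed
  finally show False
    by (simp add: sum_l)
qed

definition tail :: real where
  "tail = (\<Sum>k. l (k + Suc A\<^sub>0))"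

lemma split_at_A0: 
  assumes "summable f"
  shows "(\<Sum>k. f k) = (\<Sum>k\<le>A\<^sub>0. f k) + (\<Sum>k. f (k + Suc A\<^sub>0) :: real)"
  using suminf_split_initial_segment[OF assms, of "Suc A\<^sub>0"] by (simp add: lessThan_Suc_atMost)

lemma l_0: "l 0 = 0"
  by (simp add: l_def zero_notin)

lemma head_sum: "(\<Sum>k\<le>A\<^sub>0. f k) = f 0 + (\<Sum>k=1..A\<^sub>0. f k :: 'b::comm_monoid_add)"
proof -
  have "{..A\<^sub>0} = insert 0 {1..A\<^sub>0}"
    by auto
  then show ?thesis
    by simp
qed

text \<open>The threshold \<open>\<theta>\<close> separates the first \<open>A\<^sub>0\<close> eigenvalues from the others; weighting the head by
  \<open>\<theta>\<close> and the tail by \<open>1 - \<theta>\<close> bounds the tail by the trace of \<open>H - H\<^sup>2\<close>.\<close>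

lemma tail_le: "tail \<le> D"
proof -
  \<comment> \<open>For an empty head the threshold has to be 1: the value \<open>l 0 = 0\<close>
    would be no upper bound for the tail.\<close>
  define \<theta> where "\<theta> = (if A\<^sub>0 = 0 then 1 else l A\<^sub>0)"
  have \<theta>: "0 \<le> \<theta>" "\<theta> \<le> 1"
    by (auto simp: \<theta>_def l_nonneg l_le_1)
  have head: "\<theta> \<le> l k" if "1 \<le> k" "k \<le> A\<^sub>0" for k
    using l_decr[OF that] that by (auto simp: \<theta>_def)
  have rest: "l (k + Suc A\<^sub>0) \<le> \<theta>" for k
    using l_decr[of A\<^sub>0 "k + Suc A\<^sub>0"] l_le_1 by (auto simp: \<theta>_def)
  let ?f = "\<lambda>k. l k - l k * l k"
  have f_eq: "?f k = l k * (1 - l k)" for k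
    by (simp add: algebra_simps)
  have f_summable: "summable ?f"
    by (intro summable_diff l_summable l_square_summable)
  have "(\<Sum>k. ?f k) = measure L \<Omega> - (\<Sum>k. l k * l k)"
    using suminf_diff[OF l_summable l_square_summable] by (simp add: sum_l)
  then have total: "(\<Sum>k. ?f k) \<le> D"
    using sum_l_squares by linarith
  \<comment> \<open>The eigenvalues sum to |\<Omega>|, which is at most \<open>A\<^sub>0\<close>. So
    the mass of the tail is missing from the head and is at most the sum of \<open>1 - l k\<close>
    there.\<close>
  have "real A\<^sub>0 - (measure L \<Omega> - tail) = (\<Sum>k=1..A\<^sub>0. 1 - l k)"
    using split_at_A0[OF l_summable] head_sum[of l] by (simp add: sum_l l_0 tail_def sum_subtractf)
  then have "tail \<le> (\<Sum>k=1..A\<^sub>0. 1 - l k)"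
    using A0_bounds by linarith
  then have "\<theta> * tail \<le> (\<Sum>k=1..A\<^sub>0. \<theta> * (1 - l k))"
    using \<theta>(1) by (simp add: mult_left_mono flip: sum_distrib_left)
  also have "\<dots> \<le> (\<Sum>k=1..A\<^sub>0. ?f k)"
    unfolding f_eq using head l_le_1 by (intro sum_mono mult_right_mono) auto
  finally have 1: "\<theta> * tail \<le> (\<Sum>k\<le>A\<^sub>0. ?f k)"
    by (simp add: head_sum[of ?f] l_0)
  have tl: "summable (\<lambda>k. l (k + Suc A\<^sub>0))"
    using l_summable by (subst summable_iff_shift)
  have ft: "summable (\<lambda>k. ?f (k + Suc A\<^sub>0))"
    using f_summable summable_iff_shift[of ?f "Suc A\<^sub>0"] by blast
  have "(1 - \<theta>) * tail = (\<Sum>k. (1 - \<theta>) * l (k + Suc A\<^sub>0))"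
    unfolding tail_def by (rule suminf_mult[OF tl, symmetric])
  also have "\<dots> \<le> (\<Sum>k. ?f (k + Suc A\<^sub>0))"
  proof (rule suminf_le)
    show "(1 - \<theta>) * l (k + Suc A\<^sub>0) \<le> ?f (k + Suc A\<^sub>0)" for k
      unfolding f_eq using rest[of k] l_nonneg[of "k + Suc A\<^sub>0"]
      by (simp add: mult.commute[of "1 - \<theta>"] mult_left_mono)
  qed (intro summable_mult tl ft)+
  finally have "\<theta> * tail + (1 - \<theta>) * tail \<le> (\<Sum>k. ?f k)"
    using 1 split_at_A0[OF f_summable] by linarith
  then show ?thesis
    using total by (simp add: algebra_simps)
qed

definition \<rho> :: "'z \<Rightarrow> real" where
  "\<rho> z = (\<Sum>k=1..A\<^sub>0. a k z)"

lemma \<rho>_eq: "\<rho> z = (\<Sum>k=1..A\<^sub>0. b k z)"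
  unfolding \<rho>_def by (intro sum.cong refl) (simp add: b_def A0_indices)

lemma \<rho>_measurable [measurable]: "\<rho> \<in> borel_measurable L"
  unfolding \<rho>_eq[abs_def] by measurable

text \<open>In \<rho> - \<Theta> the first \<open>A\<^sub>0\<close> spectrograms carry the weights
  \<open>1 - l k\<close> and the others \<open>- l k\<close>. The total mass is at most
  \<open>A\<^sub>0\<close> - |\<Omega>| plus twice the tail, and rounding up contributes at most
  1.\<close>

lemma \<rho>_close_\<Theta>: "(\<integral>\<^sup>+z. ennreal \<bar>\<rho> z - \<Theta> z\<bar> \<partial>L) \<le> ennreal (1 + 2 * D)"
proof -
  have pointwise: "ennreal \<bar>\<rho> z - \<Theta> z\<bar> \<le> (\<Sum>k=1..A\<^sub>0. ennreal ((1 - l k) * b k z)) + (\<Sum>k. ennreal (l (k + Suc A\<^sub>0) * b (k + Suc A\<^sub>0) z))"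
    if z: "z \<in> space L" for z
  proof -
    note s = \<Theta>_sums[OF z]
    have sm: "summable (\<lambda>k. l k * b k z)"
      using s by (rule sums_summable)
    have tl: "summable (\<lambda>k. l (k + Suc A\<^sub>0) * b (k + Suc A\<^sub>0) z)"
      using sm summable_iff_shift[of "\<lambda>k. l k * b k z" "Suc A\<^sub>0"] by blast
    have "\<Theta> z = (\<Sum>k=1..A\<^sub>0. l k * b k z) + (\<Sum>k. l (k + Suc A\<^sub>0) * b (k + Suc A\<^sub>0) z)"
      using split_at_A0[OF sm] s by (simp add: sums_iff head_sum l_0)
    then have "\<rho> z - \<Theta> z = (\<Sum>k=1..A\<^sub>0. (1 - l k) * b k z) - (\<Sum>k. l (k + Suc A\<^sub>0) * b (k + Suc A\<^sub>0) z)"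
      by (simp add: \<rho>_eq left_diff_distrib sum_subtractf)
    moreover have "0 \<le> (\<Sum>k=1..A\<^sub>0. (1 - l k) * b k z)"
      by (intro sum_nonneg mult_nonneg_nonneg) (auto simp: l_le_1 b_nonneg)
    moreover have "0 \<le> (\<Sum>k. l (k + Suc A\<^sub>0) * b (k + Suc A\<^sub>0) z)"
      by (intro suminf_nonneg tl mult_nonneg_nonneg l_nonneg b_nonneg)
    ultimately have "\<bar>\<rho> z - \<Theta> z\<bar> \<le> (\<Sum>k=1..A\<^sub>0. (1 - l k) * b k z) + (\<Sum>k. l (k + Suc A\<^sub>0) * b (k + Suc A\<^sub>0) z)"
      by linarith
    then have "ennreal \<bar>\<rho> z - \<Theta> z\<bar> \<le> ennreal ((\<Sum>k=1..A\<^sub>0. (1 - l k) * b k z) + (\<Sum>k. l (k + Suc A\<^sub>0) * b (k + Suc A\<^sub>0) z))"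
      by (rule ennreal_leI)
    also have "\<dots> = ennreal (\<Sum>k=1..A\<^sub>0. (1 - l k) * b k z) + ennreal (\<Sum>k. l (k + Suc A\<^sub>0) * b (k + Suc A\<^sub>0) z)"
      by (intro ennreal_plus sum_nonneg suminf_nonneg tl mult_nonneg_nonneg l_nonneg b_nonneg) (simp add: l_le_1)
    also have "ennreal (\<Sum>k=1..A\<^sub>0. (1 - l k) * b k z) = (\<Sum>k=1..A\<^sub>0. ennreal ((1 - l k) * b k z))"
      by (rule sum_ennreal[symmetric]) (simp add: l_le_1 b_nonneg)
    also have "ennreal (\<Sum>k. l (k + Suc A\<^sub>0) * b (k + Suc A\<^sub>0) z) = (\<Sum>k. ennreal (l (k + Suc A\<^sub>0) * b (k + Suc A\<^sub>0) z))"
      by (rule suminf_ennreal2[OF _ tl, symmetric]) (simp add: l_nonneg b_nonneg)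
    finally show ?thesis .
  qed
  have cm: "(\<integral>\<^sup>+z. ennreal (c * b k z) \<partial>L) \<le> ennreal c" if "0 \<le> c" for c k
  proof -
    have "(\<integral>\<^sup>+z. ennreal (c * b k z) \<partial>L) = ennreal c * (\<integral>\<^sup>+z. ennreal (b k z) \<partial>L)"
      using that by (simp add: ennreal_mult b_nonneg nn_integral_cmult)
    also have "\<dots> \<le> ennreal c * 1"
      by (intro mult_left_mono b_total) simp
    finally show ?thesis
      by simp
  qed
  have tl: "summable (\<lambda>k. l (k + Suc A\<^sub>0))"
    using l_summable by (subst summable_iff_shift)
  have "(\<integral>\<^sup>+z. ennreal \<bar>\<rho> z - \<Theta> z\<bar> \<partial>L) \<le>
      (\<integral>\<^sup>+z. (\<Sum>k=1..A\<^sub>0. ennreal ((1 - l k) * b k z)) + (\<Sum>k. ennreal (l (k + Suc A\<^sub>0) * b (k + Suc A\<^sub>0) z)) \<partial>L)"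
    by (intro nn_integral_mono pointwise)
  also have "\<dots> = (\<integral>\<^sup>+z. (\<Sum>k=1..A\<^sub>0. ennreal ((1 - l k) * b k z)) \<partial>L) + (\<integral>\<^sup>+z. (\<Sum>k. ennreal (l (k + Suc A\<^sub>0) * b (k + Suc A\<^sub>0) z)) \<partial>L)"
    by (rule nn_integral_add) measurable
  also have "\<dots> = (\<Sum>k=1..A\<^sub>0. \<integral>\<^sup>+z. ennreal ((1 - l k) * b k z) \<partial>L) + (\<Sum>k. \<integral>\<^sup>+z. ennreal (l (k + Suc A\<^sub>0) * b (k + Suc A\<^sub>0) z) \<partial>L)"
  proof (rule arg_cong2[where f = "(+)"])
    show "(\<integral>\<^sup>+z. (\<Sum>k=1..A\<^sub>0. ennreal ((1 - l k) * b k z)) \<partial>L) = (\<Sum>k=1..A\<^sub>0. \<integral>\<^sup>+z. ennreal ((1 - l k) * b k z) \<partial>L)"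
      by (rule nn_integral_sum) measurable
    show "(\<integral>\<^sup>+z. (\<Sum>k. ennreal (l (k + Suc A\<^sub>0) * b (k + Suc A\<^sub>0) z)) \<partial>L) =
        (\<Sum>k. \<integral>\<^sup>+z. ennreal (l (k + Suc A\<^sub>0) * b (k + Suc A\<^sub>0) z) \<partial>L)"
      by (rule nn_integral_suminf) measurable
  qed
  also have "\<dots> \<le> (\<Sum>k=1..A\<^sub>0. ennreal (1 - l k)) + (\<Sum>k. ennreal (l (k + Suc A\<^sub>0)))"
    by (intro add_mono sum_mono suminf_le cm) (auto simp: l_le_1 l_nonneg)
  also have "\<dots> = ennreal (\<Sum>k=1..A\<^sub>0. 1 - l k) + ennreal tail"
    unfolding tail_def by (subst sum_ennreal, simp add: l_le_1, subst suminf_ennreal2[OF _ tl]) (auto simp: l_nonneg)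
  also have "\<dots> = ennreal ((\<Sum>k=1..A\<^sub>0. 1 - l k) + tail)"
    unfolding tail_def by (intro ennreal_plus[symmetric] sum_nonneg suminf_nonneg tl l_nonneg) (simp add: l_le_1)
  also have "\<dots> \<le> ennreal (1 + 2 * D)"
  proof (rule ennreal_leI)
    have "real A\<^sub>0 - (measure L \<Omega> - tail) = (\<Sum>k=1..A\<^sub>0. 1 - l k)"
      using split_at_A0[OF l_summable] head_sum[of l] by (simp add: sum_l l_0 tail_def sum_subtractf)
    then show "(\<Sum>k=1..A\<^sub>0. 1 - l k) + tail \<le> 1 + 2 * D"
      using A0_bounds tail_le by linarith
  qed
  finally show ?thesis .
qed

theorem symmetric_difference_le:
  assumes "1 \<le> D"
  shows "emeasure L (sym_diff \<Omega> {z \<in> space L. \<rho> z > 1 / 2}) \<le> ennreal (8 * D)"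
proof -
  let ?E = "sym_diff \<Omega> {z \<in> space L. \<rho> z > 1 / 2}"
  have [measurable]: "\<Theta> \<in> borel_measurable L"
    using \<Theta>_int by (rule borel_measurable_integrable)
  have R: "{z \<in> space L. \<rho> z > 1 / 2} \<in> sets L"
    by measurable
  have E: "?E \<in> sets L"
    by (intro sets.Un sets.Diff \<Omega>_meas R)
  have "emeasure L ?E = (\<integral>\<^sup>+z. indicator ?E z \<partial>L)"
    using E by simp
  also have "\<dots> \<le> (\<integral>\<^sup>+z. 2 * (ennreal \<bar>\<rho> z - \<Theta> z\<bar> + ennreal \<bar>\<Theta> z - indicat_real \<Omega> z\<bar>) \<partial>L)"
  proof (rule nn_integral_mono)
    fix z
    have "1 \<le> 2 * (\<bar>\<rho> z - \<Theta> z\<bar> + \<bar>\<Theta> z - indicat_real \<Omega> z\<bar>)" if "z \<in> ?E"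
    proof -
      have "1 / 2 \<le> \<bar>\<rho> z - indicat_real \<Omega> z\<bar>"
        using that sets.sets_into_space[OF \<Omega>_meas] by (auto simp: indicator_def)
      moreover have "\<bar>\<rho> z - indicat_real \<Omega> z\<bar> \<le> \<bar>\<rho> z - \<Theta> z\<bar> + \<bar>\<Theta> z - indicat_real \<Omega> z\<bar>"
        using abs_triangle_ineq[of "\<rho> z - \<Theta> z" "\<Theta> z - indicat_real \<Omega> z"] by simp
      ultimately show ?thesis
        by simp
    qed
    then have "z \<in> ?E \<Longrightarrow> 1 \<le> ennreal (2 * (\<bar>\<rho> z - \<Theta> z\<bar> + \<bar>\<Theta> z - indicat_real \<Omega> z\<bar>))"
      by (metis ennreal_1 ennreal_leI)
    also have "ennreal (2 * (\<bar>\<rho> z - \<Theta> z\<bar> + \<bar>\<Theta> z - indicat_real \<Omega> z\<bar>)) =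
        2 * (ennreal \<bar>\<rho> z - \<Theta> z\<bar> + ennreal \<bar>\<Theta> z - indicat_real \<Omega> z\<bar>)"
      by (simp add: ennreal_mult ennreal_plus)
    finally show "indicator ?E z \<le> 2 * (ennreal \<bar>\<rho> z - \<Theta> z\<bar> + ennreal \<bar>\<Theta> z - indicat_real \<Omega> z\<bar>)"
      by (cases "z \<in> ?E") auto
  qed
  also have "\<dots> = 2 * ((\<integral>\<^sup>+z. ennreal \<bar>\<rho> z - \<Theta> z\<bar> \<partial>L) + (\<integral>\<^sup>+z. ennreal \<bar>\<Theta> z - indicat_real \<Omega> z\<bar> \<partial>L))"
    by (simp add: nn_integral_cmult nn_integral_add)
  also have "\<dots> \<le> 2 * (ennreal (1 + 2 * D) + ennreal D)"
  proof (intro mult_left_mono add_mono \<rho>_close_\<Theta>)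
    have "(\<integral>\<^sup>+z. ennreal \<bar>\<Theta> z - indicat_real \<Omega> z\<bar> \<partial>L) = ennreal (LINT z|L. \<bar>\<Theta> z - indicat_real \<Omega> z\<bar>)"
      using \<Theta>_int \<Omega>_int by (intro nn_integral_eq_integral) auto
    also have "\<dots> \<le> ennreal D"
      by (intro ennreal_leI \<Theta>_close)
    finally show "(\<integral>\<^sup>+z. ennreal \<bar>\<Theta> z - indicat_real \<Omega> z\<bar> \<partial>L) \<le> ennreal D" .
  qed simp
  also have "\<dots> = ennreal (2 * ((1 + 2 * D) + D))"
  proof -
    have "ennreal ((1 + 2 * D) + D) = ennreal (1 + 2 * D) + ennreal D"
      using assms by (intro ennreal_plus) auto
    moreover have "ennreal (2 * ((1 + 2 * D) + D)) = ennreal 2 * ennreal ((1 + 2 * D) + D)"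
      using assms by (intro ennreal_mult) auto
    ultimately show ?thesis
      by (simp only: ennreal_numeral)
  qed
  \<comment> \<open>Here \<open>1 \<le> D\<close> absorbs the summand 2 into
    \<open>2 * D\<close>.\<close>
  also have "\<dots> \<le> ennreal (8 * D)"
    using assms by (intro ennreal_leI) simp
  finally show ?thesis .
qed

end

section \<open>Smoothing an indicator by a density of finite first moment\<close>

lemma compact_subset_cube:
  assumes "compact \<Omega>" "\<Omega> \<subseteq> Rn n"
  obtains r where "\<Omega> \<subseteq> cube n r"
proof -
  have "\<exists>c. \<forall>x\<in>\<Omega>. \<bar>x i\<bar> \<le> c" for i
  proof -
    have "compact ((\<lambda>x. x i) ` \<Omega>)"
      by (intro compact_continuous_image assms(1) continuous_on_subset[OF continuous_on_product_coordinates]) auto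
    then have "bounded ((\<lambda>x. x i) ` \<Omega>)"
      by (rule compact_imp_bounded)
    then show ?thesis
      by (auto simp: bounded_iff)
  qed
  then obtain c where c: "\<And>i x. x \<in> \<Omega> \<Longrightarrow> \<bar>x i\<bar> \<le> c i"
    by metis
  have "\<Omega> \<subseteq> cube n (\<Sum>i<n. \<bar>c i\<bar>)"
  proof
    fix x assume x: "x \<in> \<Omega>"
    have "\<bar>x i\<bar> \<le> (\<Sum>i<n. \<bar>c i\<bar>)" if "i < n" for i
    proof -
      have "\<bar>x i\<bar> \<le> \<bar>c i\<bar>"
        using c[OF x, of i] by simp
      also have "\<dots> \<le> (\<Sum>i<n. \<bar>c i\<bar>)"
        using that by (intro member_le_sum) auto
      finally show ?thesis .
    qed
    then show "x \<in> cube n (\<Sum>i<n. \<bar>c i\<bar>)"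
      using x assms(2) by (auto simp: mem_cube)
  qed
  then show ?thesis
    by (rule that)
qed

locale smoothed_set =
  fixes n :: nat and p :: "vec \<Rightarrow> real" and \<Omega> :: "vec set" and r :: real
  assumes p_meas [measurable]: "p \<in> borel_measurable (lebR n)" and p_nonneg: "0 \<le> p u"
    and p_total: "(\<integral>\<^sup>+u. ennreal (p u) \<partial>lebR n) = 1"
    and p_moment: "integrable (lebR n) (\<lambda>u. enorm n u * p u)"
    and fin: "finite_perimeter n \<Omega>" and \<Omega>_cube: "\<Omega> \<subseteq> cube n r"
begin

sublocale L: sigma_finite_measure "lebR n"
  by (rule sigma_finite_lebR)

sublocale LL: pair_sigma_finite "lebR n" "lebR n"
  by standard

definition \<Theta> :: "vec \<Rightarrow> real" where
  "\<Theta> z = (LINT w|lebR n. indicat_real \<Omega> w * p (vdiff n w z))"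

lemma \<Omega>_int: "integrable (lebR n) (indicat_real \<Omega>)"
  using fin by (simp add: finite_perimeter_def)

lemma \<Omega>_meas [measurable]: "indicat_real \<Omega> \<in> borel_measurable (lebR n)"
  using \<Omega>_int by simp

lemma \<Omega>_sets [measurable]: "\<Omega> \<in> sets (lebR n)"
proof -
  have "\<Omega> \<inter> space (lebR n) = \<Omega>"
    using \<Omega>_cube cube_subset by (auto simp: space_lebR)
  then show ?thesis
    using \<Omega>_meas by (simp add: borel_measurable_indicator_iff)
qed

lemma p_vdiff_meas: "(\<lambda>q. p (vdiff n (fst q) (snd q))) \<in> borel_measurable (lebR n \<Otimes>\<^sub>M lebR n)"
  by (intro measurable_compose[OF _ p_meas] measurable_vdiff) auto

lemma p_vdiff_swap_meas: "(\<lambda>q. p (vdiff n (snd q) (fst q))) \<in> borel_measurable (lebR n \<Otimes>\<^sub>M lebR n)"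
  by (intro measurable_compose[OF _ p_meas] measurable_vdiff) auto

lemma p_total_vdiff: "(\<integral>\<^sup>+w. ennreal (p (vdiff n w z)) \<partial>lebR n) = 1"
  using nn_integral_vdiff[of "\<lambda>u. ennreal (p u)" n z] by (simp add: p_total)

lemma p_total_vdiff_right: "(\<integral>\<^sup>+z. ennreal (p (vdiff n w z)) \<partial>lebR n) = 1"
  using nn_integral_vdiff_right[of "\<lambda>u. ennreal (p u)" n w] by (simp add: p_total)

lemma p_vdiff_int: "integrable (lebR n) (\<lambda>w. p (vdiff n w z))" "(LINT w|lebR n. p (vdiff n w z)) = 1"
proof -
  have [measurable]: "(\<lambda>w. p (vdiff n w z)) \<in> borel_measurable (lebR n)"
    unfolding vdiff_aff_map by measurable
  show "integrable (lebR n) (\<lambda>w. p (vdiff n w z))"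
    by (rule integrableI_nonneg) (auto simp: p_nonneg p_total_vdiff)
  show "(LINT w|lebR n. p (vdiff n w z)) = 1"
    by (subst integral_eq_nn_integral) (auto simp: p_nonneg p_total_vdiff)
qed

lemma \<Omega>_p_int: "integrable (lebR n) (\<lambda>w. indicat_real \<Omega> w * p (vdiff n w z))"
  using integrable_mult_indicator[OF \<Omega>_sets p_vdiff_int(1)] by simp

lemma \<Theta>_nonneg: "0 \<le> \<Theta> z"
  unfolding \<Theta>_def by (intro integral_nonneg_AE AE_I2) (simp add: p_nonneg)

lemma \<Theta>_nn: "ennreal (\<Theta> z) = (\<integral>\<^sup>+w. indicator \<Omega> w * ennreal (p (vdiff n w z)) \<partial>lebR n)"
proof -
  have "ennreal (\<Theta> z) = (\<integral>\<^sup>+w. ennreal (indicat_real \<Omega> w * p (vdiff n w z)) \<partial>lebR n)"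
    unfolding \<Theta>_def using \<Omega>_p_int by (intro nn_integral_eq_integral[symmetric]) (auto simp: p_nonneg)
  then show ?thesis
    by (simp add: ennreal_mult' ennreal_indicator)
qed

lemma \<Theta>_meas [measurable]: "\<Theta> \<in> borel_measurable (lebR n)"
proof -
  have "(\<lambda>q. indicat_real \<Omega> (snd q) * p (vdiff n (snd q) (fst q))) \<in> borel_measurable (lebR n \<Otimes>\<^sub>M lebR n)"
    by (intro borel_measurable_times p_vdiff_swap_meas measurable_compose[OF _ \<Omega>_meas]) auto
  then have "(\<lambda>(z, w). indicat_real \<Omega> w * p (vdiff n w z)) \<in> borel_measurable (lebR n \<Otimes>\<^sub>M lebR n)"
    by (simp only: case_prod_unfold)
  then show ?thesis
    unfolding \<Theta>_def[abs_def] by (rule L.borel_measurable_lebesgue_integral)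
qed

lemma \<Theta>_nn_total: "(\<integral>\<^sup>+z. ennreal (\<Theta> z) \<partial>lebR n) = emeasure (lebR n) \<Omega>"
proof -
  have m: "(\<lambda>q. indicator \<Omega> (snd q) * ennreal (p (vdiff n (snd q) (fst q)))) \<in> borel_measurable (lebR n \<Otimes>\<^sub>M lebR n)"
    using p_vdiff_swap_meas by measurable
  have "(\<integral>\<^sup>+z. ennreal (\<Theta> z) \<partial>lebR n) = (\<integral>\<^sup>+w. \<integral>\<^sup>+z. indicator \<Omega> w * ennreal (p (vdiff n w z)) \<partial>lebR n \<partial>lebR n)"
    unfolding \<Theta>_nn using m by (intro LL.Fubini'[symmetric]) (simp add: case_prod_unfold)
  also have "\<dots> = (\<integral>\<^sup>+w. indicator \<Omega> w * 1 \<partial>lebR n)"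
  proof (intro nn_integral_cong)
    fix w
    have [measurable]: "(\<lambda>z. p (vdiff n w z)) \<in> borel_measurable (lebR n)"
      unfolding vdiff_aff_map_right by measurable
    show "(\<integral>\<^sup>+z. indicator \<Omega> w * ennreal (p (vdiff n w z)) \<partial>lebR n) = indicator \<Omega> w * 1"
      by (subst nn_integral_cmult) (auto simp: p_total_vdiff_right)
  qed
  finally show ?thesis
    by simp
qed

lemma \<Omega>_finite: "emeasure (lebR n) \<Omega> < \<infinity>"
  using \<Omega>_int sets.Int_space_eq2[OF \<Omega>_sets] by (simp add: integrable_indicator_iff)

lemma \<Theta>_int: "integrable (lebR n) \<Theta>"
  using \<Omega>_finite by (intro integrableI_nonneg) (auto simp: \<Theta>_nonneg \<Theta>_nn_total)

lemma \<Theta>_total: "(LINT z|lebR n. \<Theta> z) = measure (lebR n) \<Omega>"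
  by (subst integral_eq_nn_integral) (auto simp: \<Theta>_nonneg \<Theta>_nn_total measure_def)

text \<open>As \<open>p\<close> has mass 1, the difference at z is the average of the indicator at
  \<open>vadd n z u\<close> minus the indicator at z, with density \<open>p u\<close>. Tonelli and
  the translation bound for each \<open>u\<close> then bring in the first moment of
  \<open>p\<close>.\<close>

lemma \<Theta>_close:
  "(LINT z|lebR n. \<bar>\<Theta> z - indicat_real \<Omega> z\<bar>) \<le> (LINT u|lebR n. enorm n u * p u) * perimeter n \<Omega>"
proof -
  \<comment> \<open>The zero field is admissible and pairs to 0. The sign is needed to move
    \<open>perimeter\<close> in and out of \<open>ennreal\<close>.\<close>
  have per: "0 \<le> perimeter n \<Omega>"
  proof (rule ccontr)
    assume neg: "\<not> 0 \<le> perimeter n \<Omega>"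
    have "(\<lambda>x. \<lambda>i\<in>{..<n}. 0) \<in> test_fields n"
      by (auto simp: test_fields_def Rn_def C1_on_Rn_def partial_derivative_def[abs_def] L2_set_def
        intro!: exI[of _ "{}"])
    from perimeter_ge[OF fin this] neg show False
      by (simp add: divergence_def partial_derivative_def)
  qed
  have pointwise: "ennreal \<bar>\<Theta> z - indicat_real \<Omega> z\<bar> \<le>
      (\<integral>\<^sup>+u. ennreal (p u) * ennreal \<bar>indicat_real \<Omega> z - indicat_real \<Omega> (vadd n z u)\<bar> \<partial>lebR n)"
    if z: "z \<in> space (lebR n)" for z
  proof -
    have "\<Theta> z - indicat_real \<Omega> z = (LINT w|lebR n. indicat_real \<Omega> w * p (vdiff n w z)) - (LINT w|lebR n. indicat_real \<Omega> z * p (vdiff n w z))"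
      by (simp add: \<Theta>_def p_vdiff_int)
    also have "\<dots> = (LINT w|lebR n. (indicat_real \<Omega> w - indicat_real \<Omega> z) * p (vdiff n w z))"
      using \<Omega>_p_int p_vdiff_int(1) by (simp add: left_diff_distrib)
    finally have eq: "\<Theta> z - indicat_real \<Omega> z = (LINT w|lebR n. (indicat_real \<Omega> w - indicat_real \<Omega> z) * p (vdiff n w z))" .
    have [measurable]: "(\<lambda>w. p (vdiff n w z)) \<in> borel_measurable (lebR n)"
      using p_vdiff_int(1) by (rule borel_measurable_integrable)
    have "ennreal \<bar>\<Theta> z - indicat_real \<Omega> z\<bar> \<le> (\<integral>\<^sup>+w. ennreal (norm ((indicat_real \<Omega> w - indicat_real \<Omega> z) * p (vdiff n w z))) \<partial>lebR n)"
      unfolding eq real_norm_def[symmetric]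
      using \<Omega>_p_int p_vdiff_int(1) by (intro integral_norm_bound_ennreal) (simp add: left_diff_distrib)
    also have "\<dots> = (\<integral>\<^sup>+u. ennreal (norm ((indicat_real \<Omega> (vadd n u z) - indicat_real \<Omega> z) * p (vdiff n (vadd n u z) z))) \<partial>lebR n)"
      by (rule nn_integral_vadd[symmetric]) measurable
    also have "\<dots> = (\<integral>\<^sup>+u. ennreal (p u) * ennreal \<bar>indicat_real \<Omega> z - indicat_real \<Omega> (vadd n z u)\<bar> \<partial>lebR n)"
    proof (intro nn_integral_cong)
      fix u assume "u \<in> space (lebR n)"
      then have 1: "vdiff n (vadd n u z) z = u"
        by (auto simp: vdiff_def vadd_def space_lebR Rn_def PiE_iff extensional_def fun_eq_iff)
      have 2: "vadd n u z = vadd n z u"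
        by (simp add: vadd_def add.commute)
      show "ennreal (norm ((indicat_real \<Omega> (vadd n u z) - indicat_real \<Omega> z) * p (vdiff n (vadd n u z) z))) =
          ennreal (p u) * ennreal \<bar>indicat_real \<Omega> z - indicat_real \<Omega> (vadd n z u)\<bar>"
        unfolding 1 unfolding 2
        by (simp add: abs_mult p_nonneg abs_minus_commute mult.commute ennreal_mult')
    qed
    finally show ?thesis .
  qed
  have m: "(\<lambda>q. ennreal (p (snd q)) * ennreal \<bar>indicat_real \<Omega> (fst q) - indicat_real \<Omega> (vadd n (fst q) (snd q))\<bar>)
      \<in> borel_measurable (lebR n \<Otimes>\<^sub>M lebR n)"
  proof -
    have [measurable]: "(\<lambda>q. indicat_real \<Omega> (vadd n (fst q) (snd q))) \<in> borel_measurable (lebR n \<Otimes>\<^sub>M lebR n)"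
      by (intro measurable_compose[OF _ \<Omega>_meas] measurable_vadd) auto
    show ?thesis
      by measurable
  qed
  have "ennreal (LINT z|lebR n. \<bar>\<Theta> z - indicat_real \<Omega> z\<bar>) = (\<integral>\<^sup>+z. ennreal \<bar>\<Theta> z - indicat_real \<Omega> z\<bar> \<partial>lebR n)"
    using \<Theta>_int \<Omega>_int by (intro nn_integral_eq_integral[symmetric]) auto
  also have "\<dots> \<le> (\<integral>\<^sup>+z. \<integral>\<^sup>+u. ennreal (p u) * ennreal \<bar>indicat_real \<Omega> z - indicat_real \<Omega> (vadd n z u)\<bar> \<partial>lebR n \<partial>lebR n)"
    by (intro nn_integral_mono pointwise)
  also have "\<dots> = (\<integral>\<^sup>+u. \<integral>\<^sup>+z. ennreal (p u) * ennreal \<bar>indicat_real \<Omega> z - indicat_real \<Omega> (vadd n z u)\<bar> \<partial>lebR n \<partial>lebR n)"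
    using m by (intro LL.Fubini'[symmetric]) (simp add: case_prod_unfold)
  also have "\<dots> \<le> (\<integral>\<^sup>+u. ennreal (enorm n u * p u * perimeter n \<Omega>) \<partial>lebR n)"
  proof (intro nn_integral_mono)
    fix u
    have v_int: "integrable (lebR n) (\<lambda>z. indicat_real \<Omega> (vadd n z u))"
      using \<Omega>_int integrable_vadd_iff[of "indicat_real \<Omega>" n u] by simp
    have [measurable]: "(\<lambda>z. indicat_real \<Omega> (vadd n z u)) \<in> borel_measurable (lebR n)"
      using v_int by (rule borel_measurable_integrable)
    have "(\<integral>\<^sup>+z. ennreal (p u) * ennreal \<bar>indicat_real \<Omega> z - indicat_real \<Omega> (vadd n z u)\<bar> \<partial>lebR n) =
        ennreal (p u) * (\<integral>\<^sup>+z. ennreal \<bar>indicat_real \<Omega> z - indicat_real \<Omega> (vadd n z u)\<bar> \<partial>lebR n)"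
      by (rule nn_integral_cmult) measurable
    also have "(\<integral>\<^sup>+z. ennreal \<bar>indicat_real \<Omega> z - indicat_real \<Omega> (vadd n z u)\<bar> \<partial>lebR n) =
        ennreal (LINT z|lebR n. \<bar>indicat_real \<Omega> z - indicat_real \<Omega> (vadd n z u)\<bar>)"
      using \<Omega>_int v_int by (intro nn_integral_eq_integral) auto
    also have "ennreal (p u) * \<dots> \<le> ennreal (p u) * ennreal (enorm n u * perimeter n \<Omega>)"
      by (intro mult_left_mono ennreal_leI translation_le_perimeter[OF fin \<Omega>_cube]) simp
    also have "\<dots> = ennreal (enorm n u * p u * perimeter n \<Omega>)"
      using per by (simp add: p_nonneg mult_ac L2_set_nonneg flip: ennreal_mult)
    finally show "(\<integral>\<^sup>+z. ennreal (p u) * ennreal \<bar>indicat_real \<Omega> z - indicat_real \<Omega> (vadd n z u)\<bar> \<partial>lebR n) \<le>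
        ennreal (enorm n u * p u * perimeter n \<Omega>)" .
  qed
  also have "\<dots> = ennreal (LINT u|lebR n. enorm n u * p u * perimeter n \<Omega>)"
    using p_moment per by (intro nn_integral_eq_integral) (auto simp: p_nonneg L2_set_nonneg)
  also have "\<dots> = ennreal ((LINT u|lebR n. enorm n u * p u) * perimeter n \<Omega>)"
    by simp
  finally show ?thesis
    using per by (subst (asm) ennreal_le_iff)
      (auto intro!: mult_nonneg_nonneg integral_nonneg_AE simp: p_nonneg L2_set_nonneg)
qed

end

section \<open>The localization operator and the final estimate\<close>

locale localization =
  fixes d :: nat and g :: "vec \<Rightarrow> complex" and \<Omega> :: "vec set" and N :: enat
    and lam :: "nat \<Rightarrow> real" and h :: "nat \<Rightarrow> vec \<Rightarrow> complex"
  assumes g_Mstar: "g \<in> Mstar d" and g_norm: "L2_norm d g = 1"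
    and \<Omega>_Rn: "\<Omega> \<subseteq> Rn (2 * d)" and \<Omega>_compact: "compact \<Omega>" and fin: "finite_perimeter (2 * d) \<Omega>"
    and eig: "eigensystem d g \<Omega> N lam h"
begin

definition p :: "vec \<Rightarrow> real" where
  "p u = (cmod (stft d g g u))\<^sup>2"

definition D :: real where
  "D = (Mstar_norm d g)\<^sup>2 * perimeter (2 * d) \<Omega>"

text \<open>A density keeps all of phase space as the underlying space, so measurability carries
  over from \<open>lebR (2 * d)\<close> unchanged, while the total mass is |\<Omega>|.\<close>

definition Nu :: "vec measure" where
  "Nu = density (lebR (2 * d)) (\<lambda>z. ennreal (indicat_real \<Omega> z))"

text \<open>\<open>smoothed_set\<close> takes the size of an enclosing cube as a parameter, so one
  is fixed by choice.\<close>

definition rad :: real where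
  "rad = (SOME r. \<Omega> \<subseteq> cube (2 * d) r)"

lemma g_sq: "g \<in> sq_int (lebR d)"
  using g_Mstar by (simp add: Mstar_def L2_eq_sq_int)

lemma sq_norm_g: "sq_norm (lebR d) g = 1"
  using g_norm by (simp add: L2_norm_eq_sq_norm)

lemma \<Omega>_rad: "\<Omega> \<subseteq> cube (2 * d) rad"
proof -
  obtain r where "\<Omega> \<subseteq> cube (2 * d) r"
    using compact_subset_cube[OF \<Omega>_compact \<Omega>_Rn] .
  then show ?thesis
    unfolding rad_def by (rule someI)
qed

sublocale S: smoothed_set "2 * d" p \<Omega> rad
proof
  show "p \<in> borel_measurable (lebR (2 * d))"
    unfolding p_def[abs_def] using stft_measurable[OF g_sq g_sq] by measurable
  show "(\<integral>\<^sup>+u. ennreal (p u) \<partial>lebR (2 * d)) = 1"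
    unfolding p_def using moyal[OF g_sq g_sq] by (simp add: sq_norm_g)
  show "integrable (lebR (2 * d)) (\<lambda>u. enorm (2 * d) u * p u)"
    using g_Mstar by (simp add: Mstar_def p_def)
qed (simp_all add: p_def fin \<Omega>_rad)

lemma D_eq: "(LINT u|lebR (2 * d). enorm (2 * d) u * p u) * perimeter (2 * d) \<Omega> = D"
proof -
  have "0 \<le> (LINT u|lebR (2 * d). enorm (2 * d) u * p u)"
    by (intro integral_nonneg_AE AE_I2) (simp add: p_def L2_set_nonneg)
  then show ?thesis
    by (simp add: D_def Mstar_norm_def p_def)
qed

lemma sets_Nu: "sets Nu = sets (lebR (2 * d))"
  by (simp add: Nu_def)

lemma nn_integral_Nu:
  "f \<in> borel_measurable (lebR (2 * d)) \<Longrightarrow> (\<integral>\<^sup>+z. f z \<partial>Nu) = (\<integral>\<^sup>+z. indicator \<Omega> z * f z \<partial>lebR (2 * d))"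
  unfolding Nu_def by (subst nn_integral_density) (auto simp: ennreal_indicator)

lemma integral_Nu:
  fixes f :: "vec \<Rightarrow> 'b::{banach, second_countable_topology}"
  assumes "f \<in> borel_measurable (lebR (2 * d))"
  shows "(LINT z|Nu. f z) = (LINT z|lebR (2 * d). indicat_real \<Omega> z *\<^sub>R f z)"
  unfolding Nu_def by (subst integral_density) (use assms in auto)

lemma emeasure_Nu: "emeasure Nu (space Nu) = emeasure (lebR (2 * d)) \<Omega>"
  using nn_integral_Nu[of "\<lambda>_. 1"] by simp

lemma measure_Nu: "measure Nu (space Nu) = measure (lebR (2 * d)) \<Omega>"
  by (simp add: measure_def emeasure_Nu)

sublocale VF: vector_family Nu "lebR d" "tf_shift d g"
proof -
  have "finite_measure Nu"
    by (rule finite_measureI) (use emeasure_Nu S.\<Omega>_finite in auto)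
  moreover have "case_prod (tf_shift d g) \<in> borel_measurable (Nu \<Otimes>\<^sub>M lebR d)"
    using tf_shift_measurable[OF g_sq]
    by (simp cong: measurable_cong_sets sets_pair_measure_cong add: sets_Nu)
  ultimately show "vector_family Nu (lebR d) (tf_shift d g)"
    using sigma_finite_lebR tf_shift_sq_int[OF g_sq] sq_norm_tf_shift[OF g_sq] sq_norm_g
    by (simp add: vector_family_def vector_family_axioms_def)
qed

lemma V_eq_stft: "VF.V f z = stft d g f z"
  by (simp add: VF.V_def stft_eq_ip)

lemma synth_eq_loc_op:
  assumes f: "f \<in> sq_int (lebR d)" and t: "t \<in> space (lebR d)"
  shows "VF.synth (VF.V f) t = loc_op d g \<Omega> f t"
proof -
  have "(\<lambda>z. tf_shift d g z t) \<in> borel_measurable (lebR (2 * d))"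
    using measurable_Pair1[OF tf_shift_measurable[OF g_sq] t] by simp
  then have "(\<lambda>z. VF.V f z * tf_shift d g z t) \<in> borel_measurable (lebR (2 * d))"
    using stft_measurable[OF g_sq f] by (simp add: V_eq_stft)
  then show ?thesis
    unfolding VF.synth_def
    by (subst integral_Nu) (simp_all add: loc_op_def set_lebesgue_integral_def V_eq_stft tf_shift_def mult.assoc)
qed

lemma AE_loc_op_iff:
  "f \<in> sq_int (lebR d) \<Longrightarrow> (AE t in lebR d. VF.synth (VF.V f) t = c * f t) \<longleftrightarrow> (AE t in lebR d. loc_op d g \<Omega> f t = c * f t)"
  by (intro AE_cong) (simp add: synth_eq_loc_op)

sublocale EF: eigen_family Nu "lebR d" "tf_shift d g" h lam "eigen_indices N"
proof
  note e = eig[unfolded eigensystem_def is_eigenfunction_def L2_eq_sq_int L2_inner_eq_ip]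
  show "orthonormal (lebR d) (eigen_indices N) h"
    using e by (simp add: orthonormal_def)
  show "lam k \<noteq> 0" if "k \<in> eigen_indices N" for k
    using e that by simp
  show "AE t in lebR d. VF.synth (VF.V (h k)) t = complex_of_real (lam k) * h k t" if "k \<in> eigen_indices N" for k
    using e that by (subst AE_loc_op_iff) simp_all
  show "\<exists>F c. finite F \<and> F \<subseteq> {k \<in> eigen_indices N. complex_of_real (lam k) = \<mu>} \<and>
        (AE t in lebR d. f t = (\<Sum>k\<in>F. c k * h k t))"
    if "\<mu> \<noteq> 0" "f \<in> sq_int (lebR d)" "\<not> (AE t in lebR d. f t = 0)" "AE t in lebR d. VF.synth (VF.V f) t = \<mu> * f t"
    for \<mu> f
  proof -
    have "AE t in lebR d. loc_op d g \<Omega> f t = \<mu> * f t"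
      using that by (simp add: AE_loc_op_iff)
    moreover note e[THEN conjunct2, THEN conjunct2, THEN conjunct2, rule_format, of \<mu> f]
    ultimately show ?thesis
      using that by blast
  qed
qed

text \<open>The eigenvalue is the share of the unit energy of \<open>h k\<close> that lies over
  \<Omega>; compared with \<open>spectrogram_total\<close> this bounds it by 1.\<close>

lemma spectrogram_local:
  assumes "k \<in> eigen_indices N"
  shows "(\<integral>\<^sup>+z. indicator \<Omega> z * ennreal ((cmod (stft d g (h k) z))\<^sup>2) \<partial>lebR (2 * d)) = ennreal (lam k)"
proof -
  note hk = EF.h_sq_int[OF assms]
  have "VF.V (h k) \<in> sq_int Nu"
    by (intro VF.N.bdd_meas_sq_int VF.V_bdd_meas hk)
  from nn_integral_norm_square[OF this]
  have "(\<integral>\<^sup>+z. ennreal ((cmod (stft d g (h k) z))\<^sup>2) \<partial>Nu) = ennreal (lam k)"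
    by (simp add: V_eq_stft EF.sq_norm_V_eigen[OF assms])
  then show ?thesis
    using stft_measurable[OF g_sq hk] by (subst (asm) nn_integral_Nu) auto
qed

lemma spectrogram_total:
  assumes "k \<in> eigen_indices N"
  shows "(\<integral>\<^sup>+z. ennreal ((cmod (stft d g (h k) z))\<^sup>2) \<partial>lebR (2 * d)) = 1"
  using moyal[OF g_sq EF.h_sq_int[OF assms]] orthonormal_ip[OF EF.h_orthonormal assms assms]
  by (simp add: sq_norm_g ip_self)

text \<open>By covariance the spectrogram of a shifted \<open>g\<close> is a translate of
  \<open>p\<close>, and integrating it over \<Omega> gives \<Theta>. Through this identity the
  spectral bound becomes an expansion of \<Theta>.\<close>

lemma sq_norm_V_tf_shift: "sq_norm Nu (VF.V (tf_shift d g z)) = S.\<Theta> z"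
proof -
  have "(\<lambda>w. (cmod (stft d g (tf_shift d g z) w))\<^sup>2) \<in> borel_measurable (lebR (2 * d))"
    using stft_measurable[OF g_sq tf_shift_sq_int[OF g_sq]] by measurable
  then show ?thesis
    unfolding sq_norm_def V_eq_stft
    by (subst integral_Nu) (simp_all add: S.\<Theta>_def p_def cmod_stft_tf_shift[OF g_sq])
qed

sublocale SE: spectrogram_expansion "lebR (2 * d)" \<Omega> S.\<Theta> D N lam "\<lambda>k z. (cmod (stft d g (h k) z))\<^sup>2"
proof
  show "(LINT z|lebR (2 * d). \<bar>S.\<Theta> z - indicat_real \<Omega> z\<bar>) \<le> D"
    using S.\<Theta>_close by (simp only: D_eq)
  show "lam k \<le> 1" if k: "k \<in> eigen_indices N" for k
  proof -
    have "ennreal (lam k) \<le> (\<integral>\<^sup>+z. ennreal ((cmod (stft d g (h k) z))\<^sup>2) \<partial>lebR (2 * d))"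
      unfolding spectrogram_local[OF k, symmetric]
      by (intro nn_integral_mono) (simp add: indicator_def)
    then show ?thesis
      by (simp add: spectrogram_total[OF k] ennreal_le_1)
  qed
  show "lam k \<le> lam j" if "j \<in> eigen_indices N" "k \<in> eigen_indices N" "j \<le> k" for j k
    using eig that unfolding eigensystem_def by blast
  show "(\<Sum>k\<in>A. lam k) \<le> measure (lebR (2 * d)) \<Omega>" if "finite A" "A \<subseteq> eigen_indices N" for A
    using EF.sum_lam_le[OF that(2,1)] by (simp add: measure_Nu)
  show "(\<lambda>z. (cmod (stft d g (h k) z))\<^sup>2) \<in> borel_measurable (lebR (2 * d))" if "k \<in> eigen_indices N" for k
    using stft_measurable[OF g_sq EF.h_sq_int[OF that]] by measurable
  \<comment> \<open>\<open>spectral_gap\<close> for the unit vector \<open>tf_shift d g z\<close>,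
    whose coefficients have the same moduli as the transforms of the \<open>h k\<close> at
    \<open>z\<close>.\<close>
  show "\<bar>S.\<Theta> z - (\<Sum>k\<in>A. lam k * (cmod (stft d g (h k) z))\<^sup>2)\<bar> \<le> c"
    if "finite A" "A \<subseteq> eigen_indices N" "0 \<le> c" "\<And>k. k \<in> eigen_indices N - A \<Longrightarrow> lam k \<le> c" for A c z
  proof -
    have "cmod (ip (lebR d) (tf_shift d g z) (h k)) = cmod (stft d g (h k) z)" for k
      by (simp add: stft_eq_ip ip_cnj[of _ "tf_shift d g z"])
    then show ?thesis
      using EF.spectral_gap[OF that(2,1) tf_shift_sq_int[OF g_sq] that(3,4), of z]
      by (simp add: sq_norm_V_tf_shift sq_norm_tf_shift[OF g_sq] sq_norm_g)
  qed
qed (auto simp: S.\<Omega>_int S.\<Theta>_int S.\<Theta>_nonneg S.\<Theta>_total EF.lam_pos spectrogram_local spectrogram_total)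

lemma acc_spectrogram_eq: "acc_spectrogram d g \<Omega> h z = SE.\<rho> z"
  by (simp add: acc_spectrogram_def SE.\<rho>_def SE.A\<^sub>0_def ceil_measure_def)

theorem sym_diff_le:
  assumes "1 \<le> D"
  shows "emeasure (lebR (2 * d)) (sym_diff \<Omega> {z \<in> Rn (2 * d). acc_spectrogram d g \<Omega> h z > 1 / 2}) \<le> ennreal (8 * D)"
  using SE.symmetric_difference_le[OF assms] by (simp add: acc_spectrogram_eq space_lebR)

end

theorem theorem6p2:
  shows "\<exists>C::real. C > 0 \<and>
    (\<forall>(d::nat) (g :: vec \<Rightarrow> complex) (\<Omega> :: vec set) (N::enat)
       (lam :: nat \<Rightarrow> real) (h :: nat \<Rightarrow> vec \<Rightarrow> complex) (\<Omega>' :: vec set).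
       d \<ge> 1 \<longrightarrow>
       g \<in> Mstar d \<longrightarrow> L2_norm d g = 1 \<longrightarrow>
       \<Omega> \<subseteq> Rn (2 * d) \<longrightarrow> compact \<Omega> \<longrightarrow> finite_perimeter (2 * d) \<Omega> \<longrightarrow>
       (Mstar_norm d g)\<^sup>2 * perimeter (2 * d) \<Omega> \<ge> 1 \<longrightarrow>
       eigensystem d g \<Omega> N lam h \<longrightarrow>
       \<Omega>' = {z \<in> Rn (2 * d). acc_spectrogram d g \<Omega> h z > 1 / 2} \<longrightarrow>
       emeasure (lebR (2 * d)) (sym_diff \<Omega> \<Omega>')
         \<le> ennreal (C * (Mstar_norm d g)\<^sup>2 * perimeter (2 * d) \<Omega>))"
proof (intro exI[of _ 8] conjI allI impI)
  fix d g \<Omega> N lam h \<Omega>'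
  assume a: "g \<in> Mstar d" "L2_norm d g = 1" "\<Omega> \<subseteq> Rn (2 * d)" "compact \<Omega>" "finite_perimeter (2 * d) \<Omega>"
    "(Mstar_norm d g)\<^sup>2 * perimeter (2 * d) \<Omega> \<ge> 1" "eigensystem d g \<Omega> N lam h"
    and \<Omega>': "\<Omega>' = {z \<in> Rn (2 * d). acc_spectrogram d g \<Omega> h z > 1 / 2}"
  interpret localization d g \<Omega> N lam h
    by standard (use a in auto)
  \<comment> \<open>The 8 does not depend on \<open>d\<close>: all dimension-dependent bounds were
    confined to dominating functions.\<close>
  show "emeasure (lebR (2 * d)) (sym_diff \<Omega> \<Omega>') \<le> ennreal (8 * (Mstar_norm d g)\<^sup>2 * perimeter (2 * d) \<Omega>)"
    using sym_diff_le a(6) unfolding \<Omega>' D_def by (simp add: mult.assoc)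
qed simp

end
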